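(* Let $R$ be a commutative ring and let $\mathcal C$ be a Hom-finite, Krull-Schmidt, triangulated $R$-category with shift functor $[1]$. Suppose $X\xrightarrow{f}M\xrightarrow{g}Y\xrightarrow{w}X[1]$ is an Auslander-Reiten triangle in $\mathcal C$ such that $X[1]\notin\mathrm{add}(M\oplus Y)$. If $N$ is an object in $\mathcal C$ such that none of $X$, $Y$, $X[1]$ and $Y[-1]$ belongs to $\mathrm{add}(N)$, then $\mathrm{End}_{\mathcal C}(N\oplus M\oplus X)$ and $\mathrm{End}_{\mathcal C}(N\oplus M\oplus Y)$ are derived-equivalent via a tilting module. In particular, $\mathrm{End}_{\mathcal C}(M\oplus X)$ and $\mathrm{End}_{\mathcal C}(M\oplus Y)$ are derived-equivalent via a tilting module.
   Context: Composition of $f:X\to Y$ and $g:Y\to Z$ is written $fg$, and endomorphism rings use this multiplication; modules are left modules. $\mathrm{add}(N)$ is the full subcategory of direct summands of finite sums of copies of $N$. A triangulated $R$-category $\mathcal C$ is Hom-finite if $\mathrm{Hom}_{\mathcal C}(X,Y)$ has finite length as an $R$-module for all $X,Y$. A triangle $X\xrightarrow{f}M\xrightarrow{g}Y\xrightarrow{w}X[1]$ in $\mathcal C$ is an Auslander-Reiten triangle if (AR1) $X$ and $Y$ are indecomposable; (AR2) $w\ne0$; (AR3) if $t:U\to Y$ is not a split epimorphism, then $tw=0$. Rings $A$ and $B$ are derived-equivalent if the bounded derived categories of $A$-Mod and $B$-Mod are equivalent as triangulated categories. An $A$-module $T$ is a tilting module if it has a finite resolution by finitely generated projective modules, $\mathrm{Ext}^i_A(T,T)=0$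 for all $i>0$, and there is an exact sequence $0\to A\to T^0\to\cdots\to T^m\to0$ with all $T^i\in\mathrm{add}(T)$. $A$ and $B$ are derived-equivalent via a tilting module if there is a tilting $A$-module $T$ with $B\simeq\mathrm{End}_A(T)$. *)

theory Defs
  imports "HOL-Algebra.Module" "HOL-Algebra.QuotRing"
begin

section \<open>Left modules over a not necessarily commutative ring\<close>

text \<open>
  The locale \<open>module\<close> of HOL-Algebra requires a commutative ring of scalars. Its record type and
  its locale \<open>submodule\<close> do not and are reused here; the fields \<open>mult\<close> and \<open>one\<close> of a module
  record carry no meaning.
\<close>

locale left_module = A?: ring A + M?: abelian_group M
  for A :: "('a, 'b) ring_scheme" (structure) and M :: "('a, 'm) module" (structure) +
  assumes smult_closed [simp, intro]:
      "\<lbrakk>a \<in> carrier A; x \<in> carrier M\<rbrakk> \<Longrightarrow> a \<odot>\<^bsub>M\<^esub> x \<in> carrier M"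
    and smult_l_distr:
      "\<lbrakk>a \<in> carrier A; b \<in> carrier A; x \<in> carrier M\<rbrakk>
        \<Longrightarrow> (a \<oplus>\<^bsub>A\<^esub> b) \<odot>\<^bsub>M\<^esub> x = a \<odot>\<^bsub>M\<^esub> x \<oplus>\<^bsub>M\<^esub> b \<odot>\<^bsub>M\<^esub> x"
    and smult_r_distr:
      "\<lbrakk>a \<in> carrier A; x \<in> carrier M; y \<in> carrier M\<rbrakk>
        \<Longrightarrow> a \<odot>\<^bsub>M\<^esub> (x \<oplus>\<^bsub>M\<^esub> y) = a \<odot>\<^bsub>M\<^esub> x \<oplus>\<^bsub>M\<^esub> a \<odot>\<^bsub>M\<^esub> y"
    and smult_assoc:
      "\<lbrakk>a \<in> carrier A; b \<in> carrier A; x \<in> carrier M\<rbrakk>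
        \<Longrightarrow> (a \<otimes>\<^bsub>A\<^esub> b) \<odot>\<^bsub>M\<^esub> x = a \<odot>\<^bsub>M\<^esub> (b \<odot>\<^bsub>M\<^esub> x)"
    and smult_one [simp]:
      "x \<in> carrier M \<Longrightarrow> \<one>\<^bsub>A\<^esub> \<odot>\<^bsub>M\<^esub> x = x"

text \<open>
  Homomorphisms are extensional functions, so that equal maps on the carrier are equal in HOL.
\<close>

definition module_hom ::
  "('a, 'b) ring_scheme \<Rightarrow> ('a, 'm) module \<Rightarrow> ('a, 'n) module \<Rightarrow> ('m \<Rightarrow> 'n) set"
  where "module_hom A M N =
    {\<phi> \<in> carrier M \<rightarrow>\<^sub>E carrier N.
       (\<forall>x\<in>carrier M. \<forall>y\<in>carrier M. \<phi> (x \<oplus>\<^bsub>M\<^esub> y) = \<phi> x \<oplus>\<^bsub>N\<^esub> \<phi> y) \<and>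
       (\<forall>a\<in>carrier A. \<forall>x\<in>carrier M. \<phi> (a \<odot>\<^bsub>M\<^esub> x) = a \<odot>\<^bsub>N\<^esub> \<phi> x)}"

definition module_kernel :: "('a, 'm) module \<Rightarrow> ('a, 'n) module \<Rightarrow> ('m \<Rightarrow> 'n) \<Rightarrow> 'm set"
  where "module_kernel M N \<phi> = {x \<in> carrier M. \<phi> x = \<zero>\<^bsub>N\<^esub>}"

text \<open>The product of \<open>\<phi>\<close> and \<open>\<psi>\<close> in the endomorphism ring is \<open>\<phi>\<close> followed by \<open>\<psi>\<close>.\<close>

definition module_End_ring :: "('a, 'b) ring_scheme \<Rightarrow> ('a, 'm) module \<Rightarrow> ('m \<Rightarrow> 'm) ring"
  where "module_End_ring A M =
    \<lparr>carrier = module_hom A M M,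
     monoid.mult = (\<lambda>\<phi> \<psi>. \<lambda>x\<in>carrier M. \<psi> (\<phi> x)),
     one = (\<lambda>x\<in>carrier M. x),
     zero = (\<lambda>x\<in>carrier M. \<zero>\<^bsub>M\<^esub>),
     add = (\<lambda>\<phi> \<psi>. \<lambda>x\<in>carrier M. \<phi> x \<oplus>\<^bsub>M\<^esub> \<psi> x)\<rparr>"

definition regular_module :: "('a, 'b) ring_scheme \<Rightarrow> ('a, 'a) module"
  where "regular_module A =
    \<lparr>carrier = carrier A, monoid.mult = monoid.mult A, one = \<one>\<^bsub>A\<^esub>,
     zero = \<zero>\<^bsub>A\<^esub>, add = add A, smult = monoid.mult A\<rparr>"

definition module_power :: "('a, 'm) module \<Rightarrow> nat \<Rightarrow> ('a, nat \<Rightarrow> 'm) module"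
  where "module_power M n =
    \<lparr>carrier = {..<n} \<rightarrow>\<^sub>E carrier M,
     monoid.mult = (\<lambda>x y. undefined),
     one = undefined,
     zero = (\<lambda>i\<in>{..<n}. \<zero>\<^bsub>M\<^esub>),
     add = (\<lambda>x y. \<lambda>i\<in>{..<n}. x i \<oplus>\<^bsub>M\<^esub> y i),
     smult = (\<lambda>a x. \<lambda>i\<in>{..<n}. a \<odot>\<^bsub>M\<^esub> x i)\<rparr>"

definition module_direct_summand ::
  "('a, 'b) ring_scheme \<Rightarrow> ('a, 'm) module \<Rightarrow> ('a, 'n) module \<Rightarrow> bool"
  where "module_direct_summand A U W \<longleftrightarrow>
    left_module A U \<and>
    (\<exists>\<iota>\<in>module_hom A U W. \<exists>L. inj_on \<iota> (carrier U) \<and> submodule L A W \<and>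
       \<iota> ` carrier U \<inter> L = {\<zero>\<^bsub>W\<^esub>} \<and>
       (\<forall>w\<in>carrier W. \<exists>u\<in>carrier U. \<exists>l\<in>L. w = \<iota> u \<oplus>\<^bsub>W\<^esub> l))"

definition in_module_add ::
  "('a, 'b) ring_scheme \<Rightarrow> ('a, 'm) module \<Rightarrow> ('a, 'n) module \<Rightarrow> bool"
  where "in_module_add A T U \<longleftrightarrow> (\<exists>n. module_direct_summand A U (module_power T n))"

definition finitely_generated :: "('a, 'b) ring_scheme \<Rightarrow> ('a, 'm) module \<Rightarrow> bool"
  where "finitely_generated A M \<longleftrightarrow>
    (\<exists>S. finite S \<and> S \<subseteq> carrier M \<and> (\<forall>H. submodule H A M \<and> S \<subseteq> H \<longrightarrow> H = carrier M))"

text \<open>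
  Projectivity is the lifting property. A HOL formula fixes the types of the test modules \<open>M\<close> and
  \<open>N\<close>. Those chosen here lose nothing: they include the canonical surjection onto \<open>P\<close> from the
  free module of finitely supported functions on \<open>carrier P\<close>, and lifting the identity of \<open>P\<close>
  along it makes \<open>P\<close> a direct summand of a free module.
\<close>

definition projective_module :: "('a, 'b) ring_scheme \<Rightarrow> ('a, 'p) module \<Rightarrow> bool"
  where "projective_module A P \<longleftrightarrow>
    left_module A P \<and>
    (\<forall>(M :: ('a, 'p \<Rightarrow> 'a) module) (N :: ('a, 'p) module).
       left_module A M \<longrightarrow> left_module A N \<longrightarrow>
       (\<forall>\<epsilon>\<in>module_hom A M N. \<forall>\<phi>\<in>module_hom A P N. \<epsilon> ` carrier M = carrier N \<longrightarrow>
          (\<exists>\<psi>\<in>module_hom A P M. \<forall>x\<in>carrier P. \<epsilon> (\<psi> x) = \<phi> x)))"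

text \<open>\<open>\<dots> \<rightarrow> P 1 \<rightarrow> P 0 \<rightarrow> M \<rightarrow> 0\<close> with \<open>\<delta> i : P (i + 1) \<rightarrow> P i\<close> and augmentation \<open>\<epsilon>\<close>.\<close>

definition projective_resolution ::
  "('a, 'b) ring_scheme \<Rightarrow> (nat \<Rightarrow> ('a, 'p) module) \<Rightarrow> (nat \<Rightarrow> 'p \<Rightarrow> 'p) \<Rightarrow> ('p \<Rightarrow> 'm)
     \<Rightarrow> ('a, 'm) module \<Rightarrow> bool"
  where "projective_resolution A P \<delta> \<epsilon> M \<longleftrightarrow>
    (\<forall>i. projective_module A (P i)) \<and>
    (\<forall>i. \<delta> i \<in> module_hom A (P (Suc i)) (P i)) \<and>
    \<epsilon> \<in> module_hom A (P 0) M \<and>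
    \<epsilon> ` carrier (P 0) = carrier M \<and>
    \<delta> 0 ` carrier (P 1) = module_kernel (P 0) M \<epsilon> \<and>
    (\<forall>i. \<delta> (Suc i) ` carrier (P (Suc (Suc i))) = module_kernel (P (Suc i)) (P i) (\<delta> i))"

definition Ext_cocycles ::
  "('a, 'b) ring_scheme \<Rightarrow> (nat \<Rightarrow> ('a, 'p) module) \<Rightarrow> (nat \<Rightarrow> 'p \<Rightarrow> 'p) \<Rightarrow> ('a, 'n) module
     \<Rightarrow> nat \<Rightarrow> ('p \<Rightarrow> 'n) set"
  where "Ext_cocycles A P \<delta> N i =
    {\<phi> \<in> module_hom A (P i) N. \<forall>x\<in>carrier (P (Suc i)). \<phi> (\<delta> i x) = \<zero>\<^bsub>N\<^esub>}"

fun Ext_coboundaries ::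
  "('a, 'b) ring_scheme \<Rightarrow> (nat \<Rightarrow> ('a, 'p) module) \<Rightarrow> (nat \<Rightarrow> 'p \<Rightarrow> 'p) \<Rightarrow> ('a, 'n) module
     \<Rightarrow> nat \<Rightarrow> ('p \<Rightarrow> 'n) set"
  where
    "Ext_coboundaries A P \<delta> N 0 = {\<lambda>x\<in>carrier (P 0). \<zero>\<^bsub>N\<^esub>}"
  | "Ext_coboundaries A P \<delta> N (Suc i) =
      (\<lambda>\<psi>. \<lambda>x\<in>carrier (P (Suc i)). \<psi> (\<delta> i x)) ` module_hom A (P i) N"

text \<open>
  \<open>Ext\<^sup>i(M, N) = 0\<close>, computed as the cohomology of \<open>Hom(P, N)\<close>. The result does not depend on the
  projective resolution \<open>P\<close> of \<open>M\<close>, so that any one of them may be used. The element type of the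
  resolution is large enough for one to exist: all terms of the standard resolution by free
  modules have at most \<open>max(\<aleph>\<^sub>0, |A|, |M|)\<close> elements.
\<close>

definition Ext_zero ::
  "('a, 'b) ring_scheme \<Rightarrow> nat \<Rightarrow> ('a, 'm) module \<Rightarrow> ('a, 'n) module \<Rightarrow> bool"
  where "Ext_zero A i M N \<longleftrightarrow>
    (\<exists>(P :: nat \<Rightarrow> ('a, nat \<Rightarrow> 'a \<times> 'm) module) \<delta> \<epsilon>.
       projective_resolution A P \<delta> \<epsilon> M \<and> Ext_cocycles A P \<delta> N i = Ext_coboundaries A P \<delta> N i)"

text \<open>
  A finitely generated projective module is isomorphic to a submodule of some \<open>A\<^sup>n\<close>, so the element
  type below is no restriction.
\<close>

definition finite_fg_projective_dim ::
  "('a, 'b) ring_scheme \<Rightarrow> ('a, 'm) module \<Rightarrow> bool"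
  where "finite_fg_projective_dim A M \<longleftrightarrow>
    (\<exists>(P :: nat \<Rightarrow> ('a, nat \<Rightarrow> 'a \<times> 'm) module) \<delta> \<epsilon> n.
       projective_resolution A P \<delta> \<epsilon> M \<and> (\<forall>i. finitely_generated A (P i)) \<and>
       (\<forall>i>n. carrier (P i) = {\<zero>\<^bsub>P i\<^esub>}))"

text \<open>
  An exact sequence \<open>0 \<rightarrow> A \<rightarrow> Q 0 \<rightarrow> \<dots> \<rightarrow> Q m \<rightarrow> 0\<close> with all \<open>Q i\<close> in \<open>add(T)\<close>, continued by zero
  modules. Every module in \<open>add(T)\<close> is isomorphic to a submodule of some \<open>T\<^sup>n\<close>, so the element
  type of the \<open>Q i\<close> is no restriction.
\<close>

definition finite_add_coresolution ::
  "('a, 'b) ring_scheme \<Rightarrow> ('a, 'm) module \<Rightarrow> bool"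
  where "finite_add_coresolution A T \<longleftrightarrow>
    (\<exists>(Q :: nat \<Rightarrow> ('a, nat \<Rightarrow> 'm) module) d \<eta> m.
       (\<forall>i. in_module_add A T (Q i)) \<and>
       (\<forall>i>m. carrier (Q i) = {\<zero>\<^bsub>Q i\<^esub>}) \<and>
       \<eta> \<in> module_hom A (regular_module A) (Q 0) \<and>
       (\<forall>i. d i \<in> module_hom A (Q i) (Q (Suc i))) \<and>
       inj_on \<eta> (carrier A) \<and>
       \<eta> ` carrier A = module_kernel (Q 0) (Q 1) (d 0) \<and>
       (\<forall>i. d i ` carrier (Q i) = module_kernel (Q (Suc i)) (Q (Suc (Suc i))) (d (Suc i))))"

definition tilting_module :: "('a, 'b) ring_scheme \<Rightarrow> ('a, 'm) module \<Rightarrow> bool"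
  where "tilting_module A T \<longleftrightarrow>
    left_module A T \<and>
    finite_fg_projective_dim A T \<and>
    (\<forall>i>0. Ext_zero A i T T) \<and>
    finite_add_coresolution A T"

text \<open>
  A tilting module is finitely generated, hence isomorphic to a quotient of some \<open>A\<^sup>n\<close>. The elements
  of such a quotient are cosets, that is, sets of functions \<open>nat \<Rightarrow> 'a\<close>, so the element type
  of \<open>T\<close> is no restriction.
\<close>

definition derived_equivalent_via_tilting ::
  "('a, 'b) ring_scheme \<Rightarrow> ('c, 'd) ring_scheme \<Rightarrow> bool"
  where "derived_equivalent_via_tilting A B \<longleftrightarrow>
    (\<exists>T :: ('a, (nat \<Rightarrow> 'a) set) module. tilting_module A T \<and> B \<simeq> module_End_ring A T)"


section \<open>Modules of finite length and local rings\<close>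

text \<open>The chain \<open>F\<close> is a composition series.\<close>

definition finite_length :: "('r, 's) ring_scheme \<Rightarrow> ('r, 'm) module \<Rightarrow> bool"
  where "finite_length R M \<longleftrightarrow>
    (\<exists>n (F :: nat \<Rightarrow> 'm set).
       F 0 = {\<zero>\<^bsub>M\<^esub>} \<and> F n = carrier M \<and> (\<forall>i\<le>n. submodule (F i) R M) \<and>
       (\<forall>i<n. F i \<subset> F (Suc i) \<and> \<not> (\<exists>H. submodule H R M \<and> F i \<subset> H \<and> H \<subset> F (Suc i))))"

definition local_ring :: "('a, 'b) ring_scheme \<Rightarrow> bool"
  where "local_ring A \<longleftrightarrow>
    ring A \<and> \<one>\<^bsub>A\<^esub> \<noteq> \<zero>\<^bsub>A\<^esub> \<and>
    (\<forall>a\<in>carrier A - Units A. \<forall>b\<in>carrier A - Units A. a \<oplus>\<^bsub>A\<^esub> b \<notin> Units A)"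


section \<open>Linear categories\<close>

text \<open>
  The morphisms from \<open>X\<close> to \<open>Y\<close> are the elements of the module \<open>Mor C X Y\<close>. Morphism sets need
  not be disjoint, hence composition takes the objects as arguments: \<open>Comp C X Y Z f g\<close> is the
  composite of \<open>f : X \<rightarrow> Y\<close> followed by \<open>g : Y \<rightarrow> Z\<close>, written \<open>fg\<close> in diagrammatic order.
\<close>

record ('o, 'm, 'r) lin_cat =
  Obj :: "'o set"
  Mor :: "'o \<Rightarrow> 'o \<Rightarrow> ('r, 'm) module"
  Comp :: "'o \<Rightarrow> 'o \<Rightarrow> 'o \<Rightarrow> 'm \<Rightarrow> 'm \<Rightarrow> 'm"
  Ident :: "'o \<Rightarrow> 'm"

abbreviation Hom_set :: "('o, 'm, 'r, 'z) lin_cat_scheme \<Rightarrow> 'o \<Rightarrow> 'o \<Rightarrow> 'm set"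
  where "Hom_set C X Y \<equiv> carrier (Mor C X Y)"

locale linear_category = R?: cring R
  for R :: "('r, 's) ring_scheme" (structure) and C :: "('o, 'm, 'r, 'z) lin_cat_scheme" +
  assumes Mor_module:
      "\<lbrakk>X \<in> Obj C; Y \<in> Obj C\<rbrakk> \<Longrightarrow> module R (Mor C X Y)"
    and Ident_closed:
      "X \<in> Obj C \<Longrightarrow> Ident C X \<in> Hom_set C X X"
    and Comp_closed:
      "\<lbrakk>X \<in> Obj C; Y \<in> Obj C; Z \<in> Obj C; f \<in> Hom_set C X Y; g \<in> Hom_set C Y Z\<rbrakk>
        \<Longrightarrow> Comp C X Y Z f g \<in> Hom_set C X Z"
    and Comp_assoc:
      "\<lbrakk>W \<in> Obj C; X \<in> Obj C; Y \<in> Obj C; Z \<in> Obj C;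
        f \<in> Hom_set C W X; g \<in> Hom_set C X Y; h \<in> Hom_set C Y Z\<rbrakk>
        \<Longrightarrow> Comp C W Y Z (Comp C W X Y f g) h = Comp C W X Z f (Comp C X Y Z g h)"
    and Comp_Ident_left:
      "\<lbrakk>X \<in> Obj C; Y \<in> Obj C; f \<in> Hom_set C X Y\<rbrakk> \<Longrightarrow> Comp C X X Y (Ident C X) f = f"
    and Comp_Ident_right:
      "\<lbrakk>X \<in> Obj C; Y \<in> Obj C; f \<in> Hom_set C X Y\<rbrakk> \<Longrightarrow> Comp C X Y Y f (Ident C Y) = f"
    and Comp_add_left:
      "\<lbrakk>X \<in> Obj C; Y \<in> Obj C; Z \<in> Obj C;
        f \<in> Hom_set C X Y; f' \<in> Hom_set C X Y; g \<in> Hom_set C Y Z\<rbrakk>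
        \<Longrightarrow> Comp C X Y Z (f \<oplus>\<^bsub>Mor C X Y\<^esub> f') g
            = Comp C X Y Z f g \<oplus>\<^bsub>Mor C X Z\<^esub> Comp C X Y Z f' g"
    and Comp_add_right:
      "\<lbrakk>X \<in> Obj C; Y \<in> Obj C; Z \<in> Obj C;
        f \<in> Hom_set C X Y; g \<in> Hom_set C Y Z; g' \<in> Hom_set C Y Z\<rbrakk>
        \<Longrightarrow> Comp C X Y Z f (g \<oplus>\<^bsub>Mor C Y Z\<^esub> g')
            = Comp C X Y Z f g \<oplus>\<^bsub>Mor C X Z\<^esub> Comp C X Y Z f g'"
    and Comp_smult_left:
      "\<lbrakk>X \<in> Obj C; Y \<in> Obj C; Z \<in> Obj C; r \<in> carrier R;
        f \<in> Hom_set C X Y; g \<in> Hom_set C Y Z\<rbrakk>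
        \<Longrightarrow> Comp C X Y Z (r \<odot>\<^bsub>Mor C X Y\<^esub> f) g = r \<odot>\<^bsub>Mor C X Z\<^esub> Comp C X Y Z f g"
    and Comp_smult_right:
      "\<lbrakk>X \<in> Obj C; Y \<in> Obj C; Z \<in> Obj C; r \<in> carrier R;
        f \<in> Hom_set C X Y; g \<in> Hom_set C Y Z\<rbrakk>
        \<Longrightarrow> Comp C X Y Z f (r \<odot>\<^bsub>Mor C Y Z\<^esub> g) = r \<odot>\<^bsub>Mor C X Z\<^esub> Comp C X Y Z f g"

definition iso_mor :: "('o, 'm, 'r, 'z) lin_cat_scheme \<Rightarrow> 'o \<Rightarrow> 'o \<Rightarrow> 'm \<Rightarrow> bool"
  where "iso_mor C X Y f \<longleftrightarrow>
    f \<in> Hom_set C X Y \<and>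
    (\<exists>g\<in>Hom_set C Y X. Comp C X Y X f g = Ident C X \<and> Comp C Y X Y g f = Ident C Y)"

definition iso_obj :: "('o, 'm, 'r, 'z) lin_cat_scheme \<Rightarrow> 'o \<Rightarrow> 'o \<Rightarrow> bool"
  where "iso_obj C X Y \<longleftrightarrow> (\<exists>f. iso_mor C X Y f)"

definition split_epi :: "('o, 'm, 'r, 'z) lin_cat_scheme \<Rightarrow> 'o \<Rightarrow> 'o \<Rightarrow> 'm \<Rightarrow> bool"
  where "split_epi C U Y t \<longleftrightarrow> (\<exists>s\<in>Hom_set C Y U. Comp C Y U Y s t = Ident C Y)"

definition zero_obj :: "('o, 'm, 'r, 'z) lin_cat_scheme \<Rightarrow> 'o \<Rightarrow> bool"
  where "zero_obj C Z \<longleftrightarrow>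
    Z \<in> Obj C \<and>
    (\<forall>U\<in>Obj C. Hom_set C Z U = {\<zero>\<^bsub>Mor C Z U\<^esub>} \<and> Hom_set C U Z = {\<zero>\<^bsub>Mor C U Z\<^esub>})"

text \<open>
  \<open>S\<close> is a direct sum (biproduct) of the finite list of objects \<open>Xs\<close>, with injections \<open>\<iota>\<close> and
  projections \<open>\<pi>\<close>. For the empty list this says that \<open>S\<close> is a zero object.
\<close>

definition direct_sum :: "('o, 'm, 'r, 'z) lin_cat_scheme \<Rightarrow> 'o list \<Rightarrow> 'o \<Rightarrow> bool"
  where "direct_sum C Xs S \<longleftrightarrow>
    set Xs \<subseteq> Obj C \<and> S \<in> Obj C \<and>
    (\<exists>\<iota> \<pi>.
       (\<forall>i<length Xs. \<iota> i \<in> Hom_set C (Xs ! i) S \<and> \<pi> i \<in> Hom_set C S (Xs ! i)) \<and>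
       (\<forall>i<length Xs. \<forall>j<length Xs.
          Comp C (Xs ! i) S (Xs ! j) (\<iota> i) (\<pi> j)
            = (if i = j then Ident C (Xs ! i) else \<zero>\<^bsub>Mor C (Xs ! i) (Xs ! j)\<^esub>)) \<and>
       (\<Oplus>\<^bsub>Mor C S S\<^esub>i\<in>{..<length Xs}. Comp C S (Xs ! i) S (\<pi> i) (\<iota> i)) = Ident C S)"

definition in_add :: "('o, 'm, 'r, 'z) lin_cat_scheme \<Rightarrow> 'o \<Rightarrow> 'o \<Rightarrow> bool"
  where "in_add C N Z \<longleftrightarrow>
    (\<exists>n S Z'. direct_sum C (replicate n N) S \<and> direct_sum C [Z, Z'] S)"

definition indecomposable :: "('o, 'm, 'r, 'z) lin_cat_scheme \<Rightarrow> 'o \<Rightarrow> bool"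
  where "indecomposable C X \<longleftrightarrow>
    X \<in> Obj C \<and> \<not> zero_obj C X \<and>
    (\<forall>U V. direct_sum C [U, V] X \<longrightarrow> zero_obj C U \<or> zero_obj C V)"

definition End_ring :: "('o, 'm, 'r, 'z) lin_cat_scheme \<Rightarrow> 'o \<Rightarrow> 'm ring"
  where "End_ring C V =
    \<lparr>carrier = Hom_set C V V,
     monoid.mult = Comp C V V V,
     one = Ident C V,
     zero = \<zero>\<^bsub>Mor C V V\<^esub>,
     add = add (Mor C V V)\<rparr>"

definition Hom_finite ::
  "('r, 's) ring_scheme \<Rightarrow> ('o, 'm, 'r, 'z) lin_cat_scheme \<Rightarrow> bool"
  where "Hom_finite R C \<longleftrightarrow> (\<forall>X\<in>Obj C. \<forall>Y\<in>Obj C. finite_length R (Mor C X Y))"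

definition Krull_Schmidt :: "('o, 'm, 'r, 'z) lin_cat_scheme \<Rightarrow> bool"
  where "Krull_Schmidt C \<longleftrightarrow>
    (\<forall>S\<in>Obj C. \<exists>Xs. direct_sum C Xs S \<and> (\<forall>X\<in>set Xs. local_ring (End_ring C X)))"

locale additive_linear_category = linear_category R C
  for R :: "('r, 's) ring_scheme" (structure) and C :: "('o, 'm, 'r, 'z) lin_cat_scheme" +
  assumes ex_zero_obj: "\<exists>Z. zero_obj C Z"
    and ex_direct_sum: "\<lbrakk>X \<in> Obj C; Y \<in> Obj C\<rbrakk> \<Longrightarrow> \<exists>S. direct_sum C [X, Y] S"


section \<open>Triangulated categories\<close>

text \<open>
  \<open>(X, Y, Z, f, g, h) \<in> Tri C\<close> means that \<open>X \<rightarrow> Y \<rightarrow> Z \<rightarrow> X[1]\<close> with morphisms \<open>f\<close>, \<open>g\<close>, \<open>h\<close> is a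
  (distinguished) triangle.
\<close>

record ('o, 'm, 'r) tri_cat = "('o, 'm, 'r) lin_cat" +
  Sh :: "'o \<Rightarrow> 'o"
  Shm :: "'o \<Rightarrow> 'o \<Rightarrow> 'm \<Rightarrow> 'm"
  Tri :: "('o \<times> 'o \<times> 'o \<times> 'm \<times> 'm \<times> 'm) set"

text \<open>
  The shift is only required to be a self-equivalence (fully faithful and essentially
  surjective); the case of an automorphism is included.
\<close>

locale shift_linear_category = additive_linear_category R C
  for R :: "('r, 's) ring_scheme" (structure) and C :: "('o, 'm, 'r, 'z) tri_cat_scheme" +
  assumes Sh_closed: "X \<in> Obj C \<Longrightarrow> Sh C X \<in> Obj C"
    and Shm_bij:
      "\<lbrakk>X \<in> Obj C; Y \<in> Obj C\<rbrakk>
        \<Longrightarrow> bij_betw (Shm C X Y) (Hom_set C X Y) (Hom_set C (Sh C X) (Sh C Y))"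
    and Shm_Ident: "X \<in> Obj C \<Longrightarrow> Shm C X X (Ident C X) = Ident C (Sh C X)"
    and Shm_Comp:
      "\<lbrakk>X \<in> Obj C; Y \<in> Obj C; Z \<in> Obj C; f \<in> Hom_set C X Y; g \<in> Hom_set C Y Z\<rbrakk>
        \<Longrightarrow> Shm C X Z (Comp C X Y Z f g)
            = Comp C (Sh C X) (Sh C Y) (Sh C Z) (Shm C X Y f) (Shm C Y Z g)"
    and Shm_add:
      "\<lbrakk>X \<in> Obj C; Y \<in> Obj C; f \<in> Hom_set C X Y; f' \<in> Hom_set C X Y\<rbrakk>
        \<Longrightarrow> Shm C X Y (f \<oplus>\<^bsub>Mor C X Y\<^esub> f')
            = Shm C X Y f \<oplus>\<^bsub>Mor C (Sh C X) (Sh C Y)\<^esub> Shm C X Y f'"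
    and Shm_smult:
      "\<lbrakk>X \<in> Obj C; Y \<in> Obj C; r \<in> carrier R; f \<in> Hom_set C X Y\<rbrakk>
        \<Longrightarrow> Shm C X Y (r \<odot>\<^bsub>Mor C X Y\<^esub> f) = r \<odot>\<^bsub>Mor C (Sh C X) (Sh C Y)\<^esub> Shm C X Y f"
    and Sh_ess_surj: "Y \<in> Obj C \<Longrightarrow> \<exists>Z\<in>Obj C. iso_obj C (Sh C Z) Y"

text \<open>\<open>Y[-1]\<close>, determined up to isomorphism.\<close>

definition Sh_inv :: "('o, 'm, 'r, 'z) tri_cat_scheme \<Rightarrow> 'o \<Rightarrow> 'o"
  where "Sh_inv C Y = (SOME Z. Z \<in> Obj C \<and> iso_obj C (Sh C Z) Y)"

locale triangulated_category = shift_linear_category R C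
  for R :: "('r, 's) ring_scheme" (structure) and C :: "('o, 'm, 'r, 'z) tri_cat_scheme" +
  assumes Tri_closed:
      "(X, Y, Z, f, g, h) \<in> Tri C \<Longrightarrow>
        X \<in> Obj C \<and> Y \<in> Obj C \<and> Z \<in> Obj C \<and>
        f \<in> Hom_set C X Y \<and> g \<in> Hom_set C Y Z \<and> h \<in> Hom_set C Z (Sh C X)"
    and TR1_Ident:
      "\<lbrakk>X \<in> Obj C; zero_obj C Z\<rbrakk>
        \<Longrightarrow> (X, X, Z, Ident C X, \<zero>\<^bsub>Mor C X Z\<^esub>, \<zero>\<^bsub>Mor C Z (Sh C X)\<^esub>) \<in> Tri C"
    and TR1_iso:
      "\<lbrakk>(X, Y, Z, f, g, h) \<in> Tri C; X' \<in> Obj C; Y' \<in> Obj C; Z' \<in> Obj C;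
        f' \<in> Hom_set C X' Y'; g' \<in> Hom_set C Y' Z'; h' \<in> Hom_set C Z' (Sh C X');
        iso_mor C X X' a; iso_mor C Y Y' b; iso_mor C Z Z' c;
        Comp C X Y Y' f b = Comp C X X' Y' a f';
        Comp C Y Z Z' g c = Comp C Y Y' Z' b g';
        Comp C Z (Sh C X) (Sh C X') h (Shm C X X' a) = Comp C Z Z' (Sh C X') c h'\<rbrakk>
        \<Longrightarrow> (X', Y', Z', f', g', h') \<in> Tri C"
    and TR1_complete:
      "\<lbrakk>X \<in> Obj C; Y \<in> Obj C; f \<in> Hom_set C X Y\<rbrakk> \<Longrightarrow> \<exists>Z g h. (X, Y, Z, f, g, h) \<in> Tri C"
    and TR2:
      "\<lbrakk>X \<in> Obj C; Y \<in> Obj C; Z \<in> Obj C;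
        f \<in> Hom_set C X Y; g \<in> Hom_set C Y Z; h \<in> Hom_set C Z (Sh C X)\<rbrakk>
        \<Longrightarrow> (X, Y, Z, f, g, h) \<in> Tri C \<longleftrightarrow>
            (Y, Z, Sh C X, g, h, \<ominus>\<^bsub>Mor C (Sh C X) (Sh C Y)\<^esub> Shm C X Y f) \<in> Tri C"
    and TR3:
      "\<lbrakk>(X, Y, Z, f, g, h) \<in> Tri C; (X', Y', Z', f', g', h') \<in> Tri C;
        a \<in> Hom_set C X X'; b \<in> Hom_set C Y Y';
        Comp C X Y Y' f b = Comp C X X' Y' a f'\<rbrakk>
        \<Longrightarrow> \<exists>c\<in>Hom_set C Z Z'.
              Comp C Y Z Z' g c = Comp C Y Y' Z' b g' \<and>
              Comp C Z (Sh C X) (Sh C X') h (Shm C X X' a) = Comp C Z Z' (Sh C X') c h'"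
    and TR4:
      "\<lbrakk>(X, Y, Z', f, i, i') \<in> Tri C; (Y, Z, X', g, j, j') \<in> Tri C;
        (X, Z, Y', Comp C X Y Z f g, k, k') \<in> Tri C\<rbrakk>
        \<Longrightarrow> \<exists>u v.
              (Z', Y', X', u, v, Comp C X' (Sh C Y) (Sh C Z') j' (Shm C Y Z' i)) \<in> Tri C \<and>
              Comp C Y Z' Y' i u = Comp C Y Z Y' g k \<and>
              Comp C Z Y' X' k v = j \<and>
              Comp C Z' Y' (Sh C X) u k' = i' \<and>
              Comp C Y' X' (Sh C Y) v j' = Comp C Y' (Sh C X) (Sh C Y) k' (Shm C X Y f)"

definition AR_triangle ::
  "('o, 'm, 'r, 'z) tri_cat_scheme \<Rightarrow> 'o \<Rightarrow> 'o \<Rightarrow> 'o \<Rightarrow> 'm \<Rightarrow> 'm \<Rightarrow> 'm \<Rightarrow> bool"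
  where "AR_triangle C X M Y f g w \<longleftrightarrow>
    (X, M, Y, f, g, w) \<in> Tri C \<and>
    indecomposable C X \<and> indecomposable C Y \<and>
    w \<noteq> \<zero>\<^bsub>Mor C Y (Sh C X)\<^esub> \<and>
    (\<forall>U\<in>Obj C. \<forall>t\<in>Hom_set C U Y. \<not> split_epi C U Y t \<longrightarrow>
       Comp C U Y (Sh C X) t w = \<zero>\<^bsub>Mor C U (Sh C X)\<^esub>)"

end

theory Submission
  imports Defs
begin

text \<open>
  Put \<open>D = N \<oplus> M\<close>, or \<open>D = M\<close> in the absence of \<open>N\<close>, and \<open>V = D \<oplus> X\<close>, \<open>W = D \<oplus> Y\<close>, \<open>E = D \<oplus> M\<close>.
  Adding the trivial triangle on \<open>D\<close> to the given one yields a triangle \<open>X \<rightarrow> E \<rightarrow> W \<rightarrow> X[1]\<close> whose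
  first two terms are direct summands of \<open>V\<^sup>2\<close>. The tilting module is the image \<open>T\<close> of
  \<open>Hom(V, E) \<rightarrow> Hom(V, W)\<close>, a left module over \<open>A = End(V)\<close>. Everything required of \<open>T\<close> is read off
  from long exact \<open>Hom\<close> sequences, once it is known that certain connecting morphisms vanish.

  \<^item> The sequence \<open>0 \<rightarrow> Hom(V, X) \<rightarrow> Hom(V, E) \<rightarrow> T \<rightarrow> 0\<close> is a projective resolution. It is exact on the
    left because a morphism from \<open>V[1]\<close> to \<open>Y\<close> is never a split epimorphism: \<open>Y[-1]\<close> is not a summand
    of \<open>V\<close>. By the Yoneda lemma \<open>Ext\<^sup>1(T, T)\<close> vanishes as soon as every morphism \<open>X \<rightarrow> E\<close> factors
    through the first one of the triangle, which holds when \<open>X\<close> is not a summand of \<open>D\<close>.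
  \<^item> The sequence \<open>V \<rightarrow> E \<rightarrow> Y\<close>, with components \<open>D = D\<close> and \<open>X \<rightarrow> M \<rightarrow> Y\<close>, induces the coresolution
    \<open>0 \<rightarrow> A \<rightarrow> Hom(V, E) \<rightarrow> L \<rightarrow> 0\<close>, where \<open>L\<close> is the image of \<open>Hom(V, M) \<rightarrow> Hom(V, Y)\<close>; the second and
    the third term are in \<open>add(T)\<close>.
  \<^item> An endomorphism of \<open>T\<close> lifts to \<open>E \<rightarrow> E\<close> and descends along \<open>E \<rightarrow> W\<close> to an endomorphism of \<open>W\<close>. The
    descent is unique because \<open>X[1]\<close> is not a summand of \<open>W\<close>, and every endomorphism of \<open>W\<close> arises
    because \<open>Y\<close> is not a summand of \<open>D\<close>. Hence the endomorphism ring of \<open>T\<close> is \<open>End(W)\<close>.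

  The vanishing statements use that \<open>X\<close> and \<open>Y\<close> have local endomorphism rings and that the condition
  on Auslander-Reiten triangles is self-dual (\<open>left_almost_split_zero\<close>). The hypothesis that \<open>X[1]\<close>
  is not in \<open>add(M \<oplus> Y)\<close> also excludes \<open>Y[-1]\<close> from \<open>add(M)\<close> (\<open>desuspension_Y_not_retract\<close>). There
  remains the question whether \<open>X\<close> or \<open>Y\<close> is a summand of \<open>M\<close>. If \<open>X\<close> and \<open>Y\<close> are not isomorphic, then
  one of them is a summand of \<open>M\<close> only if the other one is (\<open>retract_X_imp_retract_Y\<close>,
  \<open>retract_Y_imp_retract_X\<close>). So the argument above applies unless \<open>V\<close> and \<open>W\<close> are direct summands of
  powers of each other. In that case \<open>End(V)\<close> and \<open>End(W)\<close> are Morita equivalent, and the progenerator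
  \<open>Hom(V, W)\<close> is a tilting module (\<open>Morita_tilting\<close>).

  Both tilting modules are instances of one construction, \<open>tilting_presentation\<close>, which lives in an
  additive category and does not mention triangles.
\<close>

section \<open>Linear categories\<close>

context linear_category
begin

abbreviation comp_in :: "'m \<Rightarrow> 'o \<Rightarrow> 'o \<Rightarrow> 'o \<Rightarrow> 'm \<Rightarrow> 'm"  ("(_ \<cdot>[_,_,_] _)" [71, 0, 0, 0, 70] 70)
  where "f \<cdot>[X,Y,Z] g \<equiv> Comp C X Y Z f g"

abbreviation add_in :: "'m \<Rightarrow> 'o \<Rightarrow> 'o \<Rightarrow> 'm \<Rightarrow> 'm"  ("(_ \<oplus>[_,_] _)" [65, 0, 0, 66] 65)
  where "f \<oplus>[X,Y] g \<equiv> f \<oplus>\<^bsub>Mor C X Y\<^esub> g"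

abbreviation zero_in :: "'o \<Rightarrow> 'o \<Rightarrow> 'm"  ("\<zero>[_,_]")
  where "\<zero>[X,Y] \<equiv> \<zero>\<^bsub>Mor C X Y\<^esub>"

abbreviation neg_in :: "'o \<Rightarrow> 'o \<Rightarrow> 'm \<Rightarrow> 'm"  ("(\<ominus>[_,_] _)" [0, 0, 81] 80)
  where "\<ominus>[X,Y] f \<equiv> \<ominus>\<^bsub>Mor C X Y\<^esub> f"

lemma Mor_abelian_group: "\<lbrakk>X \<in> Obj C; Y \<in> Obj C\<rbrakk> \<Longrightarrow> abelian_group (Mor C X Y)"
  using Mor_module module.axioms(2) by blast

lemma Mor_abelian_monoid: "\<lbrakk>X \<in> Obj C; Y \<in> Obj C\<rbrakk> \<Longrightarrow> abelian_monoid (Mor C X Y)"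
  using Mor_abelian_group abelian_group.axioms(1) by blast

lemmas [simp] = Ident_closed Comp_closed Comp_Ident_left Comp_Ident_right Comp_assoc

lemma Mor_zero_closed [simp]: "\<lbrakk>X \<in> Obj C; Y \<in> Obj C\<rbrakk> \<Longrightarrow> \<zero>[X,Y] \<in> Hom_set C X Y"
  by (simp add: Mor_abelian_monoid abelian_monoid.zero_closed)

lemma Mor_add_closed [simp]:
  "\<lbrakk>X \<in> Obj C; Y \<in> Obj C; f \<in> Hom_set C X Y; g \<in> Hom_set C X Y\<rbrakk>
    \<Longrightarrow> f \<oplus>[X,Y] g \<in> Hom_set C X Y"
  by (simp add: Mor_abelian_monoid abelian_monoid.a_closed)

lemma Mor_neg_closed [simp]:
  "\<lbrakk>X \<in> Obj C; Y \<in> Obj C; f \<in> Hom_set C X Y\<rbrakk> \<Longrightarrow> \<ominus>[X,Y] f \<in> Hom_set C X Y"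
  by (simp add: Mor_abelian_group abelian_group.a_inv_closed)

lemma Mor_add_zero_left [simp]:
  "\<lbrakk>X \<in> Obj C; Y \<in> Obj C; f \<in> Hom_set C X Y\<rbrakk> \<Longrightarrow> \<zero>[X,Y] \<oplus>[X,Y] f = f"
  by (simp add: Mor_abelian_monoid abelian_monoid.l_zero)

lemma Mor_add_zero_right [simp]:
  "\<lbrakk>X \<in> Obj C; Y \<in> Obj C; f \<in> Hom_set C X Y\<rbrakk> \<Longrightarrow> f \<oplus>[X,Y] \<zero>[X,Y] = f"
  by (simp add: Mor_abelian_monoid abelian_monoid.r_zero)

lemma Mor_add_assoc:
  "\<lbrakk>X \<in> Obj C; Y \<in> Obj C; f \<in> Hom_set C X Y; g \<in> Hom_set C X Y; h \<in> Hom_set C X Y\<rbrakk>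
    \<Longrightarrow> f \<oplus>[X,Y] g \<oplus>[X,Y] h = f \<oplus>[X,Y] (g \<oplus>[X,Y] h)"
  by (simp add: Mor_abelian_monoid abelian_monoid.a_assoc)

lemma Mor_add_commute:
  "\<lbrakk>X \<in> Obj C; Y \<in> Obj C; f \<in> Hom_set C X Y; g \<in> Hom_set C X Y\<rbrakk>
    \<Longrightarrow> f \<oplus>[X,Y] g = g \<oplus>[X,Y] f"
  by (simp add: Mor_abelian_monoid abelian_monoid.a_comm)

lemma Mor_add_left_commute:
  "\<lbrakk>X \<in> Obj C; Y \<in> Obj C; f \<in> Hom_set C X Y; g \<in> Hom_set C X Y; h \<in> Hom_set C X Y\<rbrakk>
    \<Longrightarrow> f \<oplus>[X,Y] (g \<oplus>[X,Y] h) = g \<oplus>[X,Y] (f \<oplus>[X,Y] h)"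
  by (simp add: Mor_abelian_monoid abelian_monoid.a_lcomm)

lemmas Mor_add_ac = Mor_add_assoc Mor_add_commute Mor_add_left_commute

lemma Mor_add_neg_right [simp]:
  "\<lbrakk>X \<in> Obj C; Y \<in> Obj C; f \<in> Hom_set C X Y\<rbrakk> \<Longrightarrow> f \<oplus>[X,Y] \<ominus>[X,Y] f = \<zero>[X,Y]"
  by (simp add: Mor_abelian_group abelian_group.r_neg)

lemma Mor_add_neg_left [simp]:
  "\<lbrakk>X \<in> Obj C; Y \<in> Obj C; f \<in> Hom_set C X Y\<rbrakk> \<Longrightarrow> \<ominus>[X,Y] f \<oplus>[X,Y] f = \<zero>[X,Y]"
  by (simp add: Mor_abelian_group abelian_group.l_neg)

lemma Mor_add_diff_cancel [simp]:
  assumes "X \<in> Obj C" "Y \<in> Obj C" "f \<in> Hom_set C X Y" "g \<in> Hom_set C X Y"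
  shows "f \<oplus>[X,Y] (g \<oplus>[X,Y] \<ominus>[X,Y] f) = g"
  using assms Mor_add_left_commute[of X Y f g "\<ominus>[X,Y] f"] by simp

lemma Mor_neg_neg [simp]:
  "\<lbrakk>X \<in> Obj C; Y \<in> Obj C; f \<in> Hom_set C X Y\<rbrakk> \<Longrightarrow> \<ominus>[X,Y] (\<ominus>[X,Y] f) = f"
  by (simp add: Mor_abelian_group abelian_group.minus_minus)

lemma Mor_neg_zero [simp]: "\<lbrakk>X \<in> Obj C; Y \<in> Obj C\<rbrakk> \<Longrightarrow> \<ominus>[X,Y] \<zero>[X,Y] = \<zero>[X,Y]"
  by (metis Mor_abelian_group Mor_abelian_monoid Mor_zero_closed abelian_group.minus_equality
      abelian_monoid.l_zero)

lemma Mor_neg_eqI: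
  assumes "X \<in> Obj C" "Y \<in> Obj C" "f \<in> Hom_set C X Y" "g \<in> Hom_set C X Y"
    and "f \<oplus>[X,Y] g = \<zero>[X,Y]"
  shows "g = \<ominus>[X,Y] f"
proof -
  interpret H: abelian_group "Mor C X Y" using assms Mor_abelian_group by blast
  show ?thesis using H.minus_equality[of g f] H.a_comm[of g f] assms by simp
qed

lemma Mor_self_add_eq:
  assumes "X \<in> Obj C" "Y \<in> Obj C" "f \<in> Hom_set C X Y" "g \<in> Hom_set C X Y"
    and "f = f \<oplus>[X,Y] g"
  shows "g = \<zero>[X,Y]"
proof -
  interpret H: abelian_group "Mor C X Y" using assms Mor_abelian_group by blast
  show ?thesis using H.add.r_cancel_one'[of f g] assms by simp
qed

lemma Comp_zero_left [simp]:
  assumes "X \<in> Obj C" "Y \<in> Obj C" "Z \<in> Obj C" "g \<in> Hom_set C Y Z"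
  shows "\<zero>[X,Y] \<cdot>[X,Y,Z] g = \<zero>[X,Z]"
  by (rule Mor_self_add_eq[of _ _ "\<zero>[X,Y] \<cdot>[X,Y,Z] g"])
    (use assms in \<open>simp_all flip: Comp_add_left\<close>)

lemma Comp_zero_right [simp]:
  assumes "X \<in> Obj C" "Y \<in> Obj C" "Z \<in> Obj C" "f \<in> Hom_set C X Y"
  shows "f \<cdot>[X,Y,Z] \<zero>[Y,Z] = \<zero>[X,Z]"
  by (rule Mor_self_add_eq[of _ _ "f \<cdot>[X,Y,Z] \<zero>[Y,Z]"])
    (use assms in \<open>simp_all flip: Comp_add_right\<close>)

lemma Comp_neg_left [simp]:
  assumes "X \<in> Obj C" "Y \<in> Obj C" "Z \<in> Obj C" "f \<in> Hom_set C X Y" "g \<in> Hom_set C Y Z"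
  shows "(\<ominus>[X,Y] f) \<cdot>[X,Y,Z] g = \<ominus>[X,Z] (f \<cdot>[X,Y,Z] g)"
  by (rule Mor_neg_eqI) (use assms in \<open>simp_all flip: Comp_add_left\<close>)

lemma Comp_neg_right [simp]:
  assumes "X \<in> Obj C" "Y \<in> Obj C" "Z \<in> Obj C" "f \<in> Hom_set C X Y" "g \<in> Hom_set C Y Z"
  shows "f \<cdot>[X,Y,Z] (\<ominus>[Y,Z] g) = \<ominus>[X,Z] (f \<cdot>[X,Y,Z] g)"
  by (rule Mor_neg_eqI) (use assms in \<open>simp_all flip: Comp_add_right\<close>)

text \<open>
  Composites are kept in right-associated form. These variants substitute a known composite of two
  morphisms inside a longer chain.
\<close>

lemma Comp_subst:
  assumes "f \<cdot>[X,Y,Z] g = k"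
    and "X \<in> Obj C" "Y \<in> Obj C" "Z \<in> Obj C" "U \<in> Obj C"
    and "f \<in> Hom_set C X Y" "g \<in> Hom_set C Y Z" "h \<in> Hom_set C Z U"
  shows "f \<cdot>[X,Y,U] (g \<cdot>[Y,Z,U] h) = k \<cdot>[X,Z,U] h"
  using assms by (simp flip: assms(1))

lemma Comp_zero_subst:
  assumes "f \<cdot>[X,Y,Z] g = \<zero>[X,Z]"
    and "X \<in> Obj C" "Y \<in> Obj C" "Z \<in> Obj C" "U \<in> Obj C"
    and "f \<in> Hom_set C X Y" "g \<in> Hom_set C Y Z" "h \<in> Hom_set C Z U"
  shows "f \<cdot>[X,Y,U] (g \<cdot>[Y,Z,U] h) = \<zero>[X,U]"
  using Comp_subst[OF assms] assms by simp

lemma Comp_Ident_subst: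
  assumes "f \<cdot>[X,Y,X] g = Ident C X"
    and "X \<in> Obj C" "Y \<in> Obj C" "U \<in> Obj C"
    and "f \<in> Hom_set C X Y" "g \<in> Hom_set C Y X" "h \<in> Hom_set C X U"
  shows "f \<cdot>[X,Y,U] (g \<cdot>[Y,X,U] h) = h"
  using Comp_subst[OF assms(1-3) assms(2) assms(4-7)] assms by simp


lemma End_ring_simps [simp]:
  "carrier (End_ring C Z) = Hom_set C Z Z"
  "x \<otimes>\<^bsub>End_ring C Z\<^esub> y = x \<cdot>[Z,Z,Z] y"
  "x \<oplus>\<^bsub>End_ring C Z\<^esub> y = x \<oplus>[Z,Z] y"
  "\<one>\<^bsub>End_ring C Z\<^esub> = Ident C Z"
  "\<zero>\<^bsub>End_ring C Z\<^esub> = \<zero>[Z,Z]"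
  by (simp_all add: End_ring_def)

lemma ring_End_ring:
  assumes [simp]: "Z \<in> Obj C"
  shows "ring (End_ring C Z)"
proof (rule ringI)
  show "abelian_group (End_ring C Z)"
  proof (rule abelian_groupI)
    fix x assume x: "x \<in> carrier (End_ring C Z)"
    show "\<exists>y\<in>carrier (End_ring C Z). y \<oplus>\<^bsub>End_ring C Z\<^esub> x = \<zero>\<^bsub>End_ring C Z\<^esub>"
      using x by (intro bexI[of _ "\<ominus>[Z,Z] x"]) simp_all
  qed (simp_all add: Mor_add_ac)
  show "monoid (End_ring C Z)" by (rule monoidI) simp_all
qed (simp_all add: Comp_add_left Comp_add_right)


subsection \<open>Biproducts and retracts\<close>

definition biproduct :: "'o \<Rightarrow> 'o \<Rightarrow> 'o \<Rightarrow> 'm \<Rightarrow> 'm \<Rightarrow> 'm \<Rightarrow> 'm \<Rightarrow> bool"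
  where "biproduct A B S i p j q \<longleftrightarrow>
    A \<in> Obj C \<and> B \<in> Obj C \<and> S \<in> Obj C \<and>
    i \<in> Hom_set C A S \<and> p \<in> Hom_set C S A \<and> j \<in> Hom_set C B S \<and> q \<in> Hom_set C S B \<and>
    i \<cdot>[A,S,A] p = Ident C A \<and> j \<cdot>[B,S,B] q = Ident C B \<and>
    i \<cdot>[A,S,B] q = \<zero>[A,B] \<and> j \<cdot>[B,S,A] p = \<zero>[B,A] \<and>
    p \<cdot>[S,A,S] i \<oplus>[S,S] q \<cdot>[S,B,S] j = Ident C S"

lemma finsum_lessThan_2:
  assumes "X \<in> Obj C" "Y \<in> Obj C" "u 0 \<in> Hom_set C X Y" "u 1 \<in> Hom_set C X Y"
  shows "(\<Oplus>\<^bsub>Mor C X Y\<^esub>k\<in>{..<2::nat}. u k) = u 0 \<oplus>[X,Y] u 1"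
proof -
  interpret H: abelian_group "Mor C X Y" using assms Mor_abelian_group by blast
  have "{..<2::nat} = {0, 1}" by auto
  then show ?thesis using assms by (simp add: H.finsum_insert)
qed

lemma finsum_lessThan_3:
  assumes "X \<in> Obj C" "Y \<in> Obj C"
    and "u 0 \<in> Hom_set C X Y" "u 1 \<in> Hom_set C X Y" "u 2 \<in> Hom_set C X Y"
  shows "(\<Oplus>\<^bsub>Mor C X Y\<^esub>k\<in>{..<3::nat}. u k) = u 0 \<oplus>[X,Y] (u 1 \<oplus>[X,Y] u 2)"
proof -
  interpret H: abelian_group "Mor C X Y" using assms Mor_abelian_group by blast
  have "{..<3::nat} = {0, 1, 2}" by auto
  then show ?thesis using assms by (simp add: H.finsum_insert)
qed

lemma direct_sum_2_iff:
  "direct_sum C [A, B] S \<longleftrightarrow> (\<exists>i p j q. biproduct A B S i p j q)"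
proof
  assume *: "direct_sum C [A, B] S"
  then have [simp]: "A \<in> Obj C" "B \<in> Obj C" "S \<in> Obj C" by (auto simp: direct_sum_def)
  from * obtain \<iota> \<pi> where
      cl: "\<forall>k<2. \<iota> k \<in> Hom_set C ([A, B] ! k) S \<and> \<pi> k \<in> Hom_set C S ([A, B] ! k)"
    and orth: "\<forall>k<2. \<forall>l<2. Comp C ([A, B] ! k) S ([A, B] ! l) (\<iota> k) (\<pi> l)
            = (if k = l then Ident C ([A, B] ! k) else \<zero>\<^bsub>Mor C ([A, B] ! k) ([A, B] ! l)\<^esub>)"
    and s: "(\<Oplus>\<^bsub>Mor C S S\<^esub>k\<in>{..<2}. Comp C S ([A, B] ! k) S (\<pi> k) (\<iota> k)) = Ident C S"
    unfolding direct_sum_def by (auto simp: numeral_2_eq_2)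
  have [simp]: "\<iota> 0 \<in> Hom_set C A S" "\<pi> 0 \<in> Hom_set C S A" "\<iota> (Suc 0) \<in> Hom_set C B S" "\<pi> (Suc 0)
      \<in> Hom_set C S B"
    using cl[rule_format, of 0] cl[rule_format, of 1] by simp_all
  have "biproduct A B S (\<iota> 0) (\<pi> 0) (\<iota> 1) (\<pi> 1)"
    using orth[rule_format, of 0 0] orth[rule_format, of 0 1] orth[rule_format, of 1 0]
      orth[rule_format, of 1 1] s
    by (simp add: biproduct_def finsum_lessThan_2)
  then show "\<exists>i p j q. biproduct A B S i p j q" by blast
next
  assume "\<exists>i p j q. biproduct A B S i p j q"
  then obtain i p j q where b: "biproduct A B S i p j q" by blast
  then have [simp]: "A \<in> Obj C" "B \<in> Obj C" "S \<in> Obj C"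
     "i \<in> Hom_set C A S" "p \<in> Hom_set C S A" "j \<in> Hom_set C B S" "q \<in> Hom_set C S B"
    by (auto simp: biproduct_def)
  let ?i = "\<lambda>k::nat. if k = 0 then i else j" and ?p = "\<lambda>k::nat. if k = 0 then p else q"
  have "(\<Oplus>\<^bsub>Mor C S S\<^esub>k\<in>{..<2}. Comp C S ([A, B] ! k) S (?p k) (?i k)) = Ident C S"
    using b by (subst finsum_lessThan_2) (auto simp: biproduct_def)
  then show "direct_sum C [A, B] S"
    using b unfolding direct_sum_def
    by (intro conjI exI[of _ ?i] exI[of _ ?p])
      (auto simp: biproduct_def less_2_cases_iff numeral_2_eq_2 less_Suc_eq)
qed

definition retract :: "'o \<Rightarrow> 'o \<Rightarrow> bool"
  where "retract A B \<longleftrightarrow> A \<in> Obj C \<and> B \<in> Obj C \<and>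
    (\<exists>i\<in>Hom_set C A B. \<exists>p\<in>Hom_set C B A. i \<cdot>[A,B,A] p = Ident C A)"

lemma direct_sum_3_assoc:
  assumes "direct_sum C [A, B, E] S" "direct_sum C [A, B] D"
  shows "direct_sum C [D, E] S"
proof -
  have [simp]: "A \<in> Obj C" "B \<in> Obj C" "E \<in> Obj C" "S \<in> Obj C" "D \<in> Obj C"
    using assms by (auto simp: direct_sum_def)
  from assms(1) obtain \<iota> \<pi> where
      cl: "\<forall>k<3. \<iota> k \<in> Hom_set C ([A, B, E] ! k) S \<and> \<pi> k \<in> Hom_set C S ([A, B, E] ! k)"
    and orth: "\<forall>k<3. \<forall>l<3. Comp C ([A, B, E] ! k) S ([A, B, E] ! l) (\<iota> k) (\<pi> l)
        = (if k = l then Ident C ([A, B, E] ! k) else \<zero>\<^bsub>Mor C ([A, B, E] ! k) ([A, B, E] ! l)\<^esub>)"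
    and s: "(\<Oplus>\<^bsub>Mor C S S\<^esub>k\<in>{..<3}. Comp C S ([A, B, E] ! k) S (\<pi> k) (\<iota> k)) = Ident C S"
    unfolding direct_sum_def by (auto simp: numeral_3_eq_3)
  define a a' b b' e e' where defs: "a = \<iota> 0" "a' = \<pi> 0" "b = \<iota> (Suc 0)" "b' = \<pi> (Suc 0)" "e = \<iota>
      2" "e' = \<pi> 2"
  have [simp]: "a \<in> Hom_set C A S" "a' \<in> Hom_set C S A" "b \<in> Hom_set C B S" "b' \<in> Hom_set C S B"
      "e \<in> Hom_set C E S" "e' \<in> Hom_set C S E"
    using cl[rule_format, of 0] cl[rule_format, of "Suc 0"] cl[rule_format, of 2]
    by (simp_all flip: defs)
  have eqs [simp]: "a \<cdot>[A,S,A] a' = Ident C A" "a \<cdot>[A,S,B] b' = \<zero>[A,B]" "a \<cdot>[A,S,E] e' = \<zero>[A,E]"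
      "b \<cdot>[B,S,A] a' = \<zero>[B,A]" "b \<cdot>[B,S,B] b' = Ident C B" "b \<cdot>[B,S,E] e' = \<zero>[B,E]"
      "e \<cdot>[E,S,A] a' = \<zero>[E,A]" "e \<cdot>[E,S,B] b' = \<zero>[E,B]" "e \<cdot>[E,S,E] e' = Ident C E"
    using orth[rule_format, of 0 0] orth[rule_format, of 0 "Suc 0"] orth[rule_format, of 0 2]
      orth[rule_format, of "Suc 0" 0] orth[rule_format, of "Suc 0" "Suc 0"]
      orth[rule_format, of "Suc 0" 2]
      orth[rule_format, of 2 0] orth[rule_format, of 2 "Suc 0"] orth[rule_format, of 2 2]
    by (simp_all flip: defs)
  have s': "a' \<cdot>[S,A,S] a \<oplus>[S,S] (b' \<cdot>[S,B,S] b \<oplus>[S,S] e' \<cdot>[S,E,S] e) = Ident C S"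
    using s by (subst (asm) finsum_lessThan_3) (simp_all flip: defs)
  from assms(2) obtain c c' d d' where bd: "biproduct A B D c c' d d'" by (auto simp:
      direct_sum_2_iff)
  then have [simp]: "c \<in> Hom_set C A D" "c' \<in> Hom_set C D A" "d \<in> Hom_set C B D" "d' \<in> Hom_set C D
      B"
    and eqs2 [simp]: "c \<cdot>[A,D,A] c' = Ident C A" "c \<cdot>[A,D,B] d' = \<zero>[A,B]"
       "d \<cdot>[B,D,A] c' = \<zero>[B,A]" "d \<cdot>[B,D,B] d' = Ident C B"
    and sd: "c' \<cdot>[D,A,D] c \<oplus>[D,D] d' \<cdot>[D,B,D] d = Ident C D"
    by (auto simp: biproduct_def)
  note chain [simp] = eqs[THEN Comp_subst] eqs2[THEN Comp_subst]
  have "biproduct D E S (c' \<cdot>[D,A,S] a \<oplus>[D,S] d' \<cdot>[D,B,S] b) (a' \<cdot>[S,A,D] c \<oplus>[S,D] b' \<cdot>[S,B,D] d)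
      e e'"
    using s' sd by (simp add: biproduct_def Comp_add_left Comp_add_right Mor_add_assoc)
  then show ?thesis by (auto simp: direct_sum_2_iff)
qed

text \<open>
  \<open>Z\<close> is a direct summand of \<open>S\<^sup>2\<close>, expressed without a choice of \<open>S\<^sup>2\<close>. Two copies suffice for a
  biproduct of two retracts of \<open>S\<close>, and all projective modules below come from such objects.
\<close>

definition summand2 :: "'o \<Rightarrow> 'o \<Rightarrow> bool"
  where "summand2 S Z \<longleftrightarrow> S \<in> Obj C \<and> Z \<in> Obj C \<and>
    (\<exists>i\<in>Hom_set C Z S. \<exists>p\<in>Hom_set C S Z. \<exists>j\<in>Hom_set C Z S. \<exists>q\<in>Hom_set C S Z.
       i \<cdot>[Z,S,Z] p \<oplus>[Z,Z] j \<cdot>[Z,S,Z] q = Ident C Z)"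

lemma summand2E:
  assumes "summand2 S Z"
  obtains i p j q where "i \<in> Hom_set C Z S" "p \<in> Hom_set C S Z" "j \<in> Hom_set C Z S" "q \<in> Hom_set C
      S Z"
    "i \<cdot>[Z,S,Z] p \<oplus>[Z,Z] j \<cdot>[Z,S,Z] q = Ident C Z"
  using assms unfolding summand2_def by blast

lemma retract_imp_summand2: "retract Z S \<Longrightarrow> summand2 S Z"
  unfolding retract_def summand2_def
  by (metis Comp_zero_right Mor_add_zero_right Mor_zero_closed Ident_closed)

lemma biproduct_summand2:
  assumes b: "biproduct D B Z i p j q" and "retract D S" "retract B S"
  shows "summand2 S Z"
proof -
  from assms obtain r r' t t' where [simp]: "r \<in> Hom_set C D S" "r' \<in> Hom_set C S D"
      "r \<cdot>[D,S,D] r' = Ident C D" "t \<in> Hom_set C B S" "t' \<in> Hom_set C S B" "t \<cdot>[B,S,B] t' = Ident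
          C B"
    and [simp]: "S \<in> Obj C" by (auto simp: retract_def)
  from b have [simp]: "D \<in> Obj C" "B \<in> Obj C" "Z \<in> Obj C"
      "i \<in> Hom_set C D Z" "p \<in> Hom_set C Z D" "j \<in> Hom_set C B Z" "q \<in> Hom_set C Z B"
    and sum: "p \<cdot>[Z,D,Z] i \<oplus>[Z,Z] q \<cdot>[Z,B,Z] j = Ident C Z"
    by (auto simp: biproduct_def)
  show ?thesis
    unfolding summand2_def
    by (intro conjI bexI[of _ "p \<cdot>[Z,D,S] r"] bexI[of _ "r' \<cdot>[S,D,Z] i"]
        bexI[of _ "q \<cdot>[Z,B,S] t"] bexI[of _ "t' \<cdot>[S,B,Z] j"])
      (simp_all add: sum Comp_Ident_subst)
qed

lemma zero_obj_summand2:
  assumes "zero_obj C O'" "S \<in> Obj C"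
  shows "summand2 S O'"
proof -
  have [simp]: "O' \<in> Obj C" using assms by (auto simp: zero_obj_def)
  have "Ident C O' \<in> {\<zero>[O',O']}"
    using assms Ident_closed[of O'] by (auto simp: zero_obj_def)
  then show ?thesis
    using assms unfolding summand2_def
    by (intro conjI bexI[of _ "\<zero>[O',S]"] bexI[of _ "\<zero>[S,O']"]) auto
qed

text \<open>
  The counterpart of \<open>summand2\<close> for arrows \<open>z : Z' \<rightarrow> Z\<close> and \<open>s : S' \<rightarrow> S\<close>. The composite has to be
  the identity at the targets only: the image of \<open>Hom(V, Z') \<rightarrow> Hom(V, Z)\<close> consists of morphisms to
  \<open>Z\<close>, and the maps between the sources merely ensure that images are mapped into images.
\<close>

definition arrow_summand2 :: "'o \<Rightarrow> 'o \<Rightarrow> 'm \<Rightarrow> 'o \<Rightarrow> 'o \<Rightarrow> 'm \<Rightarrow> bool"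
  where "arrow_summand2 S' S s Z' Z z \<longleftrightarrow>
    Z' \<in> Obj C \<and> Z \<in> Obj C \<and> z \<in> Hom_set C Z' Z \<and>
    (\<exists>a\<in>Hom_set C Z S. \<exists>b\<in>Hom_set C S Z. \<exists>c\<in>Hom_set C Z S. \<exists>d\<in>Hom_set C S Z.
       \<exists>a'\<in>Hom_set C Z' S'. \<exists>b'\<in>Hom_set C S' Z'. \<exists>c'\<in>Hom_set C Z' S'. \<exists>d'\<in>Hom_set C S' Z'.
       z \<cdot>[Z',Z,S] a = a' \<cdot>[Z',S',S] s \<and> s \<cdot>[S',S,Z] b = b' \<cdot>[S',Z',Z] z \<and>
       z \<cdot>[Z',Z,S] c = c' \<cdot>[Z',S',S] s \<and> s \<cdot>[S',S,Z] d = d' \<cdot>[S',Z',Z] z \<and>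
       a \<cdot>[Z,S,Z] b \<oplus>[Z,Z] c \<cdot>[Z,S,Z] d = Ident C Z)"

lemma arrow_summand2I:
  assumes "Z' \<in> Obj C" "Z \<in> Obj C" "z \<in> Hom_set C Z' Z"
    and "a \<in> Hom_set C Z S" "b \<in> Hom_set C S Z" "c \<in> Hom_set C Z S" "d \<in> Hom_set C S Z"
    and "a' \<in> Hom_set C Z' S'" "b' \<in> Hom_set C S' Z'" "c' \<in> Hom_set C Z' S'" "d' \<in> Hom_set C S' Z'"
    and "z \<cdot>[Z',Z,S] a = a' \<cdot>[Z',S',S] s" "s \<cdot>[S',S,Z] b = b' \<cdot>[S',Z',Z] z"
      "z \<cdot>[Z',Z,S] c = c' \<cdot>[Z',S',S] s" "s \<cdot>[S',S,Z] d = d' \<cdot>[S',Z',Z] z"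
      "a \<cdot>[Z,S,Z] b \<oplus>[Z,Z] c \<cdot>[Z,S,Z] d = Ident C Z"
  shows "arrow_summand2 S' S s Z' Z z"
  using assms unfolding arrow_summand2_def by blast

end

section \<open>Left modules\<close>

context left_module
begin

lemma smult_zero_right [simp]:
  assumes "a \<in> carrier A"
  shows "a \<odot>\<^bsub>M\<^esub> \<zero>\<^bsub>M\<^esub> = \<zero>\<^bsub>M\<^esub>"
proof -
  have "a \<odot>\<^bsub>M\<^esub> \<zero>\<^bsub>M\<^esub> = a \<odot>\<^bsub>M\<^esub> \<zero>\<^bsub>M\<^esub> \<oplus>\<^bsub>M\<^esub> a \<odot>\<^bsub>M\<^esub> \<zero>\<^bsub>M\<^esub>"
    using assms smult_r_distr[of a "\<zero>\<^bsub>M\<^esub>" "\<zero>\<^bsub>M\<^esub>"] by simp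
  then show ?thesis
    using assms M.add.r_cancel_one' by (metis M.zero_closed smult_closed)
qed

lemma smult_minus_one:
  assumes "x \<in> carrier M"
  shows "(\<ominus>\<^bsub>A\<^esub> \<one>\<^bsub>A\<^esub>) \<odot>\<^bsub>M\<^esub> x = \<ominus>\<^bsub>M\<^esub> x"
proof -
  have zero: "\<zero>\<^bsub>A\<^esub> \<odot>\<^bsub>M\<^esub> x = \<zero>\<^bsub>M\<^esub>"
  proof -
    have "\<zero>\<^bsub>A\<^esub> \<odot>\<^bsub>M\<^esub> x = \<zero>\<^bsub>A\<^esub> \<odot>\<^bsub>M\<^esub> x \<oplus>\<^bsub>M\<^esub> \<zero>\<^bsub>A\<^esub> \<odot>\<^bsub>M\<^esub> x"
      using assms smult_l_distr[of "\<zero>\<^bsub>A\<^esub>" "\<zero>\<^bsub>A\<^esub>" x] by simp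
    then show ?thesis
      using assms M.add.r_cancel_one' by (metis A.zero_closed smult_closed)
  qed
  have "(\<ominus>\<^bsub>A\<^esub> \<one>\<^bsub>A\<^esub>) \<odot>\<^bsub>M\<^esub> x \<oplus>\<^bsub>M\<^esub> x = \<zero>\<^bsub>M\<^esub>"
    using assms smult_l_distr[of "\<ominus>\<^bsub>A\<^esub> \<one>\<^bsub>A\<^esub>" "\<one>\<^bsub>A\<^esub>" x] zero by (simp add: A.l_neg)
  then show ?thesis using assms by (simp add: M.minus_equality)
qed

lemma submoduleI:
  assumes "H \<subseteq> carrier M" "\<zero>\<^bsub>M\<^esub> \<in> H"
    and "\<And>x y. \<lbrakk>x \<in> H; y \<in> H\<rbrakk> \<Longrightarrow> x \<oplus>\<^bsub>M\<^esub> y \<in> H"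
    and "\<And>a x. \<lbrakk>a \<in> carrier A; x \<in> H\<rbrakk> \<Longrightarrow> a \<odot>\<^bsub>M\<^esub> x \<in> H"
  shows "submodule H A M"
proof -
  have "\<ominus>\<^bsub>M\<^esub> x \<in> H" if "x \<in> H" for x
    using assms(1) assms(4)[of "\<ominus>\<^bsub>A\<^esub> \<one>\<^bsub>A\<^esub>" x] that smult_minus_one[of x] by auto
  then show ?thesis
    using assms by (intro submodule.intro subgroup.intro) (auto simp: submodule_axioms_def
        a_inv_def)
qed

lemma left_module_power: "left_module A (module_power M n)"
proof -
  have mem: "x \<in> carrier (module_power M n) \<longleftrightarrow> (\<forall>i<n. x i \<in> carrier M) \<and> (\<forall>i. \<not> i < n \<longrightarrow> x i =
      undefined)" for x
    by (auto simp: module_power_def PiE_iff extensional_def)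
  note ops = module_power_def fun_eq_iff restrict_def
  have "abelian_group (module_power M n)"
  proof (rule abelian_groupI)
    fix x assume x: "x \<in> carrier (module_power M n)"
    show "\<exists>y\<in>carrier (module_power M n). y \<oplus>\<^bsub>module_power M n\<^esub> x = \<zero>\<^bsub>module_power M n\<^esub>"
    proof (rule bexI[of _ "\<lambda>i\<in>{..<n}. \<ominus>\<^bsub>M\<^esub> x i"])
      show "(\<lambda>i\<in>{..<n}. \<ominus>\<^bsub>M\<^esub> x i) \<oplus>\<^bsub>module_power M n\<^esub> x = \<zero>\<^bsub>module_power M n\<^esub>"
        using x unfolding mem by (simp add: ops M.l_neg)
    qed (use x in \<open>simp add: mem\<close>)
  next
    fix x y z
    assume "x \<in> carrier (module_power M n)" "y \<in> carrier (module_power M n)" "z \<in> carrier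
        (module_power M n)"
    then show "x \<oplus>\<^bsub>module_power M n\<^esub> y \<oplus>\<^bsub>module_power M n\<^esub> z = x \<oplus>\<^bsub>module_power M n\<^esub> (y
        \<oplus>\<^bsub>module_power M n\<^esub> z)"
      unfolding mem by (simp add: ops M.a_assoc)
  next
    fix x y
    assume "x \<in> carrier (module_power M n)" "y \<in> carrier (module_power M n)"
    then show "x \<oplus>\<^bsub>module_power M n\<^esub> y = y \<oplus>\<^bsub>module_power M n\<^esub> x"
      unfolding mem by (simp add: ops M.a_comm)
  next
    fix x y
    assume "x \<in> carrier (module_power M n)" "y \<in> carrier (module_power M n)"
    then show "x \<oplus>\<^bsub>module_power M n\<^esub> y \<in> carrier (module_power M n)"
      unfolding mem by (simp add: ops)
  next
    fix x assume "x \<in> carrier (module_power M n)"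
    then show "\<zero>\<^bsub>module_power M n\<^esub> \<oplus>\<^bsub>module_power M n\<^esub> x = x"
      unfolding mem by (simp add: ops)
  next
    show "\<zero>\<^bsub>module_power M n\<^esub> \<in> carrier (module_power M n)"
      unfolding mem by (simp add: ops)
  qed
  then show ?thesis
  proof (intro left_module.intro left_module_axioms.intro A.ring_axioms)
    fix a x assume "a \<in> carrier A" "x \<in> carrier (module_power M n)"
    then show "a \<odot>\<^bsub>module_power M n\<^esub> x \<in> carrier (module_power M n)"
      unfolding mem by (simp add: ops)
  next
    fix a b x assume "a \<in> carrier A" "b \<in> carrier A" "x \<in> carrier (module_power M n)"
    then show "(a \<oplus>\<^bsub>A\<^esub> b) \<odot>\<^bsub>module_power M n\<^esub> x
        = a \<odot>\<^bsub>module_power M n\<^esub> x \<oplus>\<^bsub>module_power M n\<^esub> b \<odot>\<^bsub>module_power M n\<^esub> x"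
      and "(a \<otimes>\<^bsub>A\<^esub> b) \<odot>\<^bsub>module_power M n\<^esub> x = a \<odot>\<^bsub>module_power M n\<^esub> (b \<odot>\<^bsub>module_power M n\<^esub> x)"
      unfolding mem by (simp_all add: ops smult_l_distr smult_assoc)
  next
    fix a x y
    assume "a \<in> carrier A" "x \<in> carrier (module_power M n)" "y \<in> carrier (module_power M n)"
    then show "a \<odot>\<^bsub>module_power M n\<^esub> (x \<oplus>\<^bsub>module_power M n\<^esub> y)
        = a \<odot>\<^bsub>module_power M n\<^esub> x \<oplus>\<^bsub>module_power M n\<^esub> a \<odot>\<^bsub>module_power M n\<^esub> y"
      unfolding mem by (simp add: ops smult_r_distr)
  next
    fix x assume "x \<in> carrier (module_power M n)"
    then show "\<one>\<^bsub>A\<^esub> \<odot>\<^bsub>module_power M n\<^esub> x = x"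
      unfolding mem by (simp add: ops)
  qed
qed

end

lemma module_hom_closed: "\<lbrakk>\<phi> \<in> module_hom A M N; x \<in> carrier M\<rbrakk> \<Longrightarrow> \<phi> x \<in> carrier N"
  by (auto simp: module_hom_def)

lemma module_hom_add:
  "\<lbrakk>\<phi> \<in> module_hom A M N; x \<in> carrier M; y \<in> carrier M\<rbrakk> \<Longrightarrow> \<phi> (x \<oplus>\<^bsub>M\<^esub> y) = \<phi> x \<oplus>\<^bsub>N\<^esub> \<phi> y"
  by (auto simp: module_hom_def)

lemma module_hom_smult:
  "\<lbrakk>\<phi> \<in> module_hom A M N; a \<in> carrier A; x \<in> carrier M\<rbrakk> \<Longrightarrow> \<phi> (a \<odot>\<^bsub>M\<^esub> x) = a \<odot>\<^bsub>N\<^esub> \<phi> x"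
  by (auto simp: module_hom_def)

lemma module_hom_zero:
  assumes "\<phi> \<in> module_hom A M N" "left_module A M" "left_module A N"
  shows "\<phi> \<zero>\<^bsub>M\<^esub> = \<zero>\<^bsub>N\<^esub>"
proof -
  interpret M: left_module A M by fact
  interpret N: left_module A N by fact
  have "\<phi> \<zero>\<^bsub>M\<^esub> = \<phi> \<zero>\<^bsub>M\<^esub> \<oplus>\<^bsub>N\<^esub> \<phi> \<zero>\<^bsub>M\<^esub>"
    using module_hom_add[OF assms(1), of "\<zero>\<^bsub>M\<^esub>" "\<zero>\<^bsub>M\<^esub>"] by simp
  then show ?thesis
    using module_hom_closed[OF assms(1), of "\<zero>\<^bsub>M\<^esub>"] N.M.add.r_cancel_one' by (metis M.M.zero_closed)
qed

text \<open>
  A retract of \<open>T\<^sup>2\<close> is a direct summand of it, with the kernel of the retraction as a complement.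
\<close>

lemma in_module_addI:
  assumes U: "left_module A U" and T: "left_module A T"
    and j: "j\<^sub>0 \<in> module_hom A U T" "j\<^sub>1 \<in> module_hom A U T"
    and q: "q\<^sub>0 \<in> module_hom A T U" "q\<^sub>1 \<in> module_hom A T U"
    and split: "\<And>u. u \<in> carrier U \<Longrightarrow> q\<^sub>0 (j\<^sub>0 u) \<oplus>\<^bsub>U\<^esub> q\<^sub>1 (j\<^sub>1 u) = u"
  shows "in_module_add A T U"
proof -
  interpret U: left_module A U by fact
  interpret T: left_module A T by fact
  interpret W: left_module A "module_power T 2" by (rule T.left_module_power)
  note [simp] = j[THEN module_hom_closed] q[THEN module_hom_closed]
    j[THEN module_hom_add] q[THEN module_hom_add] j[THEN module_hom_smult] q[THEN module_hom_smult]
  let ?W = "module_power T 2"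
  define \<iota> where "\<iota> = (\<lambda>u\<in>carrier U. \<lambda>k\<in>{..<2::nat}. if k = 0 then j\<^sub>0 u else j\<^sub>1 u)"
  \<comment> \<open>the summing map whose restriction to the image of \<open>\<iota>\<close> inverts \<open>\<iota>\<close>\<close>
  define \<sigma> where "\<sigma> = (\<lambda>t::nat \<Rightarrow> _. q\<^sub>0 (t 0) \<oplus>\<^bsub>U\<^esub> q\<^sub>1 (t 1))"
  have tD [simp]: "t 0 \<in> carrier T" "t (Suc 0) \<in> carrier T" if "t \<in> carrier ?W" for t
    using that by (auto simp: module_power_def PiE_iff)
  have \<iota>_hom: "\<iota> \<in> module_hom A U ?W"
    unfolding module_hom_def
  proof (intro CollectI conjI ballI PiE_I)
    fix u assume "u \<in> carrier U"
    then show "\<iota> u \<in> carrier ?W" by (simp add: \<iota>_def module_power_def)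
  next
    fix u assume "u \<notin> carrier U"
    then show "\<iota> u = undefined" by (simp add: \<iota>_def)
  next
    fix u v assume "u \<in> carrier U" "v \<in> carrier U"
    then show "\<iota> (u \<oplus>\<^bsub>U\<^esub> v) = \<iota> u \<oplus>\<^bsub>?W\<^esub> \<iota> v"
      by (simp add: \<iota>_def module_power_def fun_eq_iff)
  next
    fix a u assume "a \<in> carrier A" "u \<in> carrier U"
    then show "\<iota> (a \<odot>\<^bsub>U\<^esub> u) = a \<odot>\<^bsub>?W\<^esub> \<iota> u"
      by (simp add: \<iota>_def module_power_def fun_eq_iff)
  qed
  have \<sigma>_closed [simp]: "\<sigma> t \<in> carrier U" if "t \<in> carrier ?W" for t
    using that by (simp add: \<sigma>_def)
  have \<sigma>_add: "\<sigma> (s \<oplus>\<^bsub>?W\<^esub> t) = \<sigma> s \<oplus>\<^bsub>U\<^esub> \<sigma> t" if "s \<in> carrier ?W" "t \<in> carrier ?W" for s t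
    using that tD[OF that(1)] tD[OF that(2)]
    by (simp add: \<sigma>_def module_power_def U.M.a_assoc U.M.a_lcomm)
  have \<sigma>_smult: "\<sigma> (a \<odot>\<^bsub>?W\<^esub> t) = a \<odot>\<^bsub>U\<^esub> \<sigma> t" if "a \<in> carrier A" "t \<in> carrier ?W" for a t
    using that tD[OF that(2)] by (simp add: \<sigma>_def module_power_def U.smult_r_distr)
  have \<sigma>_zero: "\<sigma> \<zero>\<^bsub>?W\<^esub> = \<zero>\<^bsub>U\<^esub>"
    using q[THEN module_hom_zero, OF T U] by (simp add: \<sigma>_def module_power_def)
  have \<sigma>_\<iota>: "\<sigma> (\<iota> u) = u" if "u \<in> carrier U" for u
    using that split by (simp add: \<sigma>_def \<iota>_def)
  have \<iota>_closed [simp]: "\<iota> u \<in> carrier ?W" if "u \<in> carrier U" for u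
    using \<iota>_hom that by (rule module_hom_closed)
  define L where "L = {t \<in> carrier ?W. \<sigma> t = \<zero>\<^bsub>U\<^esub>}"
  have "submodule L A ?W"
    by (rule W.submoduleI) (auto simp: L_def \<sigma>_add \<sigma>_smult \<sigma>_zero)
  moreover have "inj_on \<iota> (carrier U)"
    by (rule inj_on_inverseI) (rule \<sigma>_\<iota>)
  moreover have "\<iota> ` carrier U \<inter> L = {\<zero>\<^bsub>?W\<^esub>}"
  proof -
    have "\<iota> \<zero>\<^bsub>U\<^esub> = \<zero>\<^bsub>?W\<^esub>" using \<iota>_hom U W.left_module_axioms by (rule module_hom_zero)
    then show ?thesis
      using \<sigma>_\<iota> \<sigma>_zero by (auto simp: L_def image_iff intro!: bexI[of _ "\<zero>\<^bsub>U\<^esub>"])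
  qed
  moreover have "\<exists>u\<in>carrier U. \<exists>l\<in>L. t = \<iota> u \<oplus>\<^bsub>?W\<^esub> l" if t: "t \<in> carrier ?W" for t
  proof (intro bexI)
    let ?l = "\<ominus>\<^bsub>?W\<^esub> \<iota> (\<sigma> t) \<oplus>\<^bsub>?W\<^esub> t"
    show "t = \<iota> (\<sigma> t) \<oplus>\<^bsub>?W\<^esub> ?l" using t by (simp add: W.M.r_neg2)
    have "\<sigma> t = \<sigma> (\<iota> (\<sigma> t) \<oplus>\<^bsub>?W\<^esub> ?l)" using t by (simp add: W.M.r_neg2)
    also have "\<dots> = \<sigma> t \<oplus>\<^bsub>U\<^esub> \<sigma> ?l" using t by (simp add: \<sigma>_add \<sigma>_\<iota>)
    finally have "\<sigma> ?l = \<zero>\<^bsub>U\<^esub>"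
      using t U.M.add.r_cancel_one'[of "\<sigma> t" "\<sigma> ?l"] by simp
    then show "?l \<in> L" using t by (simp add: L_def)
    show "\<sigma> t \<in> carrier U" using t by simp
  qed
  ultimately have "module_direct_summand A U ?W"
    unfolding module_direct_summand_def using U \<iota>_hom by blast
  then show ?thesis unfolding in_module_add_def by blast
qed

section \<open>Modules over an endomorphism ring\<close>

locale hom_modules = additive_linear_category R C
  for R :: "('r, 's) ring_scheme" (structure) and C :: "('o, 'm, 'r, 'z) lin_cat_scheme" +
  fixes V :: 'o
  assumes V_obj [simp]: "V \<in> Obj C"
begin

abbreviation A :: "'m ring" where "A \<equiv> End_ring C V"

text \<open>
  Every module that occurs below is the image of \<open>Hom(V, Z') \<rightarrow> Hom(V, Z)\<close> for some \<open>z : Z' \<rightarrow> Z\<close>: the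
  identity of \<open>Z\<close> gives \<open>Hom(V, Z)\<close> itself. Its elements are encoded by an injection \<open>e\<close>, because
  the terms of resolutions and coresolutions have to live in types other than that of the morphisms.
\<close>

definition image_Hom :: "'o \<Rightarrow> 'o \<Rightarrow> 'm \<Rightarrow> 'm set"
  where "image_Hom Z' Z z = (\<lambda>s. s \<cdot>[V,Z',Z] z) ` Hom_set C V Z'"

definition image_module :: "('m \<Rightarrow> 'u) \<Rightarrow> 'o \<Rightarrow> 'o \<Rightarrow> 'm \<Rightarrow> ('m, 'u) module"
  where "image_module e Z' Z z =
    \<lparr>carrier = e ` image_Hom Z' Z z,
     monoid.mult = (\<lambda>x y. undefined),
     one = undefined,
     zero = e \<zero>[V,Z],
     add = (\<lambda>x y. e (the_inv e x \<oplus>[V,Z] the_inv e y)),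
     smult = (\<lambda>a x. e (a \<cdot>[V,V,Z] the_inv e x))\<rparr>"

abbreviation Hom_module :: "('m \<Rightarrow> 'u) \<Rightarrow> 'o \<Rightarrow> ('m, 'u) module"
  where "Hom_module e Z \<equiv> image_module e Z Z (Ident C Z)"

definition postcompose :: "('m \<Rightarrow> 'u) \<Rightarrow> ('m \<Rightarrow> 'v) \<Rightarrow> 'o \<Rightarrow> 'o \<Rightarrow> 'm \<Rightarrow> 'o \<Rightarrow> 'm \<Rightarrow> 'u \<Rightarrow> 'v"
  where "postcompose e e' Z' Z z U u = (\<lambda>x\<in>e ` image_Hom Z' Z z. e' (the_inv e x \<cdot>[V,Z,U] u))"

lemma image_module_simps [simp]:
  "carrier (image_module e Z' Z z) = e ` image_Hom Z' Z z"
  "\<zero>\<^bsub>image_module e Z' Z z\<^esub> = e \<zero>[V,Z]"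
  "inj e \<Longrightarrow> e x \<oplus>\<^bsub>image_module e Z' Z z\<^esub> e y = e (x \<oplus>[V,Z] y)"
  "inj e \<Longrightarrow> a \<odot>\<^bsub>image_module e Z' Z z\<^esub> e x = e (a \<cdot>[V,V,Z] x)"
  by (simp_all add: image_module_def the_inv_f_f)

lemma image_HomI [simp, intro]:
  "s \<in> Hom_set C V Z' \<Longrightarrow> s \<cdot>[V,Z',Z] z \<in> image_Hom Z' Z z"
  by (simp add: image_Hom_def)

lemma image_HomE:
  assumes "x \<in> image_Hom Z' Z z"
  obtains s where "s \<in> Hom_set C V Z'" "x = s \<cdot>[V,Z',Z] z"
  using assms by (auto simp: image_Hom_def)

lemma image_Hom_Ident [simp]: "Z \<in> Obj C \<Longrightarrow> image_Hom Z Z (Ident C Z) = Hom_set C V Z"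
  by (auto simp: image_Hom_def image_iff)

lemma image_Hom_subset:
  "\<lbrakk>Z' \<in> Obj C; Z \<in> Obj C; z \<in> Hom_set C Z' Z; x \<in> image_Hom Z' Z z\<rbrakk> \<Longrightarrow> x \<in> Hom_set C V Z"
  by (auto elim: image_HomE)

lemma image_Hom_zero:
  "\<lbrakk>Z' \<in> Obj C; Z \<in> Obj C; z \<in> Hom_set C Z' Z\<rbrakk> \<Longrightarrow> \<zero>[V,Z] \<in> image_Hom Z' Z z"
  using image_HomI[of "\<zero>[V,Z']" Z' Z z] by simp

lemma image_Hom_add:
  assumes "Z' \<in> Obj C" "Z \<in> Obj C" "z \<in> Hom_set C Z' Z"
    and "x \<in> image_Hom Z' Z z" "y \<in> image_Hom Z' Z z"
  shows "x \<oplus>[V,Z] y \<in> image_Hom Z' Z z"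
  using assms(4,5)
proof (elim image_HomE)
  fix s t assume "s \<in> Hom_set C V Z'" "t \<in> Hom_set C V Z'" "x = s \<cdot>[V,Z',Z] z" "y = t \<cdot>[V,Z',Z] z"
  then show ?thesis
    using assms image_HomI[of "s \<oplus>[V,Z'] t" Z' Z z] by (simp add: Comp_add_left)
qed

lemma image_Hom_smult:
  assumes "Z' \<in> Obj C" "Z \<in> Obj C" "z \<in> Hom_set C Z' Z"
    and "x \<in> image_Hom Z' Z z" "a \<in> Hom_set C V V"
  shows "a \<cdot>[V,V,Z] x \<in> image_Hom Z' Z z"
  using assms(4)
proof (elim image_HomE)
  fix s assume "s \<in> Hom_set C V Z'" "x = s \<cdot>[V,Z',Z] z"
  then show ?thesis
    using assms image_HomI[of "a \<cdot>[V,V,Z'] s" Z' Z z] by simp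
qed

lemma left_module_image_module:
  assumes e [simp]: "inj e" and [simp]: "Z' \<in> Obj C" "Z \<in> Obj C" "z \<in> Hom_set C Z' Z"
  shows "left_module A (image_module e Z' Z z)"
proof -
  note [simp] = image_Hom_subset[of Z' Z z] image_Hom_zero image_Hom_add image_Hom_smult
  have "abelian_group (image_module e Z' Z z)"
  proof (rule abelian_groupI)
    fix x assume "x \<in> carrier (image_module e Z' Z z)"
    then obtain s where s [simp]: "s \<in> Hom_set C V Z'" and x: "x = e (s \<cdot>[V,Z',Z] z)"
      by (auto elim: image_HomE)
    show "\<exists>y\<in>carrier (image_module e Z' Z z). y \<oplus>\<^bsub>image_module e Z' Z z\<^esub> x = \<zero>\<^bsub>image_module e Z' Z
        z\<^esub>"
      using image_HomI[of "\<ominus>[V,Z'] s" Z' Z z]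
      by (intro bexI[of _ "e (\<ominus>[V,Z] (s \<cdot>[V,Z',Z] z))"]) (simp_all add: x)
  qed (auto simp: Mor_add_ac)
  then show ?thesis
    by (intro left_module.intro left_module_axioms.intro ring_End_ring)
      (auto simp: Comp_add_left Comp_add_right)
qed

lemma postcompose_apply [simp]:
  "\<lbrakk>inj e; x \<in> image_Hom Z' Z z\<rbrakk> \<Longrightarrow> postcompose e e' Z' Z z U u (e x) = e' (x \<cdot>[V,Z,U] u)"
  by (simp add: postcompose_def the_inv_f_f)

text \<open>
  A morphism \<open>u\<close> of targets induces a map of images as soon as it lifts to a morphism \<open>c\<close> of
  sources.
\<close>

lemma postcompose_hom:
  assumes e [simp]: "inj e" "inj e'"
    and [simp]: "Z' \<in> Obj C" "Z \<in> Obj C" "z \<in> Hom_set C Z' Z"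
      "U' \<in> Obj C" "U \<in> Obj C" "v \<in> Hom_set C U' U" "u \<in> Hom_set C Z U" "c \<in> Hom_set C Z' U'"
    and square: "z \<cdot>[Z',Z,U] u = c \<cdot>[Z',U',U] v"
  shows "postcompose e e' Z' Z z U u \<in> module_hom A (image_module e Z' Z z) (image_module e' U' U
      v)"
proof -
  note [simp] = image_Hom_subset[of Z' Z z] image_Hom_add image_Hom_smult
  have closed: "x \<cdot>[V,Z,U] u \<in> image_Hom U' U v" if "x \<in> image_Hom Z' Z z" for x
  proof -
    from that obtain s where [simp]: "s \<in> Hom_set C V Z'" and x: "x = s \<cdot>[V,Z',Z] z"
      by (elim image_HomE)
    show ?thesis using image_HomI[of "s \<cdot>[V,Z',U'] c" U' U v] by (simp add: x square)
  qed
  show ?thesis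
    unfolding module_hom_def
  proof (intro CollectI conjI ballI PiE_I)
    fix x assume "x \<notin> carrier (image_module e Z' Z z)"
    then show "postcompose e e' Z' Z z U u x = undefined" by (simp add: postcompose_def)
  qed (auto simp: closed Comp_add_left)
qed

subsection \<open>Projective modules\<close>

text \<open>
  If the identity of \<open>Z\<close> is a sum \<open>i p + j q\<close> of morphisms through \<open>V\<close>, then \<open>p\<close> and \<open>q\<close>, with the
  coordinate maps given by composition with \<open>i\<close> and \<open>j\<close>, form a dual basis of \<open>Hom(V, Z)\<close>.
\<close>

lemma dual_basis:
  assumes e [simp]: "inj e" and [simp]: "Z \<in> Obj C"
    and cl [simp]: "i \<in> Hom_set C Z V" "p \<in> Hom_set C V Z" "j \<in> Hom_set C Z V" "q \<in> Hom_set C V Z"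
    and sum: "i \<cdot>[Z,V,Z] p \<oplus>[Z,Z] j \<cdot>[Z,V,Z] q = Ident C Z"
    and \<phi>: "\<phi> \<in> module_hom A (Hom_module e Z) N" and x [simp]: "x \<in> Hom_set C V Z"
  shows "\<phi> (e x) = (x \<cdot>[V,Z,V] i) \<odot>\<^bsub>N\<^esub> \<phi> (e p) \<oplus>\<^bsub>N\<^esub> (x \<cdot>[V,Z,V] j) \<odot>\<^bsub>N\<^esub> \<phi> (e q)"
proof -
  let ?H = "Hom_module e Z"
  have "x = x \<cdot>[V,Z,Z] (i \<cdot>[Z,V,Z] p \<oplus>[Z,Z] j \<cdot>[Z,V,Z] q)" by (simp add: sum)
  then have "e x = (x \<cdot>[V,Z,V] i) \<odot>\<^bsub>?H\<^esub> e p \<oplus>\<^bsub>?H\<^esub> (x \<cdot>[V,Z,V] j) \<odot>\<^bsub>?H\<^esub> e q"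
    by (simp add: Comp_add_right)
  also have "\<phi> \<dots> = \<phi> ((x \<cdot>[V,Z,V] i) \<odot>\<^bsub>?H\<^esub> e p) \<oplus>\<^bsub>N\<^esub> \<phi> ((x \<cdot>[V,Z,V] j) \<odot>\<^bsub>?H\<^esub> e q)"
    by (rule module_hom_add[OF \<phi>]) simp_all
  also have "\<phi> ((x \<cdot>[V,Z,V] i) \<odot>\<^bsub>?H\<^esub> e p) = (x \<cdot>[V,Z,V] i) \<odot>\<^bsub>N\<^esub> \<phi> (e p)"
    by (rule module_hom_smult[OF \<phi>]) simp_all
  also have "\<phi> ((x \<cdot>[V,Z,V] j) \<odot>\<^bsub>?H\<^esub> e q) = (x \<cdot>[V,Z,V] j) \<odot>\<^bsub>N\<^esub> \<phi> (e q)"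
    by (rule module_hom_smult[OF \<phi>]) simp_all
  finally show ?thesis .
qed

text \<open>
  A homomorphism out of a module with a dual basis lifts along a surjection as soon as its values on
  the basis do.
\<close>

lemma projective_Hom_module:
  fixes e :: "'m \<Rightarrow> 'u"
  assumes e [simp]: "inj e" and Z: "summand2 V Z"
  shows "projective_module A (Hom_module e Z)"
  unfolding projective_module_def
proof (intro conjI allI impI ballI)
  have [simp]: "Z \<in> Obj C" using Z by (simp add: summand2_def)
  show "left_module A (Hom_module e Z)" by (rule left_module_image_module) simp_all
  fix M :: "('m, 'u \<Rightarrow> 'm) module" and N :: "('m, 'u) module" and \<epsilon> \<phi>
  assume M: "left_module A M" and N: "left_module A N" and \<epsilon>: "\<epsilon> \<in> module_hom A M N"
    and \<phi>: "\<phi> \<in> module_hom A (Hom_module e Z) N" and surj: "\<epsilon> ` carrier M = carrier N"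
  interpret M: left_module A M by fact
  interpret N: left_module A N by fact
  from Z obtain i p j q where
      [simp]: "i \<in> Hom_set C Z V" "p \<in> Hom_set C V Z" "j \<in> Hom_set C Z V" "q \<in> Hom_set C V Z"
    and sum: "i \<cdot>[Z,V,Z] p \<oplus>[Z,Z] j \<cdot>[Z,V,Z] q = Ident C Z"
    by (elim summand2E)
  have "\<phi> (e p) \<in> \<epsilon> ` carrier M" "\<phi> (e q) \<in> \<epsilon> ` carrier M"
    unfolding surj by (simp_all add: module_hom_closed[OF \<phi>])
  then obtain m n where [simp]: "m \<in> carrier M" "n \<in> carrier M" and mn: "\<epsilon> m = \<phi> (e p)" "\<epsilon> n = \<phi>
      (e q)"
    unfolding image_iff by metis
  let ?\<chi> = "\<lambda>x. (x \<cdot>[V,Z,V] i) \<odot>\<^bsub>M\<^esub> m \<oplus>\<^bsub>M\<^esub> (x \<cdot>[V,Z,V] j) \<odot>\<^bsub>M\<^esub> n"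
  have M_smult [simp]: "a \<odot>\<^bsub>M\<^esub> x \<in> carrier M" if "a \<in> Hom_set C V V" "x \<in> carrier M" for a x
    using M.smult_closed that by simp
  have \<chi>_add: "?\<chi> (x \<oplus>[V,Z] y) = ?\<chi> x \<oplus>\<^bsub>M\<^esub> ?\<chi> y" if "x \<in> Hom_set C V Z" "y \<in> Hom_set C V Z" for x y
    using that M.smult_l_distr[of "x \<cdot>[V,Z,V] i" "y \<cdot>[V,Z,V] i" m]
      M.smult_l_distr[of "x \<cdot>[V,Z,V] j" "y \<cdot>[V,Z,V] j" n]
    by (simp add: Comp_add_left M.M.a_ac)
  have \<chi>_smult: "(a \<cdot>[V,V,V] (x \<cdot>[V,Z,V] i)) \<odot>\<^bsub>M\<^esub> m \<oplus>\<^bsub>M\<^esub> (a \<cdot>[V,V,V] (x \<cdot>[V,Z,V] j)) \<odot>\<^bsub>M\<^esub> n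
      = a \<odot>\<^bsub>M\<^esub> ?\<chi> x" if "a \<in> Hom_set C V V" "x \<in> Hom_set C V Z" for a x
    using that M.smult_assoc[of a "x \<cdot>[V,Z,V] i" m] M.smult_assoc[of a "x \<cdot>[V,Z,V] j" n]
      M.smult_r_distr[of a "(x \<cdot>[V,Z,V] i) \<odot>\<^bsub>M\<^esub> m" "(x \<cdot>[V,Z,V] j) \<odot>\<^bsub>M\<^esub> n"]
    by simp
  define \<psi> where "\<psi> = (\<lambda>y\<in>e ` Hom_set C V Z. ?\<chi> (the_inv e y))"
  have \<psi>_app: "\<psi> (e x) = ?\<chi> x" if "x \<in> Hom_set C V Z" for x
    using that by (simp add: \<psi>_def the_inv_f_f)
  have "\<psi> \<in> module_hom A (Hom_module e Z) M"
    unfolding module_hom_def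
  proof (intro CollectI conjI ballI PiE_I)
    fix x assume "x \<notin> carrier (Hom_module e Z)"
    then show "\<psi> x = undefined" by (simp add: \<psi>_def)
  qed (auto simp: \<psi>_app \<chi>_add \<chi>_smult)
  moreover have "\<epsilon> (\<psi> y) = \<phi> y" if y: "y \<in> carrier (Hom_module e Z)" for y
  proof -
    from y obtain x where [simp]: "x \<in> Hom_set C V Z" and y: "y = e x" by auto
    have "\<epsilon> (\<psi> y) = \<epsilon> ((x \<cdot>[V,Z,V] i) \<odot>\<^bsub>M\<^esub> m \<oplus>\<^bsub>M\<^esub> (x \<cdot>[V,Z,V] j) \<odot>\<^bsub>M\<^esub> n)"
      by (simp add: y \<psi>_app)
    also have "\<dots> = \<epsilon> ((x \<cdot>[V,Z,V] i) \<odot>\<^bsub>M\<^esub> m) \<oplus>\<^bsub>N\<^esub> \<epsilon> ((x \<cdot>[V,Z,V] j) \<odot>\<^bsub>M\<^esub> n)"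
      by (rule module_hom_add[OF \<epsilon>]) simp_all
    also have "\<dots> = (x \<cdot>[V,Z,V] i) \<odot>\<^bsub>N\<^esub> \<phi> (e p) \<oplus>\<^bsub>N\<^esub> (x \<cdot>[V,Z,V] j) \<odot>\<^bsub>N\<^esub> \<phi> (e q)"
      by (simp add: module_hom_smult[OF \<epsilon>] mn)
    also have "\<dots> = \<phi> y"
      unfolding y by (rule dual_basis[symmetric, OF e _ _ _ _ _ sum \<phi>]) simp_all
    finally show ?thesis .
  qed
  ultimately show "\<exists>\<psi>\<in>module_hom A (Hom_module e Z) M. \<forall>y\<in>carrier (Hom_module e Z). \<epsilon> (\<psi> y) = \<phi> y"
    by blast
qed

lemma finitely_generated_Hom_module:
  assumes e [simp]: "inj e" and Z: "summand2 V Z"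
  shows "finitely_generated A (Hom_module e Z)"
proof -
  from Z obtain i p j q where
      [simp]: "i \<in> Hom_set C Z V" "p \<in> Hom_set C V Z" "j \<in> Hom_set C Z V" "q \<in> Hom_set C V Z"
    and sum: "i \<cdot>[Z,V,Z] p \<oplus>[Z,Z] j \<cdot>[Z,V,Z] q = Ident C Z"
    by (elim summand2E)
  have [simp]: "Z \<in> Obj C" using Z by (simp add: summand2_def)
  have "H = carrier (Hom_module e Z)" if H: "submodule H A (Hom_module e Z)" "{e p, e q} \<subseteq> H" for H
  proof
    interpret H: submodule H A "Hom_module e Z" by (rule H)
    show "H \<subseteq> carrier (Hom_module e Z)" using H.subset by simp
    show "carrier (Hom_module e Z) \<subseteq> H"
    proof
      fix y assume "y \<in> carrier (Hom_module e Z)"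
      then obtain x where [simp]: "x \<in> Hom_set C V Z" and y: "y = e x" by auto
      have "x = x \<cdot>[V,Z,Z] (i \<cdot>[Z,V,Z] p \<oplus>[Z,Z] j \<cdot>[Z,V,Z] q)" by (simp add: sum)
      then have "y = (x \<cdot>[V,Z,V] i) \<odot>\<^bsub>Hom_module e Z\<^esub> e p \<oplus>\<^bsub>Hom_module e Z\<^esub> (x \<cdot>[V,Z,V] j)
          \<odot>\<^bsub>Hom_module e Z\<^esub> e q"
        by (simp add: y Comp_add_right)
      moreover have "(x \<cdot>[V,Z,V] i) \<odot>\<^bsub>Hom_module e Z\<^esub> e p \<in> H" "(x \<cdot>[V,Z,V] j) \<odot>\<^bsub>Hom_module e Z\<^esub> e
          q \<in> H"
        using H(2) by (auto intro!: H.smult_closed simp del: image_module_simps)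
      ultimately show "y \<in> H" using H.m_closed by (simp del: image_module_simps)
    qed
  qed
  then show ?thesis
    unfolding finitely_generated_def by (intro exI[of _ "{e p, e q}"]) auto
qed

text \<open>
  The values of \<open>\<phi>\<close> on the dual basis come from morphisms \<open>V \<rightarrow> U'\<close>. Their combination with the
  coordinates \<open>Z \<rightarrow> V\<close> represents \<open>\<phi>\<close> by a morphism that ends in \<open>U'\<close>, not only in \<open>U\<close>.
\<close>

lemma Yoneda:
  assumes e [simp]: "inj e" "inj e'" and Z: "summand2 V Z"
    and [simp]: "U' \<in> Obj C" "U \<in> Obj C" "v \<in> Hom_set C U' U"
    and \<phi>: "\<phi> \<in> module_hom A (Hom_module e Z) (image_module e' U' U v)"
  obtains u where "u \<in> Hom_set C Z U'"
    and "\<And>x. x \<in> Hom_set C V Z \<Longrightarrow> \<phi> (e x) = e' (x \<cdot>[V,Z,U] (u \<cdot>[Z,U',U] v))"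
proof -
  from Z obtain i p j q where
      [simp]: "i \<in> Hom_set C Z V" "p \<in> Hom_set C V Z" "j \<in> Hom_set C Z V" "q \<in> Hom_set C V Z"
    and sum: "i \<cdot>[Z,V,Z] p \<oplus>[Z,Z] j \<cdot>[Z,V,Z] q = Ident C Z"
    by (elim summand2E)
  have [simp]: "Z \<in> Obj C" using Z by (simp add: summand2_def)
  have "\<phi> (e p) \<in> e' ` image_Hom U' U v" "\<phi> (e q) \<in> e' ` image_Hom U' U v"
    using module_hom_closed[OF \<phi>] by simp_all
  then obtain s t where [simp]: "s \<in> Hom_set C V U'" "t \<in> Hom_set C V U'"
    and st: "\<phi> (e p) = e' (s \<cdot>[V,U',U] v)" "\<phi> (e q) = e' (t \<cdot>[V,U',U] v)"
    by (auto elim!: image_HomE)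
  show thesis
  proof
    show "i \<cdot>[Z,V,U'] s \<oplus>[Z,U'] j \<cdot>[Z,V,U'] t \<in> Hom_set C Z U'" by simp
    fix x assume [simp]: "x \<in> Hom_set C V Z"
    have "\<phi> (e x) = (x \<cdot>[V,Z,V] i) \<odot>\<^bsub>image_module e' U' U v\<^esub> \<phi> (e p)
        \<oplus>\<^bsub>image_module e' U' U v\<^esub> (x \<cdot>[V,Z,V] j) \<odot>\<^bsub>image_module e' U' U v\<^esub> \<phi> (e q)"
      by (rule dual_basis[OF e(1) _ _ _ _ _ sum \<phi>]) simp_all
    then show "\<phi> (e x) = e' (x \<cdot>[V,Z,U] ((i \<cdot>[Z,V,U'] s \<oplus>[Z,U'] j \<cdot>[Z,V,U'] t) \<cdot>[Z,U',U] v))"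
      by (simp add: st Comp_add_left Comp_add_right)
  qed
qed

lemma Hom_faithful:
  assumes Z: "summand2 V Z" and [simp]: "U \<in> Obj C" and u [simp]: "u \<in> Hom_set C Z U"
    and zero: "\<And>x. x \<in> Hom_set C V Z \<Longrightarrow> x \<cdot>[V,Z,U] u = \<zero>[V,U]"
  shows "u = \<zero>[Z,U]"
proof -
  from Z obtain i p j q where
      [simp]: "i \<in> Hom_set C Z V" "p \<in> Hom_set C V Z" "j \<in> Hom_set C Z V" "q \<in> Hom_set C V Z"
    and sum: "i \<cdot>[Z,V,Z] p \<oplus>[Z,Z] j \<cdot>[Z,V,Z] q = Ident C Z"
    by (elim summand2E)
  have [simp]: "Z \<in> Obj C" using Z by (simp add: summand2_def)
  have "u = (i \<cdot>[Z,V,Z] p \<oplus>[Z,Z] j \<cdot>[Z,V,Z] q) \<cdot>[Z,Z,U] u" by (simp add: sum)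
  also have "\<dots> = \<zero>[Z,U]" by (simp add: Comp_add_left zero)
  finally show ?thesis .
qed

end

section \<open>Homomorphisms and the vanishing of Ext\<close>

lemma module_hom_eqI:
  assumes "\<phi> \<in> module_hom A M N" "\<psi> \<in> module_hom A M N"
    and "\<And>x. x \<in> carrier M \<Longrightarrow> \<phi> x = \<psi> x"
  shows "\<phi> = \<psi>"
  using assms by (intro PiE_ext[of _ "carrier M" "\<lambda>_. carrier N"]) (auto simp: module_hom_def)

lemma module_hom_comp:
  assumes \<phi>: "\<phi> \<in> module_hom A M N" and \<psi>: "\<psi> \<in> module_hom A N L" and M: "left_module A M"
  shows "(\<lambda>x\<in>carrier M. \<psi> (\<phi> x)) \<in> module_hom A M L"
proof -
  interpret M: left_module A M by fact
  note cl = \<phi>[THEN module_hom_closed]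
  show ?thesis
    unfolding module_hom_def
    by (auto simp: cl \<phi>[THEN module_hom_add] \<psi>[THEN module_hom_add] \<phi>[THEN module_hom_smult]
        \<psi>[THEN module_hom_smult] \<psi>[THEN module_hom_closed])
qed

lemma zero_module_hom:
  assumes M: "left_module A M" and N: "left_module A N"
  shows "(\<lambda>x\<in>carrier M. \<zero>\<^bsub>N\<^esub>) \<in> module_hom A M N"
proof -
  interpret M: left_module A M by fact
  interpret N: left_module A N by fact
  show ?thesis unfolding module_hom_def by auto
qed

lemma Ext_coboundaries_subset_cocycles:
  assumes res: "projective_resolution A P \<delta> \<epsilon> M" and N: "left_module A N"
  shows "Ext_coboundaries A P \<delta> N i \<subseteq> Ext_cocycles A P \<delta> N i"
proof -
  have P: "left_module A (P i)" for i
    using res by (auto simp: projective_resolution_def projective_module_def)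
  have \<delta>: "\<delta> i \<in> module_hom A (P (Suc i)) (P i)" for i
    using res by (auto simp: projective_resolution_def)
  have \<delta>\<delta>: "\<delta> i (\<delta> (Suc i) x) = \<zero>\<^bsub>P i\<^esub>" if "x \<in> carrier (P (Suc (Suc i)))" for i x
  proof -
    have "\<delta> (Suc i) x \<in> module_kernel (P (Suc i)) (P i) (\<delta> i)"
      using res that unfolding projective_resolution_def by blast
    then show ?thesis by (simp add: module_kernel_def)
  qed
  show ?thesis
  proof (cases i)
    case 0
    have "(\<lambda>x\<in>carrier (P 0). \<zero>\<^bsub>N\<^esub>) \<in> Ext_cocycles A P \<delta> N 0"
      using zero_module_hom[OF P N] module_hom_closed[OF \<delta>] by (auto simp: Ext_cocycles_def)
    then show ?thesis by (simp add: 0)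
  next
    case (Suc k)
    have "(\<lambda>x\<in>carrier (P (Suc k)). \<psi> (\<delta> k x)) \<in> Ext_cocycles A P \<delta> N (Suc k)"
      if \<psi>: "\<psi> \<in> module_hom A (P k) N" for \<psi>
      using module_hom_comp[OF \<delta> \<psi> P] module_hom_closed[OF \<delta>] \<delta>\<delta> module_hom_zero[OF \<psi> P N]
      by (auto simp: Ext_cocycles_def)
    then show ?thesis by (auto simp: Suc)
  qed
qed

lemma Ext_zero_of_zero_term:
  assumes res: "projective_resolution A P \<delta> \<epsilon> M" and N: "left_module A N"
    and zero: "carrier (P (Suc k)) = {\<zero>\<^bsub>P (Suc k)\<^esub>}"
  shows "Ext_cocycles A P \<delta> N (Suc k) = Ext_coboundaries A P \<delta> N (Suc k)"
proof
  show "Ext_coboundaries A P \<delta> N (Suc k) \<subseteq> Ext_cocycles A P \<delta> N (Suc k)"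
    using res N by (rule Ext_coboundaries_subset_cocycles)
  have P: "left_module A (P i)" for i
    using res by (auto simp: projective_resolution_def projective_module_def)
  have \<delta>: "\<delta> i \<in> module_hom A (P (Suc i)) (P i)" for i
    using res by (auto simp: projective_resolution_def)
  show "Ext_cocycles A P \<delta> N (Suc k) \<subseteq> Ext_coboundaries A P \<delta> N (Suc k)"
  proof
    fix \<phi> assume "\<phi> \<in> Ext_cocycles A P \<delta> N (Suc k)"
    then have \<phi>: "\<phi> \<in> module_hom A (P (Suc k)) N" by (simp add: Ext_cocycles_def)
    let ?\<psi> = "\<lambda>x\<in>carrier (P k). \<zero>\<^bsub>N\<^esub>"
    have \<psi>: "?\<psi> \<in> module_hom A (P k) N" by (rule zero_module_hom[OF P N])
    have "\<phi> = (\<lambda>x\<in>carrier (P (Suc k)). ?\<psi> (\<delta> k x))"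
      using module_hom_closed[OF \<delta>, of _ k] zero module_hom_zero[OF \<phi> P N]
      by (intro module_hom_eqI[OF \<phi> module_hom_comp[OF \<delta> \<psi> P]]) auto
    then show "\<phi> \<in> Ext_coboundaries A P \<delta> N (Suc k)"
      unfolding Ext_coboundaries.simps using \<psi> by (rule image_eqI)
  qed
qed

lemma nat_cases_2:
  fixes i :: nat
  obtains "i = 0" | "i = Suc 0" | k where "i = Suc (Suc k)"
  by (cases i; cases "i - 1") auto

section \<open>A tilting module from a presentation\<close>

context hom_modules
begin

lemma postcompose_image:
  "inj e \<Longrightarrow> postcompose e e' Z' Z z U u ` carrier (image_module e Z' Z z)
     = e' ` (\<lambda>x. x \<cdot>[V,Z,U] u) ` image_Hom Z' Z z"
  by (auto simp: image_iff)

lemma postcompose_kernel: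
  assumes "inj e" "inj e'"
  shows "module_kernel (image_module e Z' Z z) (image_module e' U' U v) (postcompose e e' Z' Z z U
      u)
     = e ` {x \<in> image_Hom Z' Z z. x \<cdot>[V,Z,U] u = \<zero>[V,U]}"
  using assms by (auto simp: module_kernel_def inj_eq)

lemma arrow_summand2_imp_in_module_add:
  assumes e [simp]: "inj e" "inj e'"
    and S [simp]: "S' \<in> Obj C" "S \<in> Obj C" "s \<in> Hom_set C S' S"
    and Z: "arrow_summand2 S' S s Z' Z z"
  shows "in_module_add A (image_module e S' S s) (image_module e' Z' Z z)"
proof -
  from Z have [simp]: "Z' \<in> Obj C" "Z \<in> Obj C" "z \<in> Hom_set C Z' Z"
    by (auto simp: arrow_summand2_def)
  from Z obtain a b c d a' b' c' d' where
    cl [simp]: "a \<in> Hom_set C Z S" "b \<in> Hom_set C S Z" "c \<in> Hom_set C Z S" "d \<in> Hom_set C S Z"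
      "a' \<in> Hom_set C Z' S'" "b' \<in> Hom_set C S' Z'" "c' \<in> Hom_set C Z' S'" "d' \<in> Hom_set C S' Z'"
    and sq: "z \<cdot>[Z',Z,S] a = a' \<cdot>[Z',S',S] s" "s \<cdot>[S',S,Z] b = b' \<cdot>[S',Z',Z] z"
       "z \<cdot>[Z',Z,S] c = c' \<cdot>[Z',S',S] s" "s \<cdot>[S',S,Z] d = d' \<cdot>[S',Z',Z] z"
    and sum: "a \<cdot>[Z,S,Z] b \<oplus>[Z,Z] c \<cdot>[Z,S,Z] d = Ident C Z"
    unfolding arrow_summand2_def by blast
  let ?T = "image_module e S' S s" and ?U = "image_module e' Z' Z z"
  let ?j = "postcompose e' e Z' Z z S" and ?q = "postcompose e e' S' S s Z"
  have hom: "?j a \<in> module_hom A ?U ?T" "?j c \<in> module_hom A ?U ?T"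
    "?q b \<in> module_hom A ?T ?U" "?q d \<in> module_hom A ?T ?U"
    by (rule postcompose_hom[where c = a'] postcompose_hom[where c = c']
        postcompose_hom[where c = b'] postcompose_hom[where c = d']; simp add: sq)+
  show ?thesis
  proof (rule in_module_addI[OF _ _ hom])
    fix u assume u: "u \<in> carrier ?U"
    then obtain x where x: "x \<in> image_Hom Z' Z z" and u: "u = e' x" by auto
    then have [simp]: "x \<in> Hom_set C V Z" using image_Hom_subset[of Z' Z z] by simp
    have [simp]: "x \<cdot>[V,Z,S] a \<in> image_Hom S' S s" "x \<cdot>[V,Z,S] c \<in> image_Hom S' S s"
      using module_hom_closed[OF hom(1), of u] module_hom_closed[OF hom(2), of u] x
      by (auto simp: u inj_image_mem_iff)
    show "?q b (?j a u) \<oplus>\<^bsub>?U\<^esub> ?q d (?j c u) = u"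
      using x by (simp add: u sum flip: Comp_add_right)
  qed (simp_all add: left_module_image_module)
qed

end

text \<open>
  Each group of conditions provides one property of the image \<open>T\<close> of \<open>Hom(V, P\<^sub>0) \<rightarrow> Hom(V, W)\<close>. The
  exactness of \<open>Hom(V, P\<^sub>1) \<rightarrow> Hom(V, P\<^sub>0) \<rightarrow> Hom(V, W)\<close> yields a projective resolution of \<open>T\<close>, and
  \<open>extend\<close> kills its first self-extensions. The conditions \<open>cokernel\<close>, \<open>epi\<close> and \<open>lift\<close> identify the
  endomorphisms of \<open>T\<close> with those of \<open>W\<close>. The conditions on \<open>V \<rightarrow> Q\<^sub>0 \<rightarrow> Q\<^sub>1\<close> yield a coresolution of
  the regular module by \<open>Hom(V, Q\<^sub>0)\<close> and the image of \<open>Hom(V, Q\<^sub>0) \<rightarrow> Hom(V, Q\<^sub>1)\<close>, which are in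
  \<open>add(T)\<close>.
\<close>

locale tilting_presentation = hom_modules R C V
  for R :: "('r, 's) ring_scheme" (structure) and C :: "('o, 'm, 'r, 'z) lin_cat_scheme" and V ::
      'o +
  fixes P\<^sub>1 P\<^sub>0 W Q\<^sub>0 Q\<^sub>1 :: 'o and f g j q :: 'm
  assumes objs [simp]: "W \<in> Obj C" "Q\<^sub>1 \<in> Obj C"
    and P\<^sub>1: "summand2 V P\<^sub>1" and P\<^sub>0: "summand2 V P\<^sub>0"
    and fg_closed [simp]: "f \<in> Hom_set C P\<^sub>1 P\<^sub>0" "g \<in> Hom_set C P\<^sub>0 W"
    and fg: "f \<cdot>[P\<^sub>1,P\<^sub>0,W] g = \<zero>[P\<^sub>1,W]"
    and exact_P\<^sub>0: "\<And>s. \<lbrakk>s \<in> Hom_set C V P\<^sub>0; s \<cdot>[V,P\<^sub>0,W] g = \<zero>[V,W]\<rbrakk>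
        \<Longrightarrow> \<exists>s'\<in>Hom_set C V P\<^sub>1. s = s' \<cdot>[V,P\<^sub>1,P\<^sub>0] f"
    and exact_P\<^sub>1: "\<And>s. \<lbrakk>s \<in> Hom_set C V P\<^sub>1; s \<cdot>[V,P\<^sub>1,P\<^sub>0] f = \<zero>[V,P\<^sub>0]\<rbrakk> \<Longrightarrow> s = \<zero>[V,P\<^sub>1]"
    and cokernel: "\<And>u. \<lbrakk>u \<in> Hom_set C P\<^sub>0 W; f \<cdot>[P\<^sub>1,P\<^sub>0,W] u = \<zero>[P\<^sub>1,W]\<rbrakk>
        \<Longrightarrow> \<exists>b\<in>Hom_set C W W. u = g \<cdot>[P\<^sub>0,W,W] b"
    and epi: "\<And>b. \<lbrakk>b \<in> Hom_set C W W; g \<cdot>[P\<^sub>0,W,W] b = \<zero>[P\<^sub>0,W]\<rbrakk> \<Longrightarrow> b = \<zero>[W,W]"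
    and extend: "\<And>x. x \<in> Hom_set C P\<^sub>1 P\<^sub>0 \<Longrightarrow> \<exists>y\<in>Hom_set C P\<^sub>0 P\<^sub>0. x = f \<cdot>[P\<^sub>1,P\<^sub>0,P\<^sub>0] y"
    and lift: "\<And>u. u \<in> Hom_set C P\<^sub>0 W \<Longrightarrow> \<exists>c\<in>Hom_set C P\<^sub>0 P\<^sub>0. u = c \<cdot>[P\<^sub>0,P\<^sub>0,W] g"
    and jq_closed [simp]: "j \<in> Hom_set C V Q\<^sub>0" "q \<in> Hom_set C Q\<^sub>0 Q\<^sub>1"
    and jq: "j \<cdot>[V,Q\<^sub>0,Q\<^sub>1] q = \<zero>[V,Q\<^sub>1]"
    and exact_Q\<^sub>0: "\<And>s. \<lbrakk>s \<in> Hom_set C V Q\<^sub>0; s \<cdot>[V,Q\<^sub>0,Q\<^sub>1] q = \<zero>[V,Q\<^sub>1]\<rbrakk>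
        \<Longrightarrow> \<exists>s'\<in>Hom_set C V V. s = s' \<cdot>[V,V,Q\<^sub>0] j"
    and exact_V: "\<And>s. \<lbrakk>s \<in> Hom_set C V V; s \<cdot>[V,V,Q\<^sub>0] j = \<zero>[V,Q\<^sub>0]\<rbrakk> \<Longrightarrow> s = \<zero>[V,V]"
    and Q\<^sub>0: "arrow_summand2 P\<^sub>0 W g Q\<^sub>0 Q\<^sub>0 (Ident C Q\<^sub>0)"
    and Q\<^sub>1: "arrow_summand2 P\<^sub>0 W g Q\<^sub>0 Q\<^sub>1 q"
begin

lemma objs' [simp]: "P\<^sub>1 \<in> Obj C" "P\<^sub>0 \<in> Obj C" "Q\<^sub>0 \<in> Obj C"
  using P\<^sub>1 P\<^sub>0 Q\<^sub>0 by (auto simp: summand2_def arrow_summand2_def)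

definition "zero_object = (SOME Z. zero_obj C Z)"

lemma zero_object: "zero_obj C zero_object"
  unfolding zero_object_def using ex_zero_obj by (rule someI_ex)

lemma zero_object_simps [simp]:
  "zero_object \<in> Obj C" "Hom_set C V zero_object = {\<zero>[V,zero_object]}"
  using zero_object by (auto simp: zero_obj_def)

subsection \<open>The tilting module and its projective resolution\<close>

text \<open>
  Injections of the morphisms into the element types that the definitions of a tilting module and of
  its resolutions prescribe.
\<close>

definition enc_T :: "'m \<Rightarrow> (nat \<Rightarrow> 'm) set" where "enc_T x = {\<lambda>_. x}"
definition enc_P :: "'m \<Rightarrow> nat \<Rightarrow> 'm \<times> (nat \<Rightarrow> 'm) set" where "enc_P x = (\<lambda>_. (x, {}))"
definition enc_Q :: "'m \<Rightarrow> nat \<Rightarrow> (nat \<Rightarrow> 'm) set" where "enc_Q x = (\<lambda>_. {\<lambda>_. x})"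

lemma inj_enc [simp]: "inj enc_T" "inj enc_P" "inj enc_Q"
  by (auto intro!: injI simp: enc_T_def enc_P_def enc_Q_def fun_eq_iff)

abbreviation T :: "('m, (nat \<Rightarrow> 'm) set) module" where "T \<equiv> image_module enc_T P\<^sub>0 W g"

lemma left_module_T: "left_module A T"
  by (rule left_module_image_module) simp_all

definition P_obj :: "nat \<Rightarrow> 'o"
  where "P_obj i = (if i = 0 then P\<^sub>0 else if i = 1 then P\<^sub>1 else zero_object)"
definition P_mor :: "nat \<Rightarrow> 'm"
  where "P_mor i = (if i = 0 then f else \<zero>[P_obj (Suc i), P_obj i])"

abbreviation Pr :: "nat \<Rightarrow> ('m, nat \<Rightarrow> 'm \<times> (nat \<Rightarrow> 'm) set) module"
  where "Pr i \<equiv> Hom_module enc_P (P_obj i)"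
abbreviation \<delta> :: "nat \<Rightarrow> (nat \<Rightarrow> 'm \<times> (nat \<Rightarrow> 'm) set) \<Rightarrow> nat \<Rightarrow> 'm \<times> (nat \<Rightarrow> 'm) set"
  where "\<delta> i \<equiv> postcompose enc_P enc_P (P_obj (Suc i)) (P_obj (Suc i)) (Ident C (P_obj (Suc i)))
    (P_obj i) (P_mor i)"
abbreviation \<epsilon> :: "(nat \<Rightarrow> 'm \<times> (nat \<Rightarrow> 'm) set) \<Rightarrow> (nat \<Rightarrow> 'm) set"
  where "\<epsilon> \<equiv> postcompose enc_P enc_T P\<^sub>0 P\<^sub>0 (Ident C P\<^sub>0) W g"

lemma P_obj_simps [simp]:
  "P_obj 0 = P\<^sub>0" "P_obj (Suc 0) = P\<^sub>1" "P_obj (Suc (Suc i)) = zero_object"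
  "P_mor 0 = f" "P_mor (Suc i) = \<zero>[zero_object, P_obj (Suc i)]"
  by (simp_all add: P_obj_def P_mor_def)

lemma P_obj_summand2: "summand2 V (P_obj i)"
  using P\<^sub>0 P\<^sub>1 zero_obj_summand2[OF zero_object V_obj] by (simp add: P_obj_def)

lemma P_obj_closed [simp]: "P_obj i \<in> Obj C"
  using P_obj_summand2 by (simp add: summand2_def)

lemma P_mor_closed [simp]: "P_mor i \<in> Hom_set C (P_obj (Suc i)) (P_obj i)"
  by (cases i) simp_all

lemma projective_resolution_T: "projective_resolution A Pr \<delta> \<epsilon> T"
  unfolding projective_resolution_def
proof (intro conjI allI)
  fix i
  show "projective_module A (Pr i)"
    by (rule projective_Hom_module) (simp_all add: P_obj_summand2)
  show "\<delta> i \<in> module_hom A (Pr (Suc i)) (Pr i)"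
    by (rule postcompose_hom[where c = "P_mor i"]) simp_all
  have "(\<lambda>x. x \<cdot>[V,zero_object,P_obj (Suc i)] \<zero>[zero_object,P_obj (Suc i)]) ` Hom_set C V
      zero_object
      = {\<zero>[V,P_obj (Suc i)]}"
    by simp
  also have "\<dots> = {x \<in> Hom_set C V (P_obj (Suc i)). x \<cdot>[V,P_obj (Suc i),P_obj i] P_mor i =
      \<zero>[V,P_obj i]}"
  proof (cases i)
    case 0
    then show ?thesis using exact_P\<^sub>1 by auto
  qed auto
  finally show "\<delta> (Suc i) ` carrier (Pr (Suc (Suc i))) = module_kernel (Pr (Suc i)) (Pr i) (\<delta> i)"
    by (simp add: postcompose_image postcompose_kernel del: image_module_simps)
next
  show "\<epsilon> \<in> module_hom A (Pr 0) T"
    unfolding P_obj_simps by (rule postcompose_hom[where c = "Ident C P\<^sub>0"]) simp_all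
  show "\<epsilon> ` carrier (Pr 0) = carrier T"
    by (simp add: postcompose_image image_Hom_def del: image_module_simps(1)) (simp add:
        image_Hom_def)
  have "(\<lambda>x. x \<cdot>[V,P\<^sub>1,P\<^sub>0] f) ` Hom_set C V P\<^sub>1 = {x \<in> Hom_set C V P\<^sub>0. x \<cdot>[V,P\<^sub>0,W] g = \<zero>[V,W]}"
    using exact_P\<^sub>0 by (auto simp: fg)
  then show "\<delta> 0 ` carrier (Pr 1) = module_kernel (Pr 0) T \<epsilon>"
    by (simp add: postcompose_image postcompose_kernel del: image_module_simps)
qed

lemma finite_fg_projective_dim_T: "finite_fg_projective_dim A T"
  unfolding finite_fg_projective_dim_def
proof (intro exI conjI allI impI)
  show "projective_resolution A Pr \<delta> \<epsilon> T" by (rule projective_resolution_T)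
  show "finitely_generated A (Pr i)" for i
    by (rule finitely_generated_Hom_module) (simp_all add: P_obj_summand2)
  show "carrier (Pr i) = {\<zero>\<^bsub>Pr i\<^esub>}" if "i > 1" for i
  proof -
    from that obtain k where "i = Suc (Suc k)" by (metis One_nat_def less_imp_Suc_add add_Suc)
    then show ?thesis by simp
  qed
qed

text \<open>
  By the Yoneda lemma a homomorphism from \<open>Hom(V, P\<^sub>1)\<close> to \<open>T\<close> is composition with \<open>u g\<close> for some
  \<open>u : P\<^sub>1 \<rightarrow> P\<^sub>0\<close>. If \<open>u = f y\<close>, then composition with \<open>y g\<close> extends it to \<open>Hom(V, P\<^sub>0)\<close>. All higher
  terms of the resolution vanish.
\<close>

lemma Ext_T_zero:
  assumes "i > 0"
  shows "Ext_zero A i T T"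
proof -
  from assms obtain k where i: "i = Suc k" using gr0_implies_Suc by blast
  have "Ext_cocycles A Pr \<delta> T (Suc k) = Ext_coboundaries A Pr \<delta> T (Suc k)"
  proof (cases k)
    case (Suc l)
    then show ?thesis
      using Ext_zero_of_zero_term[OF projective_resolution_T left_module_T, of k] by simp
  next
    case 0
    have "\<phi> \<in> Ext_coboundaries A Pr \<delta> T (Suc 0)" if "\<phi> \<in> Ext_cocycles A Pr \<delta> T (Suc 0)" for \<phi>
    proof -
      from that have \<phi>: "\<phi> \<in> module_hom A (Pr (Suc 0)) T" by (simp add: Ext_cocycles_def)
      then obtain u where "u \<in> Hom_set C P\<^sub>1 P\<^sub>0"
        and u: "\<And>x. x \<in> Hom_set C V P\<^sub>1 \<Longrightarrow> \<phi> (enc_P x) = enc_T (x \<cdot>[V,P\<^sub>1,W] (u \<cdot>[P\<^sub>1,P\<^sub>0,W] g))"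
        using Yoneda[OF inj_enc(2,1) P\<^sub>1 objs'(2) objs(1) fg_closed(2)] by (metis P_obj_simps(2))
      then obtain y where [simp]: "y \<in> Hom_set C P\<^sub>0 P\<^sub>0" and uy: "u = f \<cdot>[P\<^sub>1,P\<^sub>0,P\<^sub>0] y"
        using extend by blast
      let ?\<psi> = "postcompose enc_P enc_T P\<^sub>0 P\<^sub>0 (Ident C P\<^sub>0) W (y \<cdot>[P\<^sub>0,P\<^sub>0,W] g)"
      have \<psi>: "?\<psi> \<in> module_hom A (Pr 0) T"
        unfolding P_obj_simps by (rule postcompose_hom[where c = y]) simp_all
      have \<delta>: "\<delta> 0 \<in> module_hom A (Pr (Suc 0)) (Pr 0)"
        using projective_resolution_T by (simp only: projective_resolution_def)
      have P: "left_module A (Pr (Suc 0))" by (rule left_module_image_module) simp_all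
      have "\<phi> = (\<lambda>x\<in>carrier (Pr (Suc 0)). ?\<psi> (\<delta> 0 x))"
        by (rule module_hom_eqI[OF \<phi> module_hom_comp[OF \<delta> \<psi> P]]) (auto simp: u uy)
      then show ?thesis using \<psi> unfolding Ext_coboundaries.simps by (rule image_eqI)
    qed
    then show ?thesis
      using Ext_coboundaries_subset_cocycles[OF projective_resolution_T left_module_T, of "Suc 0"]
      unfolding 0 by blast
  qed
  then show ?thesis
    unfolding Ext_zero_def i using projective_resolution_T by blast
qed

subsection \<open>The coresolution of the regular module\<close>

text \<open>
  The \<open>i\<close>-th term of the coresolution is the image of composition with
  \<open>Q_img i : Q_src i \<rightarrow> Q_obj i\<close>. Taking the image of \<open>q\<close>, and not all of \<open>Hom(V, Q\<^sub>1)\<close>, in degree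
  one makes the last map surjective.
\<close>

definition Q_src :: "nat \<Rightarrow> 'o" where "Q_src i = (if i \<le> 1 then Q\<^sub>0 else zero_object)"
definition Q_obj :: "nat \<Rightarrow> 'o"
  where "Q_obj i = (if i = 0 then Q\<^sub>0 else if i = 1 then Q\<^sub>1 else zero_object)"
definition Q_img :: "nat \<Rightarrow> 'm" where "Q_img i = (if i = 1 then q else Ident C (Q_src i))"
definition Q_mor :: "nat \<Rightarrow> 'm"
  where "Q_mor i = (if i = 0 then q else \<zero>[Q_obj i, zero_object])"

abbreviation Qm :: "nat \<Rightarrow> ('m, nat \<Rightarrow> (nat \<Rightarrow> 'm) set) module"
  where "Qm i \<equiv> image_module enc_Q (Q_src i) (Q_obj i) (Q_img i)"
abbreviation dQ :: "nat \<Rightarrow> (nat \<Rightarrow> (nat \<Rightarrow> 'm) set) \<Rightarrow> nat \<Rightarrow> (nat \<Rightarrow> 'm) set"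
  where "dQ i \<equiv> postcompose enc_Q enc_Q (Q_src i) (Q_obj i) (Q_img i) (Q_obj (Suc i)) (Q_mor i)"
abbreviation \<eta> :: "'m \<Rightarrow> nat \<Rightarrow> (nat \<Rightarrow> 'm) set"
  where "\<eta> \<equiv> postcompose id enc_Q V V (Ident C V) Q\<^sub>0 j"

lemma Q_simps [simp]:
  "Q_src 0 = Q\<^sub>0" "Q_src (Suc 0) = Q\<^sub>0" "Q_src (Suc (Suc i)) = zero_object"
  "Q_obj 0 = Q\<^sub>0" "Q_obj (Suc 0) = Q\<^sub>1" "Q_obj (Suc (Suc i)) = zero_object"
  "Q_img 0 = Ident C Q\<^sub>0" "Q_img (Suc 0) = q" "Q_img (Suc (Suc i)) = Ident C zero_object"
  "Q_mor 0 = q" "Q_mor (Suc i) = \<zero>[Q_obj (Suc i), zero_object]"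
  by (simp_all add: Q_src_def Q_obj_def Q_img_def Q_mor_def)

lemma Q_closed [simp]:
  "Q_src i \<in> Obj C" "Q_obj i \<in> Obj C" "Q_img i \<in> Hom_set C (Q_src i) (Q_obj i)"
  "Q_mor i \<in> Hom_set C (Q_obj i) (Q_obj (Suc i))"
  by (cases i rule: nat_cases_2; simp)+

lemma regular_module_hom: "module_hom A (regular_module A) N = module_hom A (Hom_module id V) N"
  unfolding module_hom_def regular_module_def
  using image_module_simps(3,4)[where e = "id :: 'm \<Rightarrow> 'm" and Z' = V and Z = V and z = "Ident C
      V", simplified]
  by (auto cong: conj_cong ball_cong)

lemma Q_summand: "arrow_summand2 P\<^sub>0 W g (Q_src i) (Q_obj i) (Q_img i)"
proof (cases i rule: nat_cases_2)
  case (3 k)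
  have "Hom_set C zero_object zero_object = {\<zero>[zero_object,zero_object]}"
    using zero_object by (simp add: zero_obj_def)
  then have "Ident C zero_object = \<zero>[zero_object,zero_object]"
    using Ident_closed[of zero_object] by simp
  then have "arrow_summand2 P\<^sub>0 W g zero_object zero_object (Ident C zero_object)"
    unfolding arrow_summand2_def
    by (intro conjI bexI[of _ "\<zero>[zero_object,W]"] bexI[of _ "\<zero>[W,zero_object]"]
      bexI[of _ "\<zero>[zero_object,P\<^sub>0]"] bexI[of _ "\<zero>[P\<^sub>0,zero_object]"]) simp_all
  then show ?thesis by (simp add: 3)
qed (simp_all add: Q\<^sub>0 Q\<^sub>1)

lemma finite_add_coresolution_T: "finite_add_coresolution A T"
  unfolding finite_add_coresolution_def
proof (intro exI conjI allI impI)
  fix i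
  show "in_module_add A T (Qm i)"
    by (rule arrow_summand2_imp_in_module_add) (simp_all add: Q_summand)
  show "dQ i \<in> module_hom A (Qm i) (Qm (Suc i))"
  proof (cases i rule: nat_cases_2)
    case 1
    show ?thesis unfolding 1 Q_simps by (rule postcompose_hom[where c = "Ident C Q\<^sub>0"]) simp_all
  next
    case 2
    show ?thesis unfolding 2 Q_simps by (rule postcompose_hom[where c = "\<zero>[Q\<^sub>0,zero_object]"])
        simp_all
  next
    case (3 k)
    show ?thesis unfolding 3 Q_simps
      by (rule postcompose_hom[where c = "\<zero>[zero_object,zero_object]"]) simp_all
  qed
  have "(\<lambda>x. x \<cdot>[V,Q_obj i,Q_obj (Suc i)] Q_mor i) ` image_Hom (Q_src i) (Q_obj i) (Q_img i)
      = {x \<in> image_Hom (Q_src (Suc i)) (Q_obj (Suc i)) (Q_img (Suc i)).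
          x \<cdot>[V,Q_obj (Suc i),Q_obj (Suc (Suc i))] Q_mor (Suc i) = \<zero>[V,Q_obj (Suc (Suc i))]}"
  proof (cases i rule: nat_cases_2)
    case 1
    then show ?thesis using image_Hom_subset[of Q\<^sub>0 Q\<^sub>1 q] by (auto simp: image_Hom_def)
  next
    case 2
    then show ?thesis using image_Hom_subset[of Q\<^sub>0 Q\<^sub>1 q] image_Hom_zero[of Q\<^sub>0 Q\<^sub>1 q]
      by (auto simp: image_iff)
  qed auto
  then show "dQ i ` carrier (Qm i) = module_kernel (Qm (Suc i)) (Qm (Suc (Suc i))) (dQ (Suc i))"
    by (simp only: postcompose_image postcompose_kernel inj_enc)
next
  show "carrier (Qm i) = {\<zero>\<^bsub>Qm i\<^esub>}" if "i > 1" for i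
    using that by (cases i rule: nat_cases_2) simp_all
  show "\<eta> \<in> module_hom A (regular_module A) (Qm 0)"
    unfolding regular_module_hom Q_simps by (rule postcompose_hom[where c = j]) simp_all
  have \<eta>_app: "\<eta> x = enc_Q (x \<cdot>[V,V,Q\<^sub>0] j)" if "x \<in> Hom_set C V V" for x
    using postcompose_apply[of id x V V "Ident C V" enc_Q Q\<^sub>0 j] that by simp
  show "inj_on \<eta> (carrier A)"
  proof (rule inj_onI)
    fix x y assume xy: "x \<in> carrier A" "y \<in> carrier A" "\<eta> x = \<eta> y"
    then have [simp]: "x \<in> Hom_set C V V" "y \<in> Hom_set C V V" and "x \<cdot>[V,V,Q\<^sub>0] j = y \<cdot>[V,V,Q\<^sub>0] j"
      by (simp_all add: \<eta>_app inj_eq)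
    then have "x \<oplus>[V,V] \<ominus>[V,V] y = \<zero>[V,V]" by (intro exact_V) (simp_all add: Comp_add_left)
    then show "x = y" using Mor_neg_eqI[of V V x "\<ominus>[V,V] y"] by (metis Mor_neg_closed Mor_neg_neg
        V_obj \<open>x \<in> Hom_set C V V\<close> \<open>y \<in> Hom_set C V V\<close>)
  qed
  have "(\<lambda>x. x \<cdot>[V,V,Q\<^sub>0] j) ` Hom_set C V V = {x \<in> Hom_set C V Q\<^sub>0. x \<cdot>[V,Q\<^sub>0,Q\<^sub>1] q = \<zero>[V,Q\<^sub>1]}"
    using exact_Q\<^sub>0 by (auto simp: jq)
  then have "enc_Q ` (\<lambda>x. x \<cdot>[V,V,Q\<^sub>0] j) ` Hom_set C V V = module_kernel (Qm 0) (Qm 1) (dQ 0)"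
    by (simp add: postcompose_kernel del: image_module_simps)
  then show "\<eta> ` carrier A = module_kernel (Qm 0) (Qm 1) (dQ 0)"
    by (simp add: image_image \<eta>_app)
qed

lemma tilting_module_T: "tilting_module A T"
  by (simp add: tilting_module_def left_module_T finite_fg_projective_dim_T Ext_T_zero
      finite_add_coresolution_T)

subsection \<open>The endomorphism ring of the tilting module\<close>

text \<open>
  An endomorphism \<open>b\<close> of \<open>W\<close> acts on \<open>T\<close> by composition, and \<open>lift\<close> says that it preserves \<open>T\<close>.
  Conversely, an endomorphism \<open>\<phi>\<close> of \<open>T\<close> pulled back to \<open>Hom(V, P\<^sub>0)\<close> is composition with \<open>u g\<close> for
  some \<open>u : P\<^sub>0 \<rightarrow> P\<^sub>0\<close>. It vanishes on the kernel \<open>Hom(V, P\<^sub>1)\<close>, so \<open>f u g = 0\<close> and \<open>u g = g b\<close> for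
  some \<open>b\<close>.
\<close>

lemma End_W_iso: "End_ring C W \<simeq> module_End_ring A T"
proof -
  let ?h = "\<lambda>b. postcompose enc_T enc_T P\<^sub>0 W g W b"
  have sub: "x \<in> Hom_set C V W" if "x \<in> image_Hom P\<^sub>0 W g" for x
    using that image_Hom_subset[of P\<^sub>0 W g] by simp
  have h_hom: "?h b \<in> module_hom A T T" if [simp]: "b \<in> Hom_set C W W" for b
  proof -
    obtain c where "c \<in> Hom_set C P\<^sub>0 P\<^sub>0" "g \<cdot>[P\<^sub>0,W,W] b = c \<cdot>[P\<^sub>0,P\<^sub>0,W] g"
      using lift[of "g \<cdot>[P\<^sub>0,W,W] b"] by auto
    then show ?thesis by (intro postcompose_hom[where c = c]) simp_all
  qed
  have stable: "x \<cdot>[V,W,W] b \<in> image_Hom P\<^sub>0 W g" if "x \<in> image_Hom P\<^sub>0 W g" "b \<in> Hom_set C W W"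
      for x b
    using module_hom_closed[OF h_hom[OF that(2)], of "enc_T x"] that by (simp add:
        inj_image_mem_iff)
  have "?h \<in> ring_iso (End_ring C W) (module_End_ring A T)"
  proof (rule ring_iso_memI)
    fix b assume b: "b \<in> carrier (End_ring C W)"
    then show "?h b \<in> carrier (module_End_ring A T)" by (simp add: module_End_ring_def h_hom)
    fix b' assume b': "b' \<in> carrier (End_ring C W)"
    show "?h (b \<otimes>\<^bsub>End_ring C W\<^esub> b') = ?h b \<otimes>\<^bsub>module_End_ring A T\<^esub> ?h b'"
      using b b' by (auto simp: module_End_ring_def fun_eq_iff restrict_def stable sub)
        (auto simp: postcompose_def)
    show "?h (b \<oplus>\<^bsub>End_ring C W\<^esub> b') = ?h b \<oplus>\<^bsub>module_End_ring A T\<^esub> ?h b'"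
      using b b' by (auto simp: module_End_ring_def fun_eq_iff restrict_def stable sub
          Comp_add_right)
        (auto simp: postcompose_def)
  next
    show "?h \<one>\<^bsub>End_ring C W\<^esub> = \<one>\<^bsub>module_End_ring A T\<^esub>"
      by (auto simp: module_End_ring_def fun_eq_iff restrict_def sub) (auto simp: postcompose_def)
    show "bij_betw ?h (carrier (End_ring C W)) (carrier (module_End_ring A T))"
      unfolding bij_betw_def
    proof
      show "inj_on ?h (carrier (End_ring C W))"
      proof (rule inj_onI)
        fix b b' assume "b \<in> carrier (End_ring C W)" "b' \<in> carrier (End_ring C W)" and eq: "?h b =
            ?h b'"
        then have [simp]: "b \<in> Hom_set C W W" "b' \<in> Hom_set C W W" by simp_all
        have "x \<cdot>[V,P\<^sub>0,W] (g \<cdot>[P\<^sub>0,W,W] (b \<oplus>[W,W] \<ominus>[W,W] b')) = \<zero>[V,W]" if [simp]: "x \<in> Hom_set C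
            V P\<^sub>0" for x
        proof -
          have "?h b (enc_T (x \<cdot>[V,P\<^sub>0,W] g)) = ?h b' (enc_T (x \<cdot>[V,P\<^sub>0,W] g))" by (simp only: eq)
          then have "x \<cdot>[V,P\<^sub>0,W] (g \<cdot>[P\<^sub>0,W,W] b) = x \<cdot>[V,P\<^sub>0,W] (g \<cdot>[P\<^sub>0,W,W] b')"
            by (simp add: inj_eq)
          then show ?thesis by (simp add: Comp_add_right)
        qed
        then have "g \<cdot>[P\<^sub>0,W,W] (b \<oplus>[W,W] \<ominus>[W,W] b') = \<zero>[P\<^sub>0,W]"
          by (intro Hom_faithful[OF P\<^sub>0]) simp_all
        then have "b \<oplus>[W,W] \<ominus>[W,W] b' = \<zero>[W,W]" by (intro epi) simp_all
        then show "b = b'" using Mor_neg_eqI[of W W b "\<ominus>[W,W] b'"] by (metis Mor_neg_closed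
            Mor_neg_neg objs(1) \<open>b \<in> Hom_set C W W\<close> \<open>b' \<in> Hom_set C W W\<close>)
      qed
      have "\<phi> \<in> ?h ` Hom_set C W W" if \<phi>: "\<phi> \<in> module_hom A T T" for \<phi>
      proof -
        have \<epsilon>: "\<epsilon> \<in> module_hom A (Pr 0) T"
          using projective_resolution_T by (simp only: projective_resolution_def)
        have P: "left_module A (Pr 0)" by (rule left_module_image_module) simp_all
        obtain u where [simp]: "u \<in> Hom_set C P\<^sub>0 P\<^sub>0"
          and u: "\<And>x. x \<in> Hom_set C V P\<^sub>0 \<Longrightarrow>
            (\<lambda>y\<in>carrier (Pr 0). \<phi> (\<epsilon> y)) (enc_P x) = enc_T (x \<cdot>[V,P\<^sub>0,W] (u \<cdot>[P\<^sub>0,P\<^sub>0,W] g))"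
          using Yoneda[OF inj_enc(2,1) P\<^sub>0 objs'(2) objs(1) fg_closed(2)] module_hom_comp[OF \<epsilon> \<phi> P]
          by (metis P_obj_simps(1))
        then have \<phi>_app: "\<phi> (enc_T (x \<cdot>[V,P\<^sub>0,W] g)) = enc_T (x \<cdot>[V,P\<^sub>0,W] (u \<cdot>[P\<^sub>0,P\<^sub>0,W] g))"
          if "x \<in> Hom_set C V P\<^sub>0" for x
          using u[OF that] that by simp
        have "x \<cdot>[V,P\<^sub>1,W] (f \<cdot>[P\<^sub>1,P\<^sub>0,W] (u \<cdot>[P\<^sub>0,P\<^sub>0,W] g)) = \<zero>[V,W]" if [simp]: "x \<in> Hom_set C
            V P\<^sub>1" for x
        proof -
          have "enc_T (x \<cdot>[V,P\<^sub>1,W] (f \<cdot>[P\<^sub>1,P\<^sub>0,W] (u \<cdot>[P\<^sub>0,P\<^sub>0,W] g))) = \<phi> (enc_T \<zero>[V,W])"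
            using \<phi>_app[of "x \<cdot>[V,P\<^sub>1,P\<^sub>0] f"] by (simp add: fg)
          also have "\<dots> = enc_T \<zero>[V,W]"
            using module_hom_zero[OF \<phi> left_module_T left_module_T] by simp
          finally show ?thesis by (simp add: inj_eq)
        qed
        then have "f \<cdot>[P\<^sub>1,P\<^sub>0,W] (u \<cdot>[P\<^sub>0,P\<^sub>0,W] g) = \<zero>[P\<^sub>1,W]"
          by (intro Hom_faithful[OF P\<^sub>1]) simp_all
        then obtain b where [simp]: "b \<in> Hom_set C W W" and b: "u \<cdot>[P\<^sub>0,P\<^sub>0,W] g = g \<cdot>[P\<^sub>0,W,W] b"
          using cokernel[of "u \<cdot>[P\<^sub>0,P\<^sub>0,W] g"] by auto
        have "\<phi> = ?h b"
          by (rule module_hom_eqI[OF \<phi> h_hom]) (auto simp: \<phi>_app b elim!: image_HomE)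
        then show ?thesis by simp
      qed
      then show "?h ` carrier (End_ring C W) = carrier (module_End_ring A T)"
        by (auto simp: module_End_ring_def h_hom)
    qed
  qed
  then show ?thesis by (auto simp: is_ring_iso_def)
qed

theorem derived_equivalent: "derived_equivalent_via_tilting (End_ring C V) (End_ring C W)"
  unfolding derived_equivalent_via_tilting_def using tilting_module_T End_W_iso by blast

end

section \<open>Retracts and local endomorphism rings\<close>

context linear_category
begin

lemma retractI:
  "\<lbrakk>A \<in> Obj C; B \<in> Obj C; i \<in> Hom_set C A B; p \<in> Hom_set C B A; i \<cdot>[A,B,A] p = Ident C A\<rbrakk>
    \<Longrightarrow> retract A B"
  unfolding retract_def by blast

lemma retractE:
  assumes "retract A B"
  obtains i p where "A \<in> Obj C" "B \<in> Obj C" "i \<in> Hom_set C A B" "p \<in> Hom_set C B A"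
    "i \<cdot>[A,B,A] p = Ident C A"
  using assms unfolding retract_def by blast

lemma retract_refl: "A \<in> Obj C \<Longrightarrow> retract A A"
  by (rule retractI[of _ _ "Ident C A" "Ident C A"]) simp_all

lemma retract_trans:
  assumes "retract A B" "retract B E"
  shows "retract A E"
proof -
  from assms obtain i p k q where [simp]: "A \<in> Obj C" "B \<in> Obj C" "E \<in> Obj C"
    "i \<in> Hom_set C A B" "p \<in> Hom_set C B A" "k \<in> Hom_set C B E" "q \<in> Hom_set C E B"
    and "i \<cdot>[A,B,A] p = Ident C A" "k \<cdot>[B,E,B] q = Ident C B"
    unfolding retract_def by blast
  then show ?thesis
    by (intro retractI[of _ _ "i \<cdot>[A,B,E] k" "q \<cdot>[E,B,A] p"]) (simp_all add: Comp_Ident_subst)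
qed

lemma biproduct_retract:
  assumes "biproduct A B S i p j q"
  shows "retract A S" "retract B S"
  using assms by (auto simp: biproduct_def intro: retractI)

definition invertible :: "'o \<Rightarrow> 'o \<Rightarrow> 'm \<Rightarrow> 'm \<Rightarrow> bool"
  where "invertible A B i p \<longleftrightarrow> A \<in> Obj C \<and> B \<in> Obj C \<and> i \<in> Hom_set C A B \<and> p \<in> Hom_set C B A \<and>
    i \<cdot>[A,B,A] p = Ident C A \<and> p \<cdot>[B,A,B] i = Ident C B"

lemma iso_obj_iff: "\<lbrakk>A \<in> Obj C; B \<in> Obj C\<rbrakk> \<Longrightarrow> iso_obj C A B \<longleftrightarrow> (\<exists>i p. invertible A B i p)"
  by (auto simp: iso_obj_def iso_mor_def invertible_def)

lemma iso_obj_sym: "iso_obj C A B \<Longrightarrow> A \<in> Obj C \<Longrightarrow> B \<in> Obj C \<Longrightarrow> iso_obj C B A"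
  by (auto simp: iso_obj_iff invertible_def)

text \<open>
  The endomorphism ring of \<open>A\<close> is local or zero, in the form in which locality is applied: whenever
  the identity is a sum of two endomorphisms, one of them is invertible.
\<close>

definition local_obj :: "'o \<Rightarrow> bool"
  where "local_obj A \<longleftrightarrow> A \<in> Obj C \<and> (\<forall>a\<in>Hom_set C A A. \<forall>b\<in>Hom_set C A A.
     a \<oplus>[A,A] b = Ident C A \<longrightarrow> (\<exists>c. invertible A A a c) \<or> (\<exists>c. invertible A A b c))"

lemma local_objE:
  assumes "local_obj A" "a \<in> Hom_set C A A" "b \<in> Hom_set C A A" "a \<oplus>[A,A] b = Ident C A"
  obtains c where "invertible A A a c" | c where "invertible A A b c"
  using assms unfolding local_obj_def by blast

lemma local_obj_closed: "local_obj A \<Longrightarrow> A \<in> Obj C"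
  by (simp add: local_obj_def)

lemma local_ring_imp_local_obj:
  assumes "local_ring (End_ring C A)" and [simp]: "A \<in> Obj C"
  shows "local_obj A"
proof -
  have U: "a \<in> Units (End_ring C A) \<longleftrightarrow> (\<exists>c. invertible A A a c)" for a
    by (auto simp: Units_def End_ring_def invertible_def)
  show ?thesis
    unfolding local_obj_def
  proof (intro conjI ballI impI)
    fix a b assume ab: "a \<in> Hom_set C A A" "b \<in> Hom_set C A A" "a \<oplus>[A,A] b = Ident C A"
    have "Ident C A \<in> Units (End_ring C A)"
      unfolding U invertible_def by (intro exI[of _ "Ident C A"]) simp
    then have "a \<in> Units (End_ring C A) \<or> b \<in> Units (End_ring C A)"
      using assms(1) ab unfolding local_ring_def by (metis DiffI End_ring_simps(1,3))
    then show "(\<exists>c. invertible A A a c) \<or> (\<exists>c. invertible A A b c)"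
      by (simp add: U)
  qed simp
qed

lemma local_obj_iso:
  assumes B: "local_obj B" and inv: "invertible A B i p"
  shows "local_obj A"
  unfolding local_obj_def
proof (intro conjI ballI impI)
  from inv have [simp]: "A \<in> Obj C" "B \<in> Obj C" "i \<in> Hom_set C A B" "p \<in> Hom_set C B A"
    and ip [simp]: "i \<cdot>[A,B,A] p = Ident C A" "p \<cdot>[B,A,B] i = Ident C B"
    by (simp_all add: invertible_def)
  note [simp] = ip[THEN Comp_Ident_subst]
  show "A \<in> Obj C" by simp
  fix a b assume [simp]: "a \<in> Hom_set C A A" "b \<in> Hom_set C A A" and ab: "a \<oplus>[A,A] b = Ident C A"
  have transport: "\<exists>c. invertible A A x c"
    if [simp]: "x \<in> Hom_set C A A" and "invertible B B (p \<cdot>[B,A,B] (x \<cdot>[A,A,B] i)) c" for x c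
  proof -
    from that have [simp]: "c \<in> Hom_set C B B" by (simp add: invertible_def)
    from that have c: "p \<cdot>[B,A,B] (x \<cdot>[A,A,B] (i \<cdot>[A,B,B] c)) = Ident C B"
        "c \<cdot>[B,B,B] (p \<cdot>[B,A,B] (x \<cdot>[A,A,B] i)) = Ident C B"
      by (simp_all add: invertible_def)
    have "x \<cdot>[A,A,A] (i \<cdot>[A,B,A] (c \<cdot>[B,B,A] p))
        = i \<cdot>[A,B,A] ((p \<cdot>[B,A,B] (x \<cdot>[A,A,B] (i \<cdot>[A,B,B] c))) \<cdot>[B,B,A] p)" by simp
    also have "\<dots> = Ident C A" unfolding c by simp
    finally have 1: "x \<cdot>[A,A,A] (i \<cdot>[A,B,A] (c \<cdot>[B,B,A] p)) = Ident C A" .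
    have "(i \<cdot>[A,B,A] (c \<cdot>[B,B,A] p)) \<cdot>[A,A,A] x
        = i \<cdot>[A,B,A] ((c \<cdot>[B,B,B] (p \<cdot>[B,A,B] (x \<cdot>[A,A,B] i))) \<cdot>[B,B,A] p)" by simp
    also have "\<dots> = Ident C A" unfolding c by simp
    finally show ?thesis using 1 by (auto simp: invertible_def intro!:
        exI[of _ "i \<cdot>[A,B,A] (c \<cdot>[B,B,A] p)"])
  qed
  have "p \<cdot>[B,A,B] (a \<cdot>[A,A,B] i) \<oplus>[B,B] p \<cdot>[B,A,B] (b \<cdot>[A,A,B] i)
      = p \<cdot>[B,A,B] ((a \<oplus>[A,A] b) \<cdot>[A,A,B] i)"
    by (simp add: Comp_add_left Comp_add_right)
  also have "\<dots> = Ident C B" by (simp add: ab)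
  finally show "(\<exists>c. invertible A A a c) \<or> (\<exists>c. invertible A A b c)"
    using transport by (elim local_objE[OF B, rotated 2]) auto
qed

text \<open>
  An idempotent of a local ring is \<open>0\<close> or \<open>1\<close>, so a nonzero retract of an object with local
  endomorphism ring is isomorphic to it.
\<close>

lemma retract_of_local:
  assumes B: "local_obj B" and [simp]: "A \<in> Obj C" "s \<in> Hom_set C A B" "t \<in> Hom_set C B A"
    and st: "s \<cdot>[A,B,A] t = Ident C A" and A: "Ident C A \<noteq> \<zero>[A,A]"
  shows "t \<cdot>[B,A,B] s = Ident C B"
proof -
  have [simp]: "B \<in> Obj C" using B by (rule local_obj_closed)
  let ?e = "t \<cdot>[B,A,B] s"
  let ?e' = "Ident C B \<oplus>[B,B] \<ominus>[B,B] ?e"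
  have ee: "?e \<cdot>[B,B,B] ?e = ?e" by (simp add: Comp_Ident_subst[OF st])
  have "?e \<oplus>[B,B] ?e' = Ident C B" by simp
  then show ?thesis
  proof (rule local_objE[OF B, rotated 2])
    fix c assume "invertible B B ?e c"
    then have [simp]: "c \<in> Hom_set C B B" and c: "c \<cdot>[B,B,B] ?e = Ident C B" by (simp_all add:
        invertible_def)
    have "?e = (c \<cdot>[B,B,B] ?e) \<cdot>[B,B,B] ?e" unfolding c by simp
    also have "\<dots> = c \<cdot>[B,B,B] (?e \<cdot>[B,B,B] ?e)" by (rule Comp_assoc) simp_all
    finally show ?thesis using c ee by simp
  next
    fix c assume "invertible B B ?e' c"
    then have [simp]: "c \<in> Hom_set C B B" and c: "c \<cdot>[B,B,B] ?e' = Ident C B" by (simp_all add: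
        invertible_def)
    have "?e = (c \<cdot>[B,B,B] ?e') \<cdot>[B,B,B] ?e" unfolding c by simp
    also have "\<dots> = c \<cdot>[B,B,B] (?e' \<cdot>[B,B,B] ?e)" by (rule Comp_assoc) simp_all
    also have "?e' \<cdot>[B,B,B] ?e = \<zero>[B,B]" using ee by (simp add: Comp_add_left del: Comp_assoc)
    finally have e0: "?e = \<zero>[B,B]" by simp
    have "Ident C A = s \<cdot>[A,B,A] (?e \<cdot>[B,B,A] t)" by (simp add: st Comp_Ident_subst[OF st])
    also have "\<dots> = \<zero>[A,A]" unfolding e0 by simp
    finally show ?thesis using A by simp
  qed simp_all
qed

lemma retract_of_local_sym:
  assumes "local_obj B" "retract A B" "Ident C A \<noteq> \<zero>[A,A]"
  shows "retract B A" "iso_obj C A B"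
proof -
  from assms(2) obtain s t where *: "A \<in> Obj C" "B \<in> Obj C" "s \<in> Hom_set C A B" "t \<in> Hom_set C B A"
    "s \<cdot>[A,B,A] t = Ident C A" by (rule retractE)
  have "t \<cdot>[B,A,B] s = Ident C B"
    by (rule retract_of_local[OF assms(1) *(1,3,4,5) assms(3)])
  with * show "retract B A" "iso_obj C A B"
    by (auto intro: retractI simp: iso_obj_iff invertible_def)
qed

lemma retract_of_local_splits:
  assumes "local_obj A" and [simp]: "U \<in> Obj C" "a \<in> Hom_set C A U" "b \<in> Hom_set C U A"
    and inv: "invertible A A (a \<cdot>[A,U,A] b) c"
  shows "a \<cdot>[A,U,A] (b \<cdot>[U,A,A] c) = Ident C A" "(c \<cdot>[A,A,U] a) \<cdot>[A,U,A] b = Ident C A"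
proof -
  have [simp]: "A \<in> Obj C" "c \<in> Hom_set C A A"
    using inv by (simp_all add: invertible_def)
  show "a \<cdot>[A,U,A] (b \<cdot>[U,A,A] c) = Ident C A" "(c \<cdot>[A,A,U] a) \<cdot>[A,U,A] b = Ident C A"
    using inv by (simp_all add: invertible_def)
qed

text \<open>
  The identity of a retract of \<open>A \<oplus> B\<close> is the sum of an endomorphism through \<open>A\<close> and one through
  \<open>B\<close>.
\<close>

lemma local_retract_biproduct:
  assumes Z: "local_obj Z" and b: "biproduct A B S i p j q" and "retract Z S"
  shows "retract Z A \<or> retract Z B"
proof -
  from b have [simp]: "A \<in> Obj C" "B \<in> Obj C" "S \<in> Obj C"
      "i \<in> Hom_set C A S" "p \<in> Hom_set C S A" "j \<in> Hom_set C B S" "q \<in> Hom_set C S B"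
    and sum: "p \<cdot>[S,A,S] i \<oplus>[S,S] q \<cdot>[S,B,S] j = Ident C S"
    by (auto simp: biproduct_def)
  have [simp]: "Z \<in> Obj C" using Z by (rule local_obj_closed)
  from assms(3) obtain s t where [simp]: "s \<in> Hom_set C Z S" "t \<in> Hom_set C S Z"
    and st: "s \<cdot>[Z,S,Z] t = Ident C Z" by (rule retractE)
  have "(s \<cdot>[Z,S,A] p) \<cdot>[Z,A,Z] (i \<cdot>[A,S,Z] t) \<oplus>[Z,Z] (s \<cdot>[Z,S,B] q) \<cdot>[Z,B,Z] (j \<cdot>[B,S,Z] t)
      = s \<cdot>[Z,S,Z] ((p \<cdot>[S,A,S] i \<oplus>[S,S] q \<cdot>[S,B,S] j) \<cdot>[S,S,Z] t)"
    by (simp add: Comp_add_left Comp_add_right)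
  also have "\<dots> = Ident C Z" by (simp add: sum st)
  finally show ?thesis
  proof (rule local_objE[OF Z, rotated 2])
    fix c assume c: "invertible Z Z ((s \<cdot>[Z,S,A] p) \<cdot>[Z,A,Z] (i \<cdot>[A,S,Z] t)) c"
    then have "c \<in> Hom_set C Z Z" by (simp add: invertible_def)
    then have "retract Z A"
      using retract_of_local_splits(1)[OF Z _ _ _ c]
      by (intro retractI[of _ _ "s \<cdot>[Z,S,A] p" "(i \<cdot>[A,S,Z] t) \<cdot>[A,Z,Z] c"]) simp_all
    then show ?thesis ..
  next
    fix c assume c: "invertible Z Z ((s \<cdot>[Z,S,B] q) \<cdot>[Z,B,Z] (j \<cdot>[B,S,Z] t)) c"
    then have "c \<in> Hom_set C Z Z" by (simp add: invertible_def)
    then have "retract Z B"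
      using retract_of_local_splits(1)[OF Z _ _ _ c]
      by (intro retractI[of _ _ "s \<cdot>[Z,S,B] q" "(j \<cdot>[B,S,Z] t) \<cdot>[B,Z,Z] c"]) simp_all
    then show ?thesis ..
  qed simp_all
qed

lemma zero_obj_iff: "zero_obj C Z \<longleftrightarrow> Z \<in> Obj C \<and> Ident C Z = \<zero>[Z,Z]"
proof
  assume "zero_obj C Z"
  then have "Z \<in> Obj C" "Hom_set C Z Z = {\<zero>[Z,Z]}" by (auto simp: zero_obj_def)
  then show "Z \<in> Obj C \<and> Ident C Z = \<zero>[Z,Z]" using Ident_closed[of Z] by simp
next
  assume *: "Z \<in> Obj C \<and> Ident C Z = \<zero>[Z,Z]"
  have "x = \<zero>[Z,U]" if "x \<in> Hom_set C Z U" "U \<in> Obj C" for x U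
    using that * Comp_Ident_left[of Z U x] Comp_zero_left[of Z Z U x] by simp
  moreover have "x = \<zero>[U,Z]" if "x \<in> Hom_set C U Z" "U \<in> Obj C" for x U
    using that * Comp_Ident_right[of U Z x] Comp_zero_right[of U Z Z x] by simp
  ultimately show "zero_obj C Z" using * by (fastforce simp: zero_obj_def)
qed

lemma direct_sum_singleton: "A \<in> Obj C \<Longrightarrow> direct_sum C [A] A"
proof -
  assume [simp]: "A \<in> Obj C"
  interpret H: abelian_group "Mor C A A" by (rule Mor_abelian_group) simp_all
  have [simp]: "{..<Suc 0} = {0}" by auto
  show ?thesis
    unfolding direct_sum_def
    by (intro conjI exI[of _ "\<lambda>_. Ident C A"]) (simp_all add: H.finsum_insert)
qed

end

section \<open>Triangulated categories\<close>

context shift_linear_category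
begin

lemmas [simp] = Sh_closed

lemma Shm_closed [simp]:
  "\<lbrakk>X \<in> Obj C; Y \<in> Obj C; f \<in> Hom_set C X Y\<rbrakk> \<Longrightarrow> Shm C X Y f \<in> Hom_set C (Sh C X) (Sh C Y)"
  using Shm_bij bij_betwE by blast

lemma Shm_eq_iff:
  "\<lbrakk>X \<in> Obj C; Y \<in> Obj C; f \<in> Hom_set C X Y; g \<in> Hom_set C X Y\<rbrakk>
    \<Longrightarrow> Shm C X Y f = Shm C X Y g \<longleftrightarrow> f = g"
  using Shm_bij[of X Y] by (auto simp: bij_betw_def inj_on_eq_iff)

lemma Shm_surj:
  assumes "X \<in> Obj C" "Y \<in> Obj C" "u \<in> Hom_set C (Sh C X) (Sh C Y)"
  obtains f where "f \<in> Hom_set C X Y" "u = Shm C X Y f"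
  using Shm_bij[OF assms(1,2)] assms(3) by (metis bij_betw_imp_surj_on imageE)

lemma Shm_zero [simp]:
  assumes "X \<in> Obj C" "Y \<in> Obj C"
  shows "Shm C X Y \<zero>[X,Y] = \<zero>[Sh C X, Sh C Y]"
  using assms Shm_add[of X Y "\<zero>[X,Y]" "\<zero>[X,Y]"]
  by (intro Mor_self_add_eq[of _ _ "Shm C X Y \<zero>[X,Y]"]) simp_all

lemma Shm_eq_zero_iff:
  "\<lbrakk>X \<in> Obj C; Y \<in> Obj C; f \<in> Hom_set C X Y\<rbrakk>
    \<Longrightarrow> Shm C X Y f = \<zero>[Sh C X, Sh C Y] \<longleftrightarrow> f = \<zero>[X,Y]"
  using Shm_eq_iff[of X Y f "\<zero>[X,Y]"] by simp

lemma zero_obj_Sh: "zero_obj C Z \<Longrightarrow> zero_obj C (Sh C Z)"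
  using Shm_Ident[of Z] by (simp add: zero_obj_iff)

lemma retract_Sh_iff:
  assumes [simp]: "A \<in> Obj C" "B \<in> Obj C"
  shows "retract (Sh C A) (Sh C B) \<longleftrightarrow> retract A B"
proof
  assume "retract A B"
  then obtain i p where "i \<in> Hom_set C A B" "p \<in> Hom_set C B A" "i \<cdot>[A,B,A] p = Ident C A"
    by (rule retractE)
  then show "retract (Sh C A) (Sh C B)"
    by (intro retractI[of _ _ "Shm C A B i" "Shm C B A p"]) (simp_all flip: Shm_Comp add: Shm_Ident)
next
  assume "retract (Sh C A) (Sh C B)"
  then obtain u v where u: "u \<in> Hom_set C (Sh C A) (Sh C B)" and v: "v \<in> Hom_set C (Sh C B) (Sh C
      A)"
    and uv: "u \<cdot>[Sh C A,Sh C B,Sh C A] v = Ident C (Sh C A)"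
    by (rule retractE)
  obtain i p where *: "i \<in> Hom_set C A B" "p \<in> Hom_set C B A" "u = Shm C A B i" "v = Shm C B A p"
    using Shm_surj[OF _ _ u] Shm_surj[OF _ _ v] by (metis assms)
  then have "Shm C A A (i \<cdot>[A,B,A] p) = Shm C A A (Ident C A)"
    using uv by (simp add: Shm_Comp Shm_Ident)
  then show "retract A B" using * by (intro retractI[of _ _ i p]) (simp_all add: Shm_eq_iff)
qed

lemma local_obj_Sh_iff:
  assumes [simp]: "A \<in> Obj C"
  shows "local_obj (Sh C A) \<longleftrightarrow> local_obj A"
proof -
  have inv: "(\<exists>c. invertible (Sh C A) (Sh C A) (Shm C A A a) c) \<longleftrightarrow> (\<exists>c. invertible A A a c)"
    if [simp]: "a \<in> Hom_set C A A" for a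
  proof
    assume "\<exists>c. invertible A A a c"
    then obtain c where "invertible A A a c" ..
    then have "invertible (Sh C A) (Sh C A) (Shm C A A a) (Shm C A A c)"
      by (simp add: invertible_def Shm_Ident flip: Shm_Comp)
    then show "\<exists>c. invertible (Sh C A) (Sh C A) (Shm C A A a) c" ..
  next
    assume "\<exists>c. invertible (Sh C A) (Sh C A) (Shm C A A a) c"
    then obtain c where c: "invertible (Sh C A) (Sh C A) (Shm C A A a) c" ..
    then obtain d where [simp]: "d \<in> Hom_set C A A" and "c = Shm C A A d"
      by (metis Shm_surj assms invertible_def)
    with c have "Shm C A A (a \<cdot>[A,A,A] d) = Shm C A A (Ident C A)" "Shm C A A (d \<cdot>[A,A,A] a) = Shm
        C A A (Ident C A)"
      by (simp_all add: invertible_def Shm_Ident Shm_Comp)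
    then have "invertible A A a d" by (simp add: invertible_def Shm_eq_iff)
    then show "\<exists>c. invertible A A a c" ..
  qed
  have img: "Hom_set C (Sh C A) (Sh C A) = Shm C A A ` Hom_set C A A"
    using Shm_bij[of A A] by (simp add: bij_betw_def)
  have "Shm C A A a \<oplus>[Sh C A,Sh C A] Shm C A A b = Ident C (Sh C A) \<longleftrightarrow> a \<oplus>[A,A] b = Ident C A"
    if "a \<in> Hom_set C A A" "b \<in> Hom_set C A A" for a b
    using that Shm_eq_iff[of A A "a \<oplus>[A,A] b" "Ident C A"] by (simp add: Shm_add Shm_Ident)
  then show ?thesis by (simp add: local_obj_def img inv)
qed

end

context triangulated_category
begin

lemma Tri_closedD:
  assumes "(X, Y, Z, f, g, h) \<in> Tri C"
  shows "X \<in> Obj C" "Y \<in> Obj C" "Z \<in> Obj C"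
    "f \<in> Hom_set C X Y" "g \<in> Hom_set C Y Z" "h \<in> Hom_set C Z (Sh C X)"
  using Tri_closed[OF assms] by auto

lemma Tri_rotate:
  assumes "(X, Y, Z, f, g, h) \<in> Tri C"
  shows "(Y, Z, Sh C X, g, h, \<ominus>[Sh C X, Sh C Y] Shm C X Y f) \<in> Tri C"
  using TR2[of X Y Z f g h] Tri_closedD[OF assms] assms by simp

lemma Tri_comp_zero:
  assumes t: "(X, Y, Z, f, g, h) \<in> Tri C"
  shows "f \<cdot>[X,Y,Z] g = \<zero>[X,Z]"
proof -
  note [simp] = Tri_closedD[OF t]
  obtain O' where O': "zero_obj C O'" using ex_zero_obj by blast
  then have [simp]: "O' \<in> Obj C" by (simp add: zero_obj_def)
  have "(X, X, O', Ident C X, \<zero>[X,O'], \<zero>[O',Sh C X]) \<in> Tri C"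
    by (rule TR1_Ident) (simp_all add: O')
  from TR3[OF this t, of "Ident C X" f] obtain c where "c \<in> Hom_set C O' Z"
    and "\<zero>[X,O'] \<cdot>[X,O',Z] c = f \<cdot>[X,Y,Z] g"
    by auto
  then show ?thesis by simp
qed

text \<open>
  The pair of \<open>s\<close> and a zero morphism extends to a morphism of triangles from the rotated identity
  triangle of \<open>U\<close> to the rotation of the given one. Its third component \<open>U[1] \<rightarrow> X[1]\<close> is the shift
  of the required factor, as the shift functor is full and faithful.
\<close>

lemma factor_through_first:
  assumes t: "(X, Y, Z, f, g, h) \<in> Tri C" and [simp]: "U \<in> Obj C" "s \<in> Hom_set C U Y"
    and sg: "s \<cdot>[U,Y,Z] g = \<zero>[U,Z]"
  obtains s' where "s' \<in> Hom_set C U X" "s = s' \<cdot>[U,X,Y] f"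
proof -
  note [simp] = Tri_closedD[OF t]
  obtain O' where O': "zero_obj C O'" using ex_zero_obj by blast
  then have [simp]: "O' \<in> Obj C" by (simp add: zero_obj_def)
  have "(U, U, O', Ident C U, \<zero>[U,O'], \<zero>[O',Sh C U]) \<in> Tri C"
    by (rule TR1_Ident) (simp_all add: O')
  note U = Tri_rotate[OF this]
  from TR3[OF U Tri_rotate[OF t], of s "\<zero>[O',Z]"]
  obtain c where c: "c \<in> Hom_set C (Sh C U) (Sh C X)"
    and eq: "(\<ominus>[Sh C U, Sh C U] Shm C U U (Ident C U)) \<cdot>[Sh C U, Sh C U, Sh C Y] Shm C U Y s
      = c \<cdot>[Sh C U, Sh C X, Sh C Y] (\<ominus>[Sh C X, Sh C Y] Shm C X Y f)"
    by (auto simp: sg)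
  obtain s' where [simp]: "s' \<in> Hom_set C U X" and s': "c = Shm C U X s'"
    using Shm_surj[OF _ _ c] by auto
  have "\<ominus>[Sh C U, Sh C Y] Shm C U Y s = \<ominus>[Sh C U, Sh C Y] Shm C U Y (s' \<cdot>[U,X,Y] f)"
    using eq by (simp add: s' Shm_Ident Shm_Comp)
  then have "\<ominus>[Sh C U, Sh C Y] (\<ominus>[Sh C U, Sh C Y] Shm C U Y s)
      = \<ominus>[Sh C U, Sh C Y] (\<ominus>[Sh C U, Sh C Y] Shm C U Y (s' \<cdot>[U,X,Y] f))" by simp
  then have "s = s' \<cdot>[U,X,Y] f" by (simp add: Shm_eq_iff)
  with \<open>s' \<in> Hom_set C U X\<close> show thesis by (rule that)
qed

lemma factor_through_second:
  assumes t: "(X, Y, Z, f, g, h) \<in> Tri C" and [simp]: "U \<in> Obj C" "s \<in> Hom_set C U Z"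
    and sh: "s \<cdot>[U,Z,Sh C X] h = \<zero>[U,Sh C X]"
  obtains s' where "s' \<in> Hom_set C U Y" "s = s' \<cdot>[U,Y,Z] g"
  by (rule factor_through_first[OF Tri_rotate[OF t] assms(2,3) sh]) (rule that)

lemma factor_through_third:
  assumes t: "(X, Y, Z, f, g, h) \<in> Tri C" and [simp]: "U \<in> Obj C" "s \<in> Hom_set C U (Sh C X)"
    and sf: "s \<cdot>[U,Sh C X,Sh C Y] Shm C X Y f = \<zero>[U,Sh C Y]"
  obtains s' where "s' \<in> Hom_set C U Z" "s = s' \<cdot>[U,Z,Sh C X] h"
  using factor_through_second[OF Tri_rotate[OF t], of U s] sf Tri_closedD[OF t] by auto

text \<open>
  Dually, the pair of a zero morphism and \<open>s\<close> extends to a morphism from the given triangle to the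
  triangle \<open>0 \<rightarrow> U \<rightarrow> U \<rightarrow> 0[1]\<close>.
\<close>

lemma extend_along_second:
  assumes t: "(X, Y, Z, f, g, h) \<in> Tri C" and [simp]: "U \<in> Obj C" "s \<in> Hom_set C Y U"
    and fs: "f \<cdot>[X,Y,U] s = \<zero>[X,U]"
  obtains s' where "s' \<in> Hom_set C Z U" "s = g \<cdot>[Y,Z,U] s'"
proof -
  note [simp] = Tri_closedD[OF t]
  obtain O' where O': "zero_obj C O'" using ex_zero_obj by blast
  then have [simp]: "O' \<in> Obj C" by (simp add: zero_obj_def)
  have "(U, U, Sh C O', Ident C U, \<zero>[U,Sh C O'], \<zero>[Sh C O',Sh C U]) \<in> Tri C"
    by (rule TR1_Ident) (simp_all add: zero_obj_Sh O')
  then have "(O', U, U, \<zero>[O',U], Ident C U, \<zero>[U,Sh C O']) \<in> Tri C"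
    using TR2[of O' U U "\<zero>[O',U]" "Ident C U" "\<zero>[U,Sh C O']"] by simp
  from TR3[OF t this, of "\<zero>[X,O']" s] obtain c where "c \<in> Hom_set C Z U"
    "g \<cdot>[Y,Z,U] c = s \<cdot>[Y,U,U] Ident C U"
    by (auto simp: fs)
  then show thesis by (intro that[of c]) simp_all
qed

lemma extend_along_third:
  assumes t: "(X, Y, Z, f, g, h) \<in> Tri C" and [simp]: "U \<in> Obj C" "s \<in> Hom_set C Z U"
    and gs: "g \<cdot>[Y,Z,U] s = \<zero>[Y,U]"
  obtains s' where "s' \<in> Hom_set C (Sh C X) U" "s = h \<cdot>[Z,Sh C X,U] s'"
  by (rule extend_along_second[OF Tri_rotate[OF t] assms(2,3) gs]) (rule that)

lemma extend_along_shift: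
  assumes t: "(X, Y, Z, f, g, h) \<in> Tri C" and [simp]: "U \<in> Obj C" "s \<in> Hom_set C (Sh C X) U"
    and hs: "h \<cdot>[Z,Sh C X,U] s = \<zero>[Z,U]"
  obtains s' where "s' \<in> Hom_set C (Sh C Y) U" "s = Shm C X Y f \<cdot>[Sh C X,Sh C Y,U] s'"
proof -
  note [simp] = Tri_closedD[OF t]
  obtain s' where "s' \<in> Hom_set C (Sh C Y) U"
    "s = (\<ominus>[Sh C X, Sh C Y] Shm C X Y f) \<cdot>[Sh C X,Sh C Y,U] s'"
    using extend_along_second[OF Tri_rotate[OF Tri_rotate[OF t]] _ _ hs] by auto
  then show thesis by (intro that[of "\<ominus>[Sh C Y,U] s'"]) simp_all
qed

lemma Tri_comp_shift_zero:
  assumes t: "(X, Y, Z, f, g, h) \<in> Tri C"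
  shows "h \<cdot>[Z,Sh C X,Sh C Y] Shm C X Y f = \<zero>[Z,Sh C Y]"
proof -
  note [simp] = Tri_closedD[OF t]
  have "\<ominus>[Z,Sh C Y] (\<ominus>[Z,Sh C Y] (h \<cdot>[Z,Sh C X,Sh C Y] Shm C X Y f)) = \<ominus>[Z,Sh C Y] \<zero>[Z,Sh C Y]"
    using Tri_comp_zero[OF Tri_rotate[OF Tri_rotate[OF t]]] by simp
  then show ?thesis by simp
qed

text \<open>
  In the triangle on a split monomorphism the third morphism vanishes, so the second one has a
  section. Corrected by the given retraction, this section is the inclusion of the complement.
\<close>

lemma retract_complement:
  assumes "retract A B"
  obtains B' where "direct_sum C [A, B'] B"
proof -
  from assms obtain i p where [simp]: "A \<in> Obj C" "B \<in> Obj C" "i \<in> Hom_set C A B" "p \<in> Hom_set C B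
      A"
    and ip: "i \<cdot>[A,B,A] p = Ident C A" by (rule retractE)
  obtain Z g h where t: "(A, B, Z, i, g, h) \<in> Tri C" using TR1_complete[of A B i] by auto
  note [simp] = Tri_closedD[OF t]
  have ig: "i \<cdot>[A,B,Z] g = \<zero>[A,Z]" by (rule Tri_comp_zero[OF t])
  have "h = h \<cdot>[Z,Sh C A,Sh C A] Shm C A A (i \<cdot>[A,B,A] p)" by (simp add: ip Shm_Ident)
  also have "\<dots> = \<zero>[Z,Sh C A]"
    using Comp_zero_subst[OF Tri_comp_shift_zero[OF t], of "Sh C A" "Shm C B A p"] by (simp add:
        Shm_Comp)
  finally have h: "h = \<zero>[Z,Sh C A]" .
  obtain s where [simp]: "s \<in> Hom_set C Z B" and sg: "Ident C Z = s \<cdot>[Z,B,Z] g"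
    using factor_through_second[OF t, of Z "Ident C Z"] by (auto simp: h)
  define k where "k = s \<oplus>[Z,B] \<ominus>[Z,B] (s \<cdot>[Z,B,B] (p \<cdot>[B,A,B] i))"
  have [simp]: "k \<in> Hom_set C Z B" by (simp add: k_def)
  have kp: "k \<cdot>[Z,B,A] p = \<zero>[Z,A]" by (simp add: k_def Comp_add_left ip)
  have kg: "k \<cdot>[Z,B,Z] g = Ident C Z" by (simp add: k_def Comp_add_left ig flip: sg)
  let ?e = "p \<cdot>[B,A,B] i \<oplus>[B,B] g \<cdot>[B,Z,B] k"
  define u where "u = Ident C B \<oplus>[B,B] \<ominus>[B,B] ?e"
  have [simp]: "u \<in> Hom_set C B B" by (simp add: u_def)
  have "i \<cdot>[A,B,B] u = \<zero>[A,B]"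
    by (simp add: u_def Comp_add_right Comp_Ident_subst[OF ip] Comp_zero_subst[OF ig])
  then obtain v where [simp]: "v \<in> Hom_set C Z B" and v: "u = g \<cdot>[B,Z,B] v"
    using extend_along_second[OF t, of B u] by auto
  have "k \<cdot>[Z,B,B] u = \<zero>[Z,B]"
    by (simp add: u_def Comp_add_right Comp_Ident_subst[OF kg] Comp_zero_subst[OF kp])
  then have "v = \<zero>[Z,B]" by (simp add: v Comp_Ident_subst[OF kg])
  then have "u = \<zero>[B,B]" by (simp add: v)
  then have "\<ominus>[B,B] ?e = \<ominus>[B,B] Ident C B"
    unfolding u_def by (intro Mor_neg_eqI) simp_all
  then have "\<ominus>[B,B] (\<ominus>[B,B] ?e) = \<ominus>[B,B] (\<ominus>[B,B] Ident C B)" by simp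
  then have "biproduct A Z B i p k g"
    by (simp add: biproduct_def ip ig kp kg)
  then show thesis using that direct_sum_2_iff by blast
qed

lemma retract_imp_in_add:
  assumes "retract Z N"
  shows "in_add C N Z"
proof -
  have "direct_sum C (replicate 1 N) N"
    using assms direct_sum_singleton by (simp add: retract_def)
  then show ?thesis
    using retract_complement[OF assms] unfolding in_add_def by metis
qed

text \<open>
  In a Krull-Schmidt category an indecomposable object is isomorphic to any of its nonzero direct
  summands, in particular to one with local endomorphism ring.
\<close>

lemma indecomposable_local:
  assumes KS: "Krull_Schmidt C" and S: "indecomposable C S"
  shows "local_obj S"
proof -
  have [simp]: "S \<in> Obj C" and nz: "\<not> zero_obj C S" using S by (auto simp: indecomposable_def)
  from KS obtain Xs where Xs: "direct_sum C Xs S" and loc: "\<And>X. X \<in> set Xs \<Longrightarrow> local_ring (End_ring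
      C X)"
    unfolding Krull_Schmidt_def using \<open>S \<in> Obj C\<close> by blast
  have "Xs \<noteq> []"
  proof
    assume "Xs = []"
    then have "Ident C S = \<zero>[S,S]"
      using Xs by (auto simp: direct_sum_def abelian_monoid.finsum_empty[OF Mor_abelian_monoid])
    then show False using nz by (simp add: zero_obj_iff)
  qed
  then obtain X Ys where XYs: "Xs = X # Ys" by (cases Xs) auto
  then have X [simp]: "X \<in> Obj C" using Xs by (auto simp: direct_sum_def)
  from Xs obtain \<iota> \<pi> where cl: "\<forall>k<length Xs. \<iota> k \<in> Hom_set C (Xs ! k) S \<and> \<pi> k \<in> Hom_set C S (Xs !
      k)"
    and orth: "\<forall>k<length Xs. \<forall>l<length Xs. Comp C (Xs ! k) S (Xs ! l) (\<iota> k) (\<pi> l)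
            = (if k = l then Ident C (Xs ! k) else \<zero>\<^bsub>Mor C (Xs ! k) (Xs ! l)\<^esub>)"
    unfolding direct_sum_def by blast
  have "\<iota> 0 \<in> Hom_set C X S" "\<pi> 0 \<in> Hom_set C S X" "\<iota> 0 \<cdot>[X,S,X] \<pi> 0 = Ident C X"
    using cl[rule_format, of 0] orth[rule_format, of 0 0] by (simp_all add: XYs)
  then have "retract X S" by (intro retractI) simp_all
  then obtain S' where S': "direct_sum C [X, S'] S" by (rule retract_complement)
  have lX: "local_ring (End_ring C X)" by (rule loc) (simp add: XYs)
  then have "\<not> zero_obj C X" by (simp add: local_ring_def zero_obj_iff End_ring_def)
  then have S'_zero: "zero_obj C S'" using S S' by (auto simp: indecomposable_def)
  then have z: "S' \<in> Obj C" by (simp add: zero_obj_iff)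
  from S' obtain i p j q where b: "biproduct X S' S i p j q" by (auto simp: direct_sum_2_iff)
  then have [simp]: "i \<in> Hom_set C X S" "p \<in> Hom_set C S X" "j \<in> Hom_set C S' S" "q \<in> Hom_set C S
      S'"
    by (simp_all add: biproduct_def)
  have "j \<in> {\<zero>[S',S]}" using S'_zero \<open>j \<in> _\<close> \<open>S \<in> Obj C\<close> unfolding zero_obj_def by blast
  then have "j = \<zero>[S',S]" by simp
  then have "invertible S X p i" using b z by (simp add: biproduct_def invertible_def)
  then show ?thesis
    using local_obj_iso local_ring_imp_local_obj[OF lX] by simp
qed

end

section \<open>Auslander-Reiten triangles\<close>

locale AR_triangulated = triangulated_category R C
  for R :: "('r, 's) ring_scheme" (structure) and C :: "('o, 'm, 'r, 'z) tri_cat_scheme" +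
  fixes X M Y :: 'o and f g w :: 'm
  assumes KS: "Krull_Schmidt C" and AR: "AR_triangle C X M Y f g w"
begin

lemma tri: "(X, M, Y, f, g, w) \<in> Tri C"
  using AR by (simp add: AR_triangle_def)

lemmas tri_closed [simp] = Tri_closedD[OF tri]

lemma local_X: "local_obj X" and local_Y: "local_obj Y"
  using AR indecomposable_local[OF KS] by (simp_all add: AR_triangle_def)

lemma local_ShX: "local_obj (Sh C X)"
  using local_X by (simp add: local_obj_Sh_iff)

lemma nonzero_X: "Ident C X \<noteq> \<zero>[X,X]" and nonzero_Y: "Ident C Y \<noteq> \<zero>[Y,Y]"
  using AR by (simp_all add: AR_triangle_def indecomposable_def zero_obj_iff)

lemma nonzero_w: "w \<noteq> \<zero>[Y,Sh C X]"
  using AR by (simp add: AR_triangle_def)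

lemma right_almost_split_zero:
  assumes "U \<in> Obj C" "t \<in> Hom_set C U Y" "\<And>s. s \<in> Hom_set C Y U \<Longrightarrow> s \<cdot>[Y,U,Y] t \<noteq> Ident C Y"
  shows "t \<cdot>[U,Y,Sh C X] w = \<zero>[U,Sh C X]"
  using AR assms by (auto simp: AR_triangle_def split_epi_def)

lemma right_almost_split:
  assumes "U \<in> Obj C" "t \<in> Hom_set C U Y" "\<And>s. s \<in> Hom_set C Y U \<Longrightarrow> s \<cdot>[Y,U,Y] t \<noteq> Ident C Y"
  obtains t' where "t' \<in> Hom_set C U M" "t = t' \<cdot>[U,M,Y] g"
  using factor_through_second[OF tri assms(1,2) right_almost_split_zero[OF assms]] by blast

lemma g_not_split_epi: "s \<in> Hom_set C Y M \<Longrightarrow> s \<cdot>[Y,M,Y] g \<noteq> Ident C Y"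
proof
  assume [simp]: "s \<in> Hom_set C Y M" and sg: "s \<cdot>[Y,M,Y] g = Ident C Y"
  have gw: "g \<cdot>[M,Y,Sh C X] w = \<zero>[M,Sh C X]" using Tri_comp_zero[OF Tri_rotate[OF tri]] .
  have "w = s \<cdot>[Y,M,Sh C X] (g \<cdot>[M,Y,Sh C X] w)" by (simp add: Comp_Ident_subst[OF sg])
  then show False using nonzero_w by (simp add: gw)
qed

lemma f_not_split_mono: "s \<in> Hom_set C M X \<Longrightarrow> f \<cdot>[X,M,X] s \<noteq> Ident C X"
proof
  assume [simp]: "s \<in> Hom_set C M X" and fs: "f \<cdot>[X,M,X] s = Ident C X"
  have "w = w \<cdot>[Y,Sh C X,Sh C X] Shm C X X (f \<cdot>[X,M,X] s)" by (simp add: fs Shm_Ident)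
  also have "\<dots> = \<zero>[Y,Sh C X]"
    by (simp add: Shm_Comp Comp_zero_subst[OF Tri_comp_shift_zero[OF tri]])
  finally show False using nonzero_w by simp
qed

text \<open>
  The condition on an Auslander-Reiten triangle is self-dual. If \<open>w z\<close> were nonzero, the triangle on
  it would contain a morphism to \<open>Y\<close> that is not a split epimorphism and hence is killed by \<open>w\<close>. So
  \<open>w\<close> would factor as \<open>w z z'\<close>, and as \<open>z z'\<close> is not invertible, \<open>1 - z z'\<close> would be, which forces
  \<open>w = 0\<close>.
\<close>

lemma left_almost_split_zero:
  assumes [simp]: "Z \<in> Obj C" "z \<in> Hom_set C (Sh C X) Z"
    and ns: "\<And>s. s \<in> Hom_set C Z (Sh C X) \<Longrightarrow> z \<cdot>[Sh C X,Z,Sh C X] s \<noteq> Ident C (Sh C X)"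
  shows "w \<cdot>[Y,Sh C X,Z] z = \<zero>[Y,Z]"
proof (rule ccontr)
  let ?v = "w \<cdot>[Y,Sh C X,Z] z"
  assume nz: "?v \<noteq> \<zero>[Y,Z]"
  obtain E' j k where t: "(Y, Z, E', ?v, j, k) \<in> Tri C"
    using TR1_complete[of Y Z ?v] by auto
  note [simp] = Tri_closedD[OF t]
  obtain E where [simp]: "E \<in> Obj C" and "iso_obj C (Sh C E) E'" using Sh_ess_surj[of E'] by auto
  then obtain c d where cd: "invertible (Sh C E) E' c d" by (auto simp: iso_obj_iff)
  then have [simp]: "c \<in> Hom_set C (Sh C E) E'" "d \<in> Hom_set C E' (Sh C E)"
    and dc: "d \<cdot>[E',Sh C E,E'] c = Ident C E'" by (simp_all add: invertible_def)
  obtain b where [simp]: "b \<in> Hom_set C E Y" and b: "c \<cdot>[Sh C E,E',Sh C Y] k = Shm C E Y b"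
    using Shm_surj[of E Y "c \<cdot>[Sh C E,E',Sh C Y] k"] by auto
  have kv: "k \<cdot>[E',Sh C Y,Sh C Z] Shm C Y Z ?v = \<zero>[E',Sh C Z]" by (rule Tri_comp_shift_zero[OF t])
  have "b \<cdot>[E,Y,Sh C X] w = \<zero>[E,Sh C X]"
  proof (rule right_almost_split_zero)
    fix s assume [simp]: "s \<in> Hom_set C Y E"
    show "s \<cdot>[Y,E,Y] b \<noteq> Ident C Y"
    proof
      assume sb: "s \<cdot>[Y,E,Y] b = Ident C Y"
      have "Shm C Y Z ?v = Shm C Y Y (s \<cdot>[Y,E,Y] b) \<cdot>[Sh C Y,Sh C Y,Sh C Z] Shm C Y Z ?v"
        by (simp add: sb Shm_Ident)
      also have "\<dots> = (Shm C Y E s \<cdot>[Sh C Y,Sh C E,Sh C Y] (c \<cdot>[Sh C E,E',Sh C Y] k))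
          \<cdot>[Sh C Y,Sh C Y,Sh C Z] Shm C Y Z ?v"
        by (simp only: Shm_Comp b tri_closed \<open>s \<in> _\<close> \<open>b \<in> _\<close> \<open>E \<in> _\<close>)
      also have "\<dots> = \<zero>[Sh C Y, Sh C Z]" by (simp add: kv)
      finally show False using nz by (simp add: Shm_eq_zero_iff)
    qed
  qed simp_all
  then have bw: "Shm C E Y b \<cdot>[Sh C E,Sh C Y,Sh C (Sh C X)] Shm C Y (Sh C X) w =
      \<zero>[Sh C E,Sh C (Sh C X)]"
    by (simp flip: Shm_Comp)
  have "k \<cdot>[E',Sh C Y,Sh C (Sh C X)] Shm C Y (Sh C X) w
      = d \<cdot>[E',Sh C E,Sh C (Sh C X)] ((c \<cdot>[Sh C E,E',Sh C Y] k) \<cdot>[Sh C E,Sh C Y,Sh C (Sh C X)] Shm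
          C Y (Sh C X) w)"
    by (simp add: Comp_Ident_subst[OF dc])
  also have "\<dots> = \<zero>[E',Sh C (Sh C X)]" by (simp only: b bw) simp
  finally have "k \<cdot>[E',Sh C Y,Sh C (Sh C X)] Shm C Y (Sh C X) w = \<zero>[E',Sh C (Sh C X)]" .
  then obtain y where y: "y \<in> Hom_set C (Sh C Z) (Sh C (Sh C X))"
    and "Shm C Y (Sh C X) w = Shm C Y Z ?v \<cdot>[Sh C Y,Sh C Z,Sh C (Sh C X)] y"
    using extend_along_shift[OF t, of "Sh C (Sh C X)" "Shm C Y (Sh C X) w"] by auto
  moreover obtain z' where [simp]: "z' \<in> Hom_set C Z (Sh C X)" and "y = Shm C Z (Sh C X) z'"
    using Shm_surj[OF _ _ y] by auto
  ultimately have "Shm C Y (Sh C X) w = Shm C Y (Sh C X) (?v \<cdot>[Y,Z,Sh C X] z')"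
    by (simp add: Shm_Comp)
  then have w: "w = w \<cdot>[Y,Sh C X,Sh C X] (z \<cdot>[Sh C X,Z,Sh C X] z')" by (simp add: Shm_eq_iff)
  let ?a = "z \<cdot>[Sh C X,Z,Sh C X] z'"
  let ?b = "Ident C (Sh C X) \<oplus>[Sh C X,Sh C X] \<ominus>[Sh C X,Sh C X] ?a"
  have "?a \<oplus>[Sh C X,Sh C X] ?b = Ident C (Sh C X)" by simp
  then show False
  proof (rule local_objE[OF local_ShX, rotated 2])
    fix e assume e: "invertible (Sh C X) (Sh C X) ?a e"
    then have [simp]: "e \<in> Hom_set C (Sh C X) (Sh C X)" by (simp add: invertible_def)
    show False
      using ns[of "z' \<cdot>[Z,Sh C X,Sh C X] e"] retract_of_local_splits(1)[OF local_ShX _ _ _ e] by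
          simp
  next
    fix e assume e: "invertible (Sh C X) (Sh C X) ?b e"
    then have [simp]: "e \<in> Hom_set C (Sh C X) (Sh C X)"
      and be: "?b \<cdot>[Sh C X,Sh C X,Sh C X] e = Ident C (Sh C X)" by (simp_all add: invertible_def)
    have "w \<cdot>[Y,Sh C X,Sh C X] ?b = \<zero>[Y,Sh C X]" using w by (simp add: Comp_add_right)
    then have "w \<cdot>[Y,Sh C X,Sh C X] (?b \<cdot>[Sh C X,Sh C X,Sh C X] e) = \<zero>[Y,Sh C X]"
      by (rule Comp_zero_subst) simp_all
    then show False using nonzero_w by (simp only: be) simp
  qed simp_all
qed

lemma left_almost_split:
  assumes [simp]: "Z \<in> Obj C" "z \<in> Hom_set C X Z"
    and ns: "\<And>s. s \<in> Hom_set C Z X \<Longrightarrow> z \<cdot>[X,Z,X] s \<noteq> Ident C X"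
  obtains z' where "z' \<in> Hom_set C M Z" "z = f \<cdot>[X,M,Z] z'"
proof -
  have "w \<cdot>[Y,Sh C X,Sh C Z] Shm C X Z z = \<zero>[Y,Sh C Z]"
  proof (rule left_almost_split_zero)
    fix s assume "s \<in> Hom_set C (Sh C Z) (Sh C X)"
    then obtain s' where [simp]: "s' \<in> Hom_set C Z X" and s: "s = Shm C Z X s'"
      using Shm_surj[of Z X s] by auto
    then show "Shm C X Z z \<cdot>[Sh C X,Sh C Z,Sh C X] s \<noteq> Ident C (Sh C X)"
      using ns[of s'] Shm_eq_iff[of X X "z \<cdot>[X,Z,X] s'" "Ident C X"] by (simp add: Shm_Comp
          Shm_Ident)
  qed simp_all
  then obtain y where y: "y \<in> Hom_set C (Sh C M) (Sh C Z)"
    and "Shm C X Z z = Shm C X M f \<cdot>[Sh C X,Sh C M,Sh C Z] y"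
    using extend_along_shift[OF tri, of "Sh C Z" "Shm C X Z z"] by auto
  moreover obtain z' where [simp]: "z' \<in> Hom_set C M Z" and "y = Shm C M Z z'"
    using Shm_surj[OF _ _ y] by auto
  ultimately have "Shm C X Z z = Shm C X Z (f \<cdot>[X,M,Z] z')" by (simp add: Shm_Comp)
  then show thesis using that[of z'] by (simp add: Shm_eq_iff)
qed

end

section \<open>Morita equivalence\<close>

context additive_linear_category
begin

text \<open>
  The progenerator \<open>Hom(V, W)\<close> is the degenerate case of a presentation: the relations \<open>P\<^sub>1\<close> and the
  last term \<open>Q\<^sub>1\<close> are zero, while \<open>P\<^sub>0 = W\<close> and \<open>Q\<^sub>0 = V\<close> with identity morphisms.
\<close>

theorem Morita_tilting:
  assumes VW: "summand2 V W" and WV: "summand2 W V"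
  shows "derived_equivalent_via_tilting (End_ring C V) (End_ring C W)"
proof -
  from VW have [simp]: "V \<in> Obj C" "W \<in> Obj C" by (auto simp: summand2_def)
  obtain O' where O': "zero_obj C O'" using ex_zero_obj by blast
  then have [simp]: "O' \<in> Obj C" by (simp add: zero_obj_def)
  have O'_eq: "x = \<zero>[O',U]" if "x \<in> Hom_set C O' U" "U \<in> Obj C" for x U
    using that O' by (auto simp: zero_obj_def)
  have V_O': "x = \<zero>[V,O']" if "x \<in> Hom_set C V O'" for x
    using that O' by (auto simp: zero_obj_def)
  from WV obtain i p j q where
      [simp]: "i \<in> Hom_set C V W" "p \<in> Hom_set C W V" "j \<in> Hom_set C V W" "q \<in> Hom_set C W V"
    and sum: "i \<cdot>[V,W,V] p \<oplus>[V,V] j \<cdot>[V,W,V] q = Ident C V"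
    unfolding summand2_def by blast
  interpret tilting_presentation R C V O' W W V O' "\<zero>[O',W]" "Ident C W" "Ident C V" "\<zero>[V,O']"
  proof
    show "summand2 V O'" using zero_obj_summand2[OF O'] by simp
    show "summand2 V W" by (rule VW)
    show "arrow_summand2 W W (Ident C W) V V (Ident C V)"
      by (rule arrow_summand2I[where a = i and a' = i and b = p and b' = p and c = j and c' = j
          and d = q and d' = q])
        (simp_all add: sum)
    show "arrow_summand2 W W (Ident C W) V O' \<zero>[V,O']"
      by (rule arrow_summand2I[where a = "\<zero>[O',W]" and a' = "\<zero>[V,W]" and b = "\<zero>[W,O']" and b' =
          "\<zero>[W,V]"
            and c = "\<zero>[O',W]" and c' = "\<zero>[V,W]" and d = "\<zero>[W,O']" and d' = "\<zero>[W,V]"])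
        (simp_all add: O'_eq[of "Ident C O'" O'])
    show "\<exists>y\<in>Hom_set C W W. x = \<zero>[O',W] \<cdot>[O',W,W] y" if "x \<in> Hom_set C O' W" for x
      using O'_eq[OF that] by (intro bexI[of _ "Ident C W"]) simp_all
    show "\<exists>s'\<in>Hom_set C V O'. s = s' \<cdot>[V,O',W] \<zero>[O',W]"
      if "s \<in> Hom_set C V W" "s \<cdot>[V,W,W] Ident C W = \<zero>[V,W]" for s
      using that by (intro bexI[of _ "\<zero>[V,O']"]) simp_all
    show "s = \<zero>[V,O']" if "s \<in> Hom_set C V O'" for s
      using that by (rule V_O')
    show "\<exists>b\<in>Hom_set C W W. u = Ident C W \<cdot>[W,W,W] b" if "u \<in> Hom_set C W W" for u
      using that by (intro bexI[of _ u]) simp_all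
    show "\<exists>c\<in>Hom_set C W W. u = c \<cdot>[W,W,W] Ident C W" if "u \<in> Hom_set C W W" for u
      using that by (intro bexI[of _ u]) simp_all
    show "\<exists>s'\<in>Hom_set C V V. s = s' \<cdot>[V,V,V] Ident C V" if "s \<in> Hom_set C V V" for s
      using that by (intro bexI[of _ s]) simp_all
  qed simp_all
  show ?thesis by (rule derived_equivalent)
qed

end

section \<open>Exchanging the end terms of an Auslander-Reiten triangle\<close>

context AR_triangulated
begin

lemma eq_after_g:
  assumes [simp]: "U \<in> Obj C" "s \<in> Hom_set C U M" "t \<in> Hom_set C U M"
    and eq: "s \<cdot>[U,M,Y] g = t \<cdot>[U,M,Y] g"
  obtains l where "l \<in> Hom_set C U X" "s = t \<oplus>[U,M] l \<cdot>[U,X,M] f"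
proof -
  have "(\<ominus>[U,M] t \<oplus>[U,M] s) \<cdot>[U,M,Y] g = \<zero>[U,Y]" by (simp add: Comp_add_left eq)
  then obtain l where "l \<in> Hom_set C U X" and l: "\<ominus>[U,M] t \<oplus>[U,M] s = l \<cdot>[U,X,M] f"
    using factor_through_first[OF tri, of U "\<ominus>[U,M] t \<oplus>[U,M] s"] by auto
  moreover have "s = t \<oplus>[U,M] (\<ominus>[U,M] t \<oplus>[U,M] s)" by (simp flip: Mor_add_assoc)
  ultimately show thesis using that by metis
qed

lemma eq_before_f:
  assumes [simp]: "U \<in> Obj C" "s \<in> Hom_set C M U" "t \<in> Hom_set C M U"
    and eq: "f \<cdot>[X,M,U] s = f \<cdot>[X,M,U] t"
  obtains l where "l \<in> Hom_set C Y U" "s = t \<oplus>[M,U] g \<cdot>[M,Y,U] l"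
proof -
  have "f \<cdot>[X,M,U] (\<ominus>[M,U] t \<oplus>[M,U] s) = \<zero>[X,U]" by (simp add: Comp_add_right eq)
  then obtain l where "l \<in> Hom_set C Y U" and l: "\<ominus>[M,U] t \<oplus>[M,U] s = g \<cdot>[M,Y,U] l"
    using extend_along_second[OF tri, of U "\<ominus>[M,U] t \<oplus>[M,U] s"] by auto
  moreover have "s = t \<oplus>[M,U] (\<ominus>[M,U] t \<oplus>[M,U] s)" by (simp flip: Mor_add_assoc)
  ultimately show thesis using that by metis
qed

text \<open>
  Let \<open>s q = 1\<close> for \<open>s : X \<rightarrow> M\<close> and suppose that \<open>Y\<close> is not a summand of \<open>M\<close>. The component \<open>s g\<close> of
  \<open>g\<close> is not a split monomorphism, so it factors as \<open>f h\<close>; the morphism \<open>h : M \<rightarrow> Y\<close> is not a split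
  epimorphism, so \<open>h = h' g\<close>. Hence \<open>s - f h'\<close> factors through \<open>f\<close>, and \<open>1 = s q\<close> is a sum of two
  endomorphisms of \<open>X\<close> with the factor \<open>f\<close>. One of them is invertible, which makes \<open>f\<close> a split
  monomorphism, a contradiction.
\<close>

lemma retract_X_imp_retract_Y:
  assumes "retract X M" and niso: "\<not> iso_obj C X Y"
  shows "retract Y M"
proof (rule ccontr)
  assume nY: "\<not> retract Y M"
  from assms(1) obtain s q where [simp]: "s \<in> Hom_set C X M" "q \<in> Hom_set C M X"
    and sq: "s \<cdot>[X,M,X] q = Ident C X" by (rule retractE)
  obtain h where [simp]: "h \<in> Hom_set C M Y" and h: "s \<cdot>[X,M,Y] g = f \<cdot>[X,M,Y] h"
  proof (rule left_almost_split)
    fix r assume r: "r \<in> Hom_set C Y X"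
    show "(s \<cdot>[X,M,Y] g) \<cdot>[X,Y,X] r \<noteq> Ident C X"
    proof
      assume "(s \<cdot>[X,M,Y] g) \<cdot>[X,Y,X] r = Ident C X"
      then have "retract X Y" using r by (intro retractI[of X Y "s \<cdot>[X,M,Y] g" r]) simp_all
      then show False using retract_of_local_sym(2)[OF local_Y _ nonzero_X] niso by simp
    qed
  qed simp_all
  obtain h' where [simp]: "h' \<in> Hom_set C M M" and h': "h = h' \<cdot>[M,M,Y] g"
  proof (rule right_almost_split)
    show "r \<cdot>[Y,M,Y] h \<noteq> Ident C Y" if "r \<in> Hom_set C Y M" for r
      using that nY retractI[of Y M r h] by auto
  qed simp_all
  obtain l where [simp]: "l \<in> Hom_set C X X" and l: "s = f \<cdot>[X,M,M] h' \<oplus>[X,M] l \<cdot>[X,X,M] f"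
    using eq_after_g[of X s "f \<cdot>[X,M,M] h'"] h h' by auto
  have "f \<cdot>[X,M,X] (h' \<cdot>[M,M,X] q) \<oplus>[X,X] l \<cdot>[X,X,X] (f \<cdot>[X,M,X] q) = Ident C X"
    using sq l by (simp add: Comp_add_left)
  then show False
  proof (rule local_objE[OF local_X, rotated 2])
    fix e assume e: "invertible X X (f \<cdot>[X,M,X] (h' \<cdot>[M,M,X] q)) e"
    then have [simp]: "e \<in> Hom_set C X X" by (simp add: invertible_def)
    show False
      using retract_of_local_splits(1)[OF local_X _ _ _ e]
        f_not_split_mono[of "h' \<cdot>[M,M,X] (q \<cdot>[M,X,X] e)"] by simp
  next
    fix e assume e: "invertible X X (l \<cdot>[X,X,X] (f \<cdot>[X,M,X] q)) e"
    then have [simp]: "e \<in> Hom_set C X X" by (simp add: invertible_def)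
    have "(f \<cdot>[X,M,X] q) \<cdot>[X,X,X] (e \<cdot>[X,X,X] l) = Ident C X"
      by (rule retract_of_local[OF local_X _ _ _ _ nonzero_X])
        (use retract_of_local_splits(2)[OF local_X _ _ _ e] in simp_all)
    then show False using f_not_split_mono[of "q \<cdot>[M,X,X] (e \<cdot>[X,X,X] l)"] by simp
  qed simp_all
qed

text \<open>
  The dual argument applies to the component \<open>f q : X \<rightarrow> Y\<close> of \<open>f\<close>: it factors as \<open>f h' g\<close>, so
  \<open>q - h' g\<close> factors through \<open>g\<close> and \<open>1 = s q\<close> is a sum of two endomorphisms of \<open>Y\<close> with the factor
  \<open>g\<close>.
\<close>

lemma retract_Y_imp_retract_X:
  assumes "retract Y M" and niso: "\<not> iso_obj C Y X"
  shows "retract X M"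
proof (rule ccontr)
  assume nX: "\<not> retract X M"
  from assms(1) obtain s q where [simp]: "s \<in> Hom_set C Y M" "q \<in> Hom_set C M Y"
    and sq: "s \<cdot>[Y,M,Y] q = Ident C Y" by (rule retractE)
  obtain h where [simp]: "h \<in> Hom_set C X M" and h: "f \<cdot>[X,M,Y] q = h \<cdot>[X,M,Y] g"
  proof (rule right_almost_split)
    fix r assume r: "r \<in> Hom_set C Y X"
    show "r \<cdot>[Y,X,Y] (f \<cdot>[X,M,Y] q) \<noteq> Ident C Y"
    proof
      assume "r \<cdot>[Y,X,Y] (f \<cdot>[X,M,Y] q) = Ident C Y"
      then have "retract Y X" using r by (intro retractI[of Y X r "f \<cdot>[X,M,Y] q"]) simp_all
      then show False using retract_of_local_sym(2)[OF local_X _ nonzero_Y] niso by simp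
    qed
  qed simp_all
  obtain h' where [simp]: "h' \<in> Hom_set C M M" and h': "h = f \<cdot>[X,M,M] h'"
  proof (rule left_almost_split)
    show "h \<cdot>[X,M,X] r \<noteq> Ident C X" if "r \<in> Hom_set C M X" for r
      using that nX retractI[of X M h r] by auto
  qed simp_all
  obtain l where [simp]: "l \<in> Hom_set C Y Y" and l: "q = h' \<cdot>[M,M,Y] g \<oplus>[M,Y] g \<cdot>[M,Y,Y] l"
    using eq_before_f[of Y q "h' \<cdot>[M,M,Y] g"] h h' by auto
  have "(s \<cdot>[Y,M,M] h') \<cdot>[Y,M,Y] g \<oplus>[Y,Y] (s \<cdot>[Y,M,Y] g) \<cdot>[Y,Y,Y] l = Ident C Y"
    using sq l by (simp add: Comp_add_right)
  then show False
  proof (rule local_objE[OF local_Y, rotated 2])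
    fix e assume e: "invertible Y Y ((s \<cdot>[Y,M,M] h') \<cdot>[Y,M,Y] g) e"
    then have [simp]: "e \<in> Hom_set C Y Y" by (simp add: invertible_def)
    show False
      using retract_of_local_splits(2)[OF local_Y _ _ _ e]
          g_not_split_epi[of "e \<cdot>[Y,Y,M] (s \<cdot>[Y,M,M] h')"]
      by simp
  next
    fix e assume e: "invertible Y Y ((s \<cdot>[Y,M,Y] g) \<cdot>[Y,Y,Y] l) e"
    then have [simp]: "e \<in> Hom_set C Y Y" by (simp add: invertible_def)
    have "(l \<cdot>[Y,Y,Y] e) \<cdot>[Y,Y,Y] (s \<cdot>[Y,M,Y] g) = Ident C Y"
      by (rule retract_of_local[OF local_Y _ _ _ _ nonzero_Y])
        (use retract_of_local_splits(1)[OF local_Y _ _ _ e] in simp_all)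
    then show False using g_not_split_epi[of "l \<cdot>[Y,Y,M] (e \<cdot>[Y,Y,M] s)"] by simp
  qed simp_all
qed

text \<open>
  Here \<open>K\<close> is \<open>Y[-1]\<close>. Let \<open>s p = 1\<close> for \<open>s : K \<rightarrow> M\<close>. The component \<open>f p : X \<rightarrow> K\<close> of \<open>f\<close> becomes a
  morphism \<open>X[1] \<rightarrow> Y\<close>. It is not a split epimorphism, so it factors through \<open>g\<close> by some
  \<open>h : X[1] \<rightarrow> M\<close>, and \<open>h\<close> is not a split monomorphism, so it factors through \<open>f[1]\<close>. Comparing the
  two factorizations through \<open>f[1]\<close> writes the identity of \<open>Y\<close> as a sum of two endomorphisms, one
  with the factor \<open>g\<close> and one with the factor \<open>g[1]\<close>. Invertibility of either of them makes \<open>g\<close> a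
  split epimorphism.
\<close>

lemma desuspension_Y_not_retract:
  assumes K: "invertible (Sh C K) Y c d" and K_obj [simp]: "K \<in> Obj C"
    and nM: "\<not> retract (Sh C X) M" and nY: "\<not> retract (Sh C X) Y"
  shows "\<not> retract K M"
proof
  assume "retract K M"
  then obtain s p where [simp]: "s \<in> Hom_set C K M" "p \<in> Hom_set C M K"
    and sp: "s \<cdot>[K,M,K] p = Ident C K" by (rule retractE)
  from K have [simp]: "c \<in> Hom_set C (Sh C K) Y" "d \<in> Hom_set C Y (Sh C K)"
    and dc: "d \<cdot>[Y,Sh C K,Y] c = Ident C Y" by (simp_all add: invertible_def)
  let ?S = "Shm C K M s" and ?P = "Shm C M K p" and ?F = "Shm C X M f" and ?G = "Shm C M Y g"
  have SP: "?S \<cdot>[Sh C K,Sh C M,Sh C K] ?P = Ident C (Sh C K)"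
    by (simp add: sp Shm_Ident flip: Shm_Comp)
  obtain h where [simp]: "h \<in> Hom_set C (Sh C X) M"
    and h: "?F \<cdot>[Sh C X,Sh C M,Y] (?P \<cdot>[Sh C M,Sh C K,Y] c) = h \<cdot>[Sh C X,M,Y] g"
  proof (rule right_almost_split)
    fix r assume r: "r \<in> Hom_set C Y (Sh C X)"
    show "r \<cdot>[Y,Sh C X,Y] (?F \<cdot>[Sh C X,Sh C M,Y] (?P \<cdot>[Sh C M,Sh C K,Y] c)) \<noteq> Ident C Y"
    proof
      assume "r \<cdot>[Y,Sh C X,Y] (?F \<cdot>[Sh C X,Sh C M,Y] (?P \<cdot>[Sh C M,Sh C K,Y] c)) = Ident C Y"
      then have "retract Y (Sh C X)" using r by (intro retractI[of Y "Sh C X" r]) simp_all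
      then show False using retract_of_local_sym(1)[OF local_ShX _ nonzero_Y] nY by simp
    qed
  qed simp_all
  have "w \<cdot>[Y,Sh C X,M] h = \<zero>[Y,M]"
  proof (rule left_almost_split_zero)
    show "h \<cdot>[Sh C X,M,Sh C X] r \<noteq> Ident C (Sh C X)" if "r \<in> Hom_set C M (Sh C X)" for r
      using that nM retractI[of "Sh C X" M h r] by auto
  qed simp_all
  then obtain k where [simp]: "k \<in> Hom_set C (Sh C M) M" and k: "h = ?F \<cdot>[Sh C X,Sh C M,M] k"
    using extend_along_shift[OF tri, of M h] by auto
  define u where "u = ?P \<cdot>[Sh C M,Sh C K,Y] c \<oplus>[Sh C M,Y] \<ominus>[Sh C M,Y] (k \<cdot>[Sh C M,M,Y] g)"
  have [simp]: "u \<in> Hom_set C (Sh C M) Y" by (simp add: u_def)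
  have "?F \<cdot>[Sh C X,Sh C M,Y] u = \<zero>[Sh C X,Y]"
    using h k by (simp add: u_def Comp_add_right)
  then obtain l where [simp]: "l \<in> Hom_set C (Sh C Y) Y"
    and l: "u = (\<ominus>[Sh C M,Sh C Y] ?G) \<cdot>[Sh C M,Sh C Y,Y] l"
    using extend_along_third[OF Tri_rotate[OF Tri_rotate[OF tri]], of Y u] by auto
  have "?P \<cdot>[Sh C M,Sh C K,Y] c = k \<cdot>[Sh C M,M,Y] g \<oplus>[Sh C M,Y] u"
    by (simp add: u_def)
  then have Pc: "?P \<cdot>[Sh C M,Sh C K,Y] c
      = k \<cdot>[Sh C M,M,Y] g \<oplus>[Sh C M,Y] ?G \<cdot>[Sh C M,Sh C Y,Y] (\<ominus>[Sh C Y,Y] l)"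
    by (simp add: l)
  let ?a = "(d \<cdot>[Y,Sh C K,M] (?S \<cdot>[Sh C K,Sh C M,M] k)) \<cdot>[Y,M,Y] g"
  let ?b' = "d \<cdot>[Y,Sh C K,Sh C Y] (?S \<cdot>[Sh C K,Sh C M,Sh C Y] ?G)"
  let ?b = "?b' \<cdot>[Y,Sh C Y,Y] (\<ominus>[Sh C Y,Y] l)"
  have "?a \<oplus>[Y,Y] ?b = d \<cdot>[Y,Sh C K,Y] (?S \<cdot>[Sh C K,Sh C M,Y] (?P \<cdot>[Sh C M,Sh C K,Y] c))"
    unfolding Pc by (simp add: Comp_add_right)
  also have "\<dots> = Ident C Y" by (simp add: Comp_Ident_subst[OF SP] dc)
  finally have "?a \<oplus>[Y,Y] ?b = Ident C Y" .
  then show False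
  proof (rule local_objE[OF local_Y, rotated 2])
    fix e assume e: "invertible Y Y ?a e"
    then have [simp]: "e \<in> Hom_set C Y Y" by (simp add: invertible_def)
    show False
      using retract_of_local_splits(2)[OF local_Y _ _ _ e]
        g_not_split_epi[of "e \<cdot>[Y,Y,M] (d \<cdot>[Y,Sh C K,M] (?S \<cdot>[Sh C K,Sh C M,M] k))"]
      by simp
  next
    fix e assume e: "invertible Y Y ?b e"
    then have [simp]: "e \<in> Hom_set C Y Y" by (simp add: invertible_def)
    let ?z = "(\<ominus>[Sh C Y,Y] l) \<cdot>[Sh C Y,Y,Y] e"
    have "?b' \<cdot>[Y,Sh C Y,Y] ?z = Ident C Y"
      by (rule retract_of_local_splits(1)[OF local_Y _ _ _ e]) simp_all
    note bz = this
    have zb: "?z \<cdot>[Sh C Y,Y,Sh C Y] ?b' = Ident C (Sh C Y)"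
      by (rule retract_of_local[OF local_obj_Sh_iff[THEN iffD2, OF _ local_Y] _ _ _ _ nonzero_Y])
          (use bz in simp_all)
    have "?z \<cdot>[Sh C Y,Y,Sh C M] (d \<cdot>[Y,Sh C K,Sh C M] ?S) \<in> Hom_set C (Sh C Y) (Sh C M)" by simp
    then obtain r where [simp]: "r \<in> Hom_set C Y M"
      and r: "?z \<cdot>[Sh C Y,Y,Sh C M] (d \<cdot>[Y,Sh C K,Sh C M] ?S) = Shm C Y M r"
      using Shm_surj[of Y M] by (metis tri_closed(2,3))
    have "Shm C Y Y (r \<cdot>[Y,M,Y] g) = (?z \<cdot>[Sh C Y,Y,Sh C M] (d \<cdot>[Y,Sh C K,Sh C M] ?S))
        \<cdot>[Sh C Y,Sh C M,Sh C Y] ?G"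
      unfolding r by (simp add: Shm_Comp)
    also have "\<dots> = Shm C Y Y (Ident C Y)"
      using zb by (simp add: Shm_Ident)
    finally show False using g_not_split_epi[of r] by (simp add: Shm_eq_iff)
  qed simp_all
qed

text \<open>
  If \<open>V\<close> and \<open>W\<close> are summands of powers of each other, they are Morita equivalent. Otherwise neither
  \<open>X\<close> nor \<open>Y\<close> is a summand of \<open>D\<close>, and \<open>P\<^sub>1 = X\<close>, \<open>P\<^sub>0 = Q\<^sub>0 = D \<oplus> M\<close>, \<open>Q\<^sub>1 = Y\<close> give a tilting
  presentation. Exactness in the middle reduces to that of the triangle on the component \<open>M\<close>. The
  other conditions amount to factorizations through \<open>f\<close> or \<open>g\<close> of morphisms that do not split, and
  to the vanishing of their composites with \<open>w\<close>.
\<close>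

theorem exchange_tilting:
  assumes M: "retract M D" and V: "direct_sum C [D, X] V" and W: "direct_sum C [D, Y] W"
    and nShX: "\<not> retract (Sh C X) D" "\<not> retract (Sh C X) Y"
    and K: "invertible (Sh C K) Y c d" "K \<in> Obj C" and nK: "\<not> retract K D"
    and XY: "iso_obj C X Y \<or> (retract X D \<longleftrightarrow> retract Y D)"
  shows "derived_equivalent_via_tilting (End_ring C V) (End_ring C W)"
proof -
  from V obtain iD pD iX pX where bV: "biproduct D X V iD pD iX pX" by (auto simp: direct_sum_2_iff)
  from W obtain jD qD jY qY where bW: "biproduct D Y W jD qD jY qY" by (auto simp: direct_sum_2_iff)
  have [simp]: "D \<in> Obj C" "V \<in> Obj C" "W \<in> Obj C" "K \<in> Obj C"
    using bV bW K by (auto simp: biproduct_def)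
  note rV = biproduct_retract[OF bV] and rW = biproduct_retract[OF bW]
  have local_split: "retract Z D \<or> retract Z U"
    if "local_obj Z" "retract Z S" "biproduct D U S i p j q" for Z S U i p j q
    using local_retract_biproduct[OF that(1,3,2)] .
  show ?thesis
  proof (cases "iso_obj C X Y \<or> retract X D \<and> retract Y D")
    case True
    have "retract Y V \<and> retract X W"
    proof (cases "retract X D \<and> retract Y D")
      case True
      then show ?thesis using retract_trans rV rW by blast
    next
      case False
      with True have "iso_obj C X Y" by blast
      then have "retract X Y" "retract Y X"
        by (auto simp: iso_obj_iff invertible_def intro: retractI)
      then show ?thesis using retract_trans rV rW by blast
    qed
    then show ?thesis
      using Morita_tilting biproduct_summand2[OF bW] biproduct_summand2[OF bV] rV rW by blast
  next
    case False
    then have nX: "\<not> retract X D" and nY: "\<not> retract Y D" using XY by auto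
    from M obtain m m' where [simp]: "m \<in> Hom_set C M D" "m' \<in> Hom_set C D M"
      and mm': "m \<cdot>[M,D,M] m' = Ident C M" by (rule retractE)
    obtain E where "direct_sum C [D, M] E" using ex_direct_sum[of D M] by auto
    then obtain a a' b b' where bE: "biproduct D M E a a' b b'" by (auto simp: direct_sum_2_iff)
    from bV have V_closed [simp]: "iD \<in> Hom_set C D V" "pD \<in> Hom_set C V D" "iX \<in> Hom_set C X V"
        "pX \<in> Hom_set C V X"
      and V_eqs [simp]: "iD \<cdot>[D,V,D] pD = Ident C D" "iX \<cdot>[X,V,X] pX = Ident C X"
        "iD \<cdot>[D,V,X] pX = \<zero>[D,X]" "iX \<cdot>[X,V,D] pD = \<zero>[X,D]"
      and V_sum: "pD \<cdot>[V,D,V] iD \<oplus>[V,V] pX \<cdot>[V,X,V] iX = Ident C V"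
      by (auto simp: biproduct_def)
    from bW have W_closed [simp]: "jD \<in> Hom_set C D W" "qD \<in> Hom_set C W D" "jY \<in> Hom_set C Y W"
        "qY \<in> Hom_set C W Y"
      and W_eqs [simp]: "jD \<cdot>[D,W,D] qD = Ident C D" "jY \<cdot>[Y,W,Y] qY = Ident C Y"
        "jD \<cdot>[D,W,Y] qY = \<zero>[D,Y]" "jY \<cdot>[Y,W,D] qD = \<zero>[Y,D]"
      and W_sum: "qD \<cdot>[W,D,W] jD \<oplus>[W,W] qY \<cdot>[W,Y,W] jY = Ident C W"
      by (auto simp: biproduct_def)
    from bE have [simp]: "E \<in> Obj C" and E_closed [simp]: "a \<in> Hom_set C D E" "a' \<in> Hom_set C E D"
        "b \<in> Hom_set C M E" "b' \<in> Hom_set C E M"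
      and E_eqs [simp]: "a \<cdot>[D,E,D] a' = Ident C D" "b \<cdot>[M,E,M] b' = Ident C M"
        "a \<cdot>[D,E,M] b' = \<zero>[D,M]" "b \<cdot>[M,E,D] a' = \<zero>[M,D]"
      and E_sum: "a' \<cdot>[E,D,E] a \<oplus>[E,E] b' \<cdot>[E,M,E] b = Ident C E"
      by (auto simp: biproduct_def)
    note [simp] = V_eqs(1,2)[THEN Comp_Ident_subst] V_eqs(3,4)[THEN Comp_zero_subst]
      W_eqs(1,2)[THEN Comp_Ident_subst] W_eqs(3,4)[THEN Comp_zero_subst]
      E_eqs(1,2)[THEN Comp_Ident_subst] E_eqs(3,4)[THEN Comp_zero_subst]
      Tri_comp_zero[OF tri] Tri_comp_zero[OF tri, THEN Comp_zero_subst]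
    have decompE: "x = (x \<cdot>[U,E,D] a') \<cdot>[U,D,E] a \<oplus>[U,E] (x \<cdot>[U,E,M] b') \<cdot>[U,M,E] b"
      if [simp]: "x \<in> Hom_set C U E" "U \<in> Obj C" for x U
    proof -
      have "x = x \<cdot>[U,E,E] (a' \<cdot>[E,D,E] a \<oplus>[E,E] b' \<cdot>[E,M,E] b)" by (simp add: E_sum)
      then show ?thesis by (simp add: Comp_add_right)
    qed
    have decompE': "x = a' \<cdot>[E,D,U] (a \<cdot>[D,E,U] x) \<oplus>[E,U] b' \<cdot>[E,M,U] (b \<cdot>[M,E,U] x)"
      if [simp]: "x \<in> Hom_set C E U" "U \<in> Obj C" for x U
    proof -
      have "x = (a' \<cdot>[E,D,E] a \<oplus>[E,E] b' \<cdot>[E,M,E] b) \<cdot>[E,E,U] x" by (simp add: E_sum)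
      then show ?thesis by (simp add: Comp_add_left)
    qed
    have decompW: "x = (x \<cdot>[U,W,D] qD) \<cdot>[U,D,W] jD \<oplus>[U,W] (x \<cdot>[U,W,Y] qY) \<cdot>[U,Y,W] jY"
      if [simp]: "x \<in> Hom_set C U W" "U \<in> Obj C" for x U
    proof -
      have "x = x \<cdot>[U,W,W] (qD \<cdot>[W,D,W] jD \<oplus>[W,W] qY \<cdot>[W,Y,W] jY)" by (simp add: W_sum)
      then show ?thesis by (simp add: Comp_add_right)
    qed
    have decompW': "x = qD \<cdot>[W,D,U] (jD \<cdot>[D,W,U] x) \<oplus>[W,U] qY \<cdot>[W,Y,U] (jY \<cdot>[Y,W,U] x)"
      if [simp]: "x \<in> Hom_set C W U" "U \<in> Obj C" for x U
    proof -
      have "x = (qD \<cdot>[W,D,W] jD \<oplus>[W,W] qY \<cdot>[W,Y,W] jY) \<cdot>[W,W,U] x" by (simp add: W_sum)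
      then show ?thesis by (simp add: Comp_add_left)
    qed
    have decompV: "x = (x \<cdot>[U,V,D] pD) \<cdot>[U,D,V] iD \<oplus>[U,V] (x \<cdot>[U,V,X] pX) \<cdot>[U,X,V] iX"
      if [simp]: "x \<in> Hom_set C U V" "U \<in> Obj C" for x U
    proof -
      have "x = x \<cdot>[U,V,V] (pD \<cdot>[V,D,V] iD \<oplus>[V,V] pX \<cdot>[V,X,V] iX)" by (simp add: V_sum)
      then show ?thesis by (simp add: Comp_add_right)
    qed
    have local_K: "local_obj K"
      using local_obj_iso[OF local_Y K(1)] by (simp add: local_obj_Sh_iff)
    \<comment> \<open>Equivalently, \<open>Y[-1]\<close> is not a summand of \<open>V = D \<oplus> X\<close>.\<close>
    have nY_ShV: "\<not> retract Y (Sh C V)"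
    proof
      assume Y: "retract Y (Sh C V)"
      have KY: "retract (Sh C K) Y" using K(1) by (auto simp: invertible_def intro: retractI)
      then have "retract K V" using retract_trans[OF KY Y] by (simp add: retract_Sh_iff)
      then have "retract K X" using local_split[OF local_K _ bV] nK by blast
      moreover have "retract Y (Sh C K)" using K(1) by (auto simp: invertible_def intro: retractI)
      ultimately have "retract Y (Sh C X)" using retract_trans retract_Sh_iff tri_closed(1) \<open>K \<in>
          Obj C\<close> by blast
      then show False using retract_of_local_sym(1)[OF local_ShX _ nonzero_Y] nShX by simp
    qed
    have nX_E: "z \<cdot>[X,D,X] s \<noteq> Ident C X" if "z \<in> Hom_set C X D" "s \<in> Hom_set C D X" for z s
      using that nX retractI[of X D z s] by auto
    have nX_M: "z \<cdot>[X,M,X] s \<noteq> Ident C X" if "z \<in> Hom_set C X M" "s \<in> Hom_set C M X" for z s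
      using that nX retractI[of X M z s] retract_trans[OF _ M] by auto
    have nY_E: "s \<cdot>[Y,E,Y] z \<noteq> Ident C Y" if "s \<in> Hom_set C Y E" "z \<in> Hom_set C E Y" for z s
      using that nY retractI[of Y E s z] local_split[OF local_Y _ bE] retract_trans[OF _ M] by auto
    have nShX_W: "z \<cdot>[Sh C X,W,Sh C X] s \<noteq> Ident C (Sh C X)"
      if "z \<in> Hom_set C (Sh C X) W" "s \<in> Hom_set C W (Sh C X)" for z s
      using that nShX retractI[of "Sh C X" W z s] local_split[OF local_ShX _ bW] by auto
    \<comment> \<open>In components: \<open>F = (0, f)\<close>, \<open>G = 1 \<oplus> g\<close>, \<open>J = 1 \<oplus> f\<close> and \<open>Q = (0, g)\<close>.\<close>
    define F where "F = f \<cdot>[X,M,E] b"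
    define G where "G = a' \<cdot>[E,D,W] jD \<oplus>[E,W] b' \<cdot>[E,M,W] (g \<cdot>[M,Y,W] jY)"
    define J where "J = pD \<cdot>[V,D,E] a \<oplus>[V,E] pX \<cdot>[V,X,E] (f \<cdot>[X,M,E] b)"
    define Q where "Q = b' \<cdot>[E,M,Y] g"
    have [simp]: "F \<in> Hom_set C X E" "G \<in> Hom_set C E W" "J \<in> Hom_set C V E" "Q \<in> Hom_set C E Y"
      by (simp_all add: F_def G_def J_def Q_def)
    have comp_G [simp]: "a \<cdot>[D,E,W] G = jD" "b \<cdot>[M,E,W] G = g \<cdot>[M,Y,W] jY" "G \<cdot>[E,W,D] qD = a'" "G
        \<cdot>[E,W,Y] qY = Q"
      by (simp_all add: G_def Q_def Comp_add_left Comp_add_right)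
    have comp_J [simp]: "J \<cdot>[V,E,D] a' = pD" "J \<cdot>[V,E,M] b' = pX \<cdot>[V,X,M] f"
        "iD \<cdot>[D,V,E] J = a" "iX \<cdot>[X,V,E] J = F"
      by (simp_all add: J_def F_def Comp_add_left Comp_add_right)
    have comp_F [simp]: "F \<cdot>[X,E,D] a' = \<zero>[X,D]" "F \<cdot>[X,E,M] b' = f"
      by (simp_all add: F_def)
    \<comment> \<open>The kernel of \<open>Hom(V, f)\<close> comes from the morphisms \<open>y w\<close> with \<open>y : V[1] \<rightarrow> Y\<close>, and no such
      \<open>y\<close> is a split epimorphism.\<close>
    have kernel_f: "s = \<zero>[V,X]" if [simp]: "s \<in> Hom_set C V X" and "s \<cdot>[V,X,M] f = \<zero>[V,M]" for s
    proof -
      have "Shm C V X s \<cdot>[Sh C V,Sh C X,Sh C M] Shm C X M f = \<zero>[Sh C V,Sh C M]"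
        using that by (simp flip: Shm_Comp)
      then obtain y where y [simp]: "y \<in> Hom_set C (Sh C V) Y" and sy: "Shm C V X s = y
          \<cdot>[Sh C V,Y,Sh C X] w"
        using factor_through_third[OF tri, of "Sh C V" "Shm C V X s"] by auto
      have "y \<cdot>[Sh C V,Y,Sh C X] w = \<zero>[Sh C V,Sh C X]"
      proof (rule right_almost_split_zero)
        show "r \<cdot>[Y,Sh C V,Y] y \<noteq> Ident C Y" if "r \<in> Hom_set C Y (Sh C V)" for r
          using that nY_ShV retractI[of Y "Sh C V" r y] by auto
      qed simp_all
      then show ?thesis using sy by (simp add: Shm_eq_zero_iff)
    qed
    interpret tilting_presentation R C V X E W E Y F G J Q
    proof
      show "summand2 V X" using rV by (intro retract_imp_summand2)
      show "summand2 V E" using biproduct_summand2[OF bE] rV retract_trans[OF M] by blast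
      show "F \<cdot>[X,E,W] G = \<zero>[X,W]" by (simp add: F_def)
      show "J \<cdot>[V,E,Y] Q = \<zero>[V,Y]" by (simp add: J_def Q_def Comp_add_left)
      show "\<exists>s'\<in>Hom_set C V X. s = s' \<cdot>[V,X,E] F"
        if [simp]: "s \<in> Hom_set C V E" and sG: "s \<cdot>[V,E,W] G = \<zero>[V,W]" for s
      proof -
        have D: "s \<cdot>[V,E,D] a' = \<zero>[V,D]"
          using Comp_zero_subst[OF sG, of D qD] by simp
        have "(s \<cdot>[V,E,M] b') \<cdot>[V,M,Y] g = \<zero>[V,Y]"
          using Comp_zero_subst[OF sG, of Y qY] by (simp add: Q_def)
        then obtain s' where [simp]: "s' \<in> Hom_set C V X" and s': "s \<cdot>[V,E,M] b' = s' \<cdot>[V,X,M] f"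
          using factor_through_first[OF tri, of V "s \<cdot>[V,E,M] b'"] by auto
        have "s = s' \<cdot>[V,X,E] F"
          using decompE[of s V] unfolding D s' by (simp add: F_def)
        then show ?thesis by (intro bexI[of _ s']) simp_all
      qed
      show "s = \<zero>[V,X]" if [simp]: "s \<in> Hom_set C V X" and sF: "s \<cdot>[V,X,E] F = \<zero>[V,E]" for s
        using Comp_zero_subst[OF sF, of M b'] by (intro kernel_f) simp_all
      show "\<exists>t\<in>Hom_set C W W. u = G \<cdot>[E,W,W] t"
        if [simp]: "u \<in> Hom_set C E W" and Fu: "F \<cdot>[X,E,W] u = \<zero>[X,W]" for u
      proof -
        have "f \<cdot>[X,M,W] (b \<cdot>[M,E,W] u) = \<zero>[X,W]" using Fu by (simp add: F_def)
        then obtain t where [simp]: "t \<in> Hom_set C Y W" and t: "b \<cdot>[M,E,W] u = g \<cdot>[M,Y,W] t"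
          using extend_along_second[OF tri, of W "b \<cdot>[M,E,W] u"] by auto
        let ?t = "qD \<cdot>[W,D,W] (a \<cdot>[D,E,W] u) \<oplus>[W,W] qY \<cdot>[W,Y,W] t"
        have "u = G \<cdot>[E,W,W] ?t"
          using decompE'[of u W] unfolding t by (simp add: G_def Comp_add_left Comp_add_right)
        then show ?thesis by (intro bexI[of _ ?t]) simp_all
      qed
      show "t = \<zero>[W,W]" if [simp]: "t \<in> Hom_set C W W" and Gt: "G \<cdot>[E,W,W] t = \<zero>[E,W]" for t
      proof -
        have D: "jD \<cdot>[D,W,W] t = \<zero>[D,W]"
          using Comp_subst[OF comp_G(1), of W t] by (simp add: Gt)
        have "g \<cdot>[M,Y,W] (jY \<cdot>[Y,W,W] t) = \<zero>[M,W]"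
          using Comp_subst[OF comp_G(2), of W t] by (simp add: Gt)
        then obtain z where z [simp]: "z \<in> Hom_set C (Sh C X) W" and Y: "jY \<cdot>[Y,W,W] t = w
            \<cdot>[Y,Sh C X,W] z"
          using extend_along_third[OF tri, of W "jY \<cdot>[Y,W,W] t"] by auto
        have "w \<cdot>[Y,Sh C X,W] z = \<zero>[Y,W]"
          by (rule left_almost_split_zero) (use nShX_W in auto)
        then show ?thesis using decompW'[of t W] by (simp add: D Y)
      qed
      show "\<exists>y\<in>Hom_set C E E. x = F \<cdot>[X,E,E] y" if [simp]: "x \<in> Hom_set C X E" for x
      proof -
        obtain y\<^sub>D where [simp]: "y\<^sub>D \<in> Hom_set C M D" and D: "x \<cdot>[X,E,D] a' = f \<cdot>[X,M,D] y\<^sub>D"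
          by (rule left_almost_split[of D "x \<cdot>[X,E,D] a'"]) (use nX_E in \<open>auto simp del:
              Comp_assoc\<close>)
        obtain y\<^sub>M where [simp]: "y\<^sub>M \<in> Hom_set C M M" and M': "x \<cdot>[X,E,M] b' = f \<cdot>[X,M,M] y\<^sub>M"
          by (rule left_almost_split[of M "x \<cdot>[X,E,M] b'"]) (use nX_M in \<open>auto simp del:
              Comp_assoc\<close>)
        let ?y = "b' \<cdot>[E,M,E] (y\<^sub>D \<cdot>[M,D,E] a \<oplus>[M,E] y\<^sub>M \<cdot>[M,M,E] b)"
        have "x = F \<cdot>[X,E,E] ?y"
          using decompE[of x X] unfolding D M' by (simp add: F_def Comp_add_right)
        then show ?thesis by (intro bexI[of _ ?y]) simp_all
      qed
      show "\<exists>e\<in>Hom_set C E E. u = e \<cdot>[E,E,W] G" if [simp]: "u \<in> Hom_set C E W" for u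
      proof -
        obtain v where [simp]: "v \<in> Hom_set C E M" and v: "u \<cdot>[E,W,Y] qY = v \<cdot>[E,M,Y] g"
          by (rule right_almost_split[of E "u \<cdot>[E,W,Y] qY"]) (use nY_E in \<open>auto simp del:
              Comp_assoc\<close>)
        let ?e = "u \<cdot>[E,W,E] (qD \<cdot>[W,D,E] a) \<oplus>[E,E] v \<cdot>[E,M,E] b"
        have "u = ?e \<cdot>[E,E,W] G"
          using decompW[of u E] unfolding v by (simp add: Comp_add_left)
        then show ?thesis by (intro bexI[of _ ?e]) simp_all
      qed
      show "\<exists>s'\<in>Hom_set C V V. s = s' \<cdot>[V,V,E] J"
        if [simp]: "s \<in> Hom_set C V E" and sQ: "s \<cdot>[V,E,Y] Q = \<zero>[V,Y]" for s
      proof -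
        have "(s \<cdot>[V,E,M] b') \<cdot>[V,M,Y] g = \<zero>[V,Y]" using sQ by (simp add: Q_def)
        then obtain s' where [simp]: "s' \<in> Hom_set C V X" and s': "s \<cdot>[V,E,M] b' = s' \<cdot>[V,X,M] f"
          using factor_through_first[OF tri, of V "s \<cdot>[V,E,M] b'"] by auto
        let ?s = "s \<cdot>[V,E,V] (a' \<cdot>[E,D,V] iD) \<oplus>[V,V] s' \<cdot>[V,X,V] iX"
        have "s = ?s \<cdot>[V,V,E] J"
          using decompE[of s V] unfolding s' by (simp add: Comp_add_left F_def)
        then show ?thesis by (intro bexI[of _ ?s]) simp_all
      qed
      show "s = \<zero>[V,V]" if [simp]: "s \<in> Hom_set C V V" and sJ: "s \<cdot>[V,V,E] J = \<zero>[V,E]" for s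
      proof -
        have D: "s \<cdot>[V,V,D] pD = \<zero>[V,D]" using Comp_zero_subst[OF sJ, of D a'] by simp
        have "s \<cdot>[V,V,X] pX = \<zero>[V,X]"
          using Comp_zero_subst[OF sJ, of M b'] by (intro kernel_f) simp_all
        then show ?thesis using decompV[of s V] D by simp
      qed
      \<comment> \<open>The summand \<open>D\<close> of \<open>E\<close> is one of \<open>W\<close>, and the summand \<open>M\<close> is one of \<open>W\<close> by way of \<open>D\<close>.\<close>
      show "arrow_summand2 E W G E E (Ident C E)"
      proof (rule arrow_summand2I)
        show "Ident C E \<cdot>[E,E,W] (a' \<cdot>[E,D,W] jD) = (a' \<cdot>[E,D,E] a) \<cdot>[E,E,W] G" by simp
        show "G \<cdot>[E,W,E] (qD \<cdot>[W,D,E] a) = (G \<cdot>[E,W,E] (qD \<cdot>[W,D,E] a)) \<cdot>[E,E,E] Ident C E" by simp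
        show "Ident C E \<cdot>[E,E,W] (b' \<cdot>[E,M,W] (m \<cdot>[M,D,W] jD)) = (b' \<cdot>[E,M,E] (m \<cdot>[M,D,E] a))
            \<cdot>[E,E,W] G"
          by simp
        show "G \<cdot>[E,W,E] (qD \<cdot>[W,D,E] (m' \<cdot>[D,M,E] b))
          = (G \<cdot>[E,W,E] (qD \<cdot>[W,D,E] (m' \<cdot>[D,M,E] b))) \<cdot>[E,E,E] Ident C E" by simp
        show "(a' \<cdot>[E,D,W] jD) \<cdot>[E,W,E] (qD \<cdot>[W,D,E] a)
          \<oplus>[E,E] (b' \<cdot>[E,M,W] (m \<cdot>[M,D,W] jD)) \<cdot>[E,W,E] (qD \<cdot>[W,D,E] (m' \<cdot>[D,M,E] b)) = Ident C E"
          by (simp add: Comp_Ident_subst[OF mm'] E_sum)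
      qed simp_all
      show "arrow_summand2 E W G E Y Q"
      proof (rule arrow_summand2I)
        show "Q \<cdot>[E,Y,W] jY = (b' \<cdot>[E,M,E] b) \<cdot>[E,E,W] G" by (simp add: Q_def)
        show "G \<cdot>[E,W,Y] qY = Ident C E \<cdot>[E,E,Y] Q" by simp
        show "Q \<cdot>[E,Y,W] \<zero>[Y,W] = \<zero>[E,E] \<cdot>[E,E,W] G" by simp
        show "G \<cdot>[E,W,Y] \<zero>[W,Y] = \<zero>[E,E] \<cdot>[E,E,Y] Q" by simp
        show "jY \<cdot>[Y,W,Y] qY \<oplus>[Y,Y] \<zero>[Y,W] \<cdot>[Y,W,Y] \<zero>[W,Y] = Ident C Y" by simp
      qed simp_all
    qed simp_all
    show ?thesis by (rule derived_equivalent)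
  qed
qed

end

section \<open>The derived equivalence\<close>

theorem proposition5p1:
  fixes R :: "('r, 's) ring_scheme"
    and C :: "('o, 'm, 'r, 'z) tri_cat_scheme"
    and X M Y MY :: 'o
    and f g w :: 'm
  assumes "triangulated_category R C"
    and "Hom_finite R C"
    and "Krull_Schmidt C"
    and "AR_triangle C X M Y f g w"
    and "direct_sum C [M, Y] MY"
    and "\<not> in_add C MY (Sh C X)"
  shows "(\<forall>N\<in>Obj C.
            \<not> in_add C N X \<longrightarrow> \<not> in_add C N Y \<longrightarrow>
            \<not> in_add C N (Sh C X) \<longrightarrow> \<not> in_add C N (Sh_inv C Y) \<longrightarrow>
            (\<forall>V W. direct_sum C [N, M, X] V \<longrightarrow> direct_sum C [N, M, Y] W \<longrightarrow>
               derived_equivalent_via_tilting (End_ring C V) (End_ring C W))) \<and>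
         (\<forall>V W. direct_sum C [M, X] V \<longrightarrow> direct_sum C [M, Y] W \<longrightarrow>
            derived_equivalent_via_tilting (End_ring C V) (End_ring C W))"
proof -
  interpret triangulated_category R C by fact
  interpret AR_triangulated R C X M Y f g w
    by unfold_locales (use assms in auto)
  have nShX: "\<not> retract (Sh C X) M" "\<not> retract (Sh C X) Y"
  proof -
    from assms(5) obtain i p j q where "biproduct M Y MY i p j q" by (auto simp: direct_sum_2_iff)
    from biproduct_retract[OF this] assms(6) show "\<not> retract (Sh C X) M" "\<not> retract (Sh C X) Y"
      using retract_trans retract_imp_in_add by blast+
  qed
  define K where "K = Sh_inv C Y"
  have "\<exists>Z. Z \<in> Obj C \<and> iso_obj C (Sh C Z) Y"
    using Sh_ess_surj[of Y] by auto
  then have K [simp]: "K \<in> Obj C" and "iso_obj C (Sh C K) Y"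
    unfolding K_def Sh_inv_def by (metis (mono_tags, lifting) someI_ex)+
  then obtain c d where cd: "invertible (Sh C K) Y c d" by (auto simp: iso_obj_iff)
  have local_K: "local_obj K"
    using local_obj_iso[OF local_Y cd] by (simp add: local_obj_Sh_iff)
  have nK: "\<not> retract K M"
    by (rule desuspension_Y_not_retract[OF cd K nShX])
  have XY: "iso_obj C X Y \<or> (retract X M \<longleftrightarrow> retract Y M)"
    using retract_X_imp_retract_Y retract_Y_imp_retract_X iso_obj_sym[of Y X] by auto
  show ?thesis
  proof (intro conjI ballI allI impI)
    fix V W assume "direct_sum C [M, X] V" "direct_sum C [M, Y] W"
    then show "derived_equivalent_via_tilting (End_ring C V) (End_ring C W)"
      by (rule exchange_tilting[OF retract_refl[OF tri_closed(2)] _ _ nShX cd K nK XY])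
  next
    fix N V W
    assume [simp]: "N \<in> Obj C"
      and N: "\<not> in_add C N X" "\<not> in_add C N Y" "\<not> in_add C N (Sh C X)" "\<not> in_add C N (Sh_inv C Y)"
      and V: "direct_sum C [N, M, X] V" and W: "direct_sum C [N, M, Y] W"
    obtain D where D: "direct_sum C [N, M] D" using ex_direct_sum[of N M] by auto
    then obtain i p j q where b: "biproduct N M D i p j q" by (auto simp: direct_sum_2_iff)
    have M: "retract M D" by (rule biproduct_retract(2)[OF b])
    have D_iff: "retract Z D \<longleftrightarrow> retract Z M" if "local_obj Z" "\<not> in_add C N Z" for Z
      using local_retract_biproduct[OF that(1) b] retract_imp_in_add that(2) retract_trans[OF _ M]
      by blast
    show "derived_equivalent_via_tilting (End_ring C V) (End_ring C W)"
    proof (rule exchange_tilting[OF M direct_sum_3_assoc[OF V D] direct_sum_3_assoc[OF W D] _ nShX(2) cd K])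
      show "\<not> retract (Sh C X) D" using D_iff[OF local_ShX] N nShX by simp
      show "\<not> retract K D" using D_iff[OF local_K] N nK by (simp add: K_def)
      show "iso_obj C X Y \<or> (retract X D \<longleftrightarrow> retract Y D)"
        using XY D_iff[OF local_X] D_iff[OF local_Y] N by simp
    qed
  qed
qed

end
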